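(* Let $k\ge 2$ be an integer, $L>0$, and let $\mathcal{D}$ be a good probability distribution on $[0,1]^{k-1}$. Consider the continuous fragmentation process with $k$ parts started from $R$ living sticks of length $L$, in which each newly created stick is alive with probability $r=1/k$ and dead with probability $1-r$, the alive/dead statuses of all sticks being independent. Then, for every $R\ge1$, the process ends in finitely many levels with probability $1$, and for every base $B>1$ the collection of ending stick lengths converges to strong Benford behavior base $B$ as $R\to\infty$: if $P_R(s)$ is the proportion of ending sticks whose length has base-$B$ significand at most $s$, then for every $s\in[1,B)$, $$\lim_{R\to\infty}\mathbb{E}[P_R(s)]=\log_B s,\qquad \lim_{R\to\infty}\operatorname{Var}[P_R(s)]=0 .$$
   Context: Significand: for $B>1$, each $x>0$ is written uniquely as $x=S_B(x)B^{j}$ with $S_B(x)\in[1,B)$, $j\in\mathbb{Z}$; $S_B(x)$ is the significand. Convergence to strong Benford behavior of random finite collections (counted with multiplicity) is by definition the pair of limits displayed in the claim for all $s\in[1,B)$. Good distributions: let $\mathcal{D}$ be a probability distribution on $\mathbb{R}^d$ supported on $[0,1]^d$. For $X\sim\mathcal{D}$ let $\mathrm{rk}_i(X)$ be its $i$-th smallest coordinate ($1\le i\le d$), $\mathrm{rk}_0(X)=0$, $\mathrm{rk}_{d+1}(X)=1$. $\mathcal{D}$ is good if for all $0\le i\le d$ the random variable $\mathrm{rk}_{i+1}(X)-\mathrm{rk}_i(X)$ has a Hölder continuous density (a density being a function on $[0,\infty)$). Process: all $R$ initial sticks are alive. At each level every living stick, of length $\ell$ say, is broken into $k$ pieces of lengths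 $\ell(\mathrm{rk}_{i+1}(X)-\mathrm{rk}_i(X))$, $0\le i\le k-1$, where $X\sim\mathcal{D}$ is sampled independently for each living stick. Each new piece is then declared alive (it will be broken at the next level) or dead (it is never broken again). Statuses are independent of the cut points. The process ends when there are no living sticks; the ending sticks are then all the dead sticks. *)

theory Defs
  imports "HOL-Probability.Probability"
begin

text \<open>The value is unspecified, but the same for all arguments, when \<open>x \<le> 0\<close>.\<close>

definition significand :: "real \<Rightarrow> real \<Rightarrow> real" where
  "significand B x = (THE y. 1 \<le> y \<and> y < B \<and> (\<exists>j::int. x = y * B powi j))"

text \<open>A point of \<open>\<real>\<^sup>d\<close> is a function on \<open>{..<d}\<close>; \<open>rk d x i\<close> is its \<open>i\<close>-th smallest coordinate,
  counted from 1.\<close>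

definition rk :: "nat \<Rightarrow> (nat \<Rightarrow> real) \<Rightarrow> nat \<Rightarrow> real" where
  "rk d x i = (if i = 0 then 0 else if i \<le> d then sort (map x [0..<d]) ! (i - 1) else 1)"

definition gap :: "nat \<Rightarrow> (nat \<Rightarrow> real) \<Rightarrow> nat \<Rightarrow> real" where
  "gap d x i = rk d x (i + 1) - rk d x i"

definition distribution_on_cube :: "nat \<Rightarrow> (nat \<Rightarrow> real) measure \<Rightarrow> bool" where
  "distribution_on_cube d D \<longleftrightarrow>
     prob_space D \<and> sets D = sets (\<Pi>\<^sub>M i\<in>{..<d}. (borel :: real measure)) \<and>
     (AE x in D. \<forall>i<d. x i \<in> {0..1})"

definition holder_continuous_on :: "real set \<Rightarrow> (real \<Rightarrow> real) \<Rightarrow> bool" where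
  "holder_continuous_on S f \<longleftrightarrow>
     (\<exists>C \<alpha>. 0 < \<alpha> \<and> \<alpha> \<le> 1 \<and> (\<forall>x\<in>S. \<forall>y\<in>S. \<bar>f x - f y\<bar> \<le> C * \<bar>x - y\<bar> powr \<alpha>))"

text \<open>Densities are functions on \<open>[0, \<infinity>)\<close>: Hoelder continuity is required there, and in particular
  not across \<open>0\<close>.\<close>

definition good_distribution :: "nat \<Rightarrow> (nat \<Rightarrow> real) measure \<Rightarrow> bool" where
  "good_distribution d D \<longleftrightarrow> distribution_on_cube d D \<and>
     (\<forall>i\<le>d. \<exists>f. (\<forall>x\<ge>0. 0 \<le> f x) \<and> holder_continuous_on {0..} f \<and>
        distributed D lborel (\<lambda>x. gap d x i) (\<lambda>x. ennreal (f x * indicator {0..} x)))"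

text \<open>A potential stick is a pair \<open>(j, w)\<close> of the initial stick \<open>j\<close> it descends from and its address
  \<open>w\<close>; the \<open>i\<close>-th piece of \<open>(j, w)\<close> is \<open>(j, i # w)\<close>, and the level is \<open>length w\<close>. Cut points and
  statuses are attached to all potential sticks; those of sticks that never come into being are
  ignored. Initial sticks carry no status, as they are alive.\<close>

type_synonym stick = "nat \<times> nat list"

definition sticks :: "nat \<Rightarrow> nat \<Rightarrow> stick set" where
  "sticks k R = {..<R} \<times> lists {..<k}"

fun stick_length :: "nat \<Rightarrow> real \<Rightarrow> (stick \<Rightarrow> nat \<Rightarrow> real) \<Rightarrow> stick \<Rightarrow> real" where
  "stick_length k L x (j, []) = L"
| "stick_length k L x (j, i # w) = stick_length k L x (j, w) * gap (k - 1) (x (j, w)) i"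

fun living :: "(stick \<Rightarrow> bool) \<Rightarrow> stick \<Rightarrow> bool" where
  "living a (j, []) \<longleftrightarrow> True"
| "living a (j, i # w) \<longleftrightarrow> living a (j, w) \<and> a (j, i # w)"

fun dead :: "(stick \<Rightarrow> bool) \<Rightarrow> stick \<Rightarrow> bool" where
  "dead a (j, []) \<longleftrightarrow> False"
| "dead a (j, i # w) \<longleftrightarrow> living a (j, w) \<and> \<not> a (j, i # w)"

definition living_sticks :: "nat \<Rightarrow> nat \<Rightarrow> (stick \<Rightarrow> bool) \<Rightarrow> nat \<Rightarrow> stick set" where
  "living_sticks k R a n = {v \<in> sticks k R. length (snd v) = n \<and> living a v}"

text \<open>The lengths of the ending sticks, with multiplicity; \<open>{#}\<close> if there are infinitely many.\<close>

definition ending_lengths ::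
  "nat \<Rightarrow> nat \<Rightarrow> real \<Rightarrow> (stick \<Rightarrow> nat \<Rightarrow> real) \<Rightarrow> (stick \<Rightarrow> bool) \<Rightarrow> real multiset" where
  "ending_lengths k R L x a =
     image_mset (stick_length k L x) (mset_set {v \<in> sticks k R. dead a v})"

definition significand_proportion :: "real \<Rightarrow> real \<Rightarrow> real multiset \<Rightarrow> real" where
  "significand_proportion B s C = real (size {#l \<in># C. significand B l \<le> s#}) / real (size C)"

text \<open>The last conjunct says that the family of all cut points is independent of the family of all
  statuses.\<close>

definition fragmentation_process ::
  "nat \<Rightarrow> real \<Rightarrow> (nat \<Rightarrow> real) measure \<Rightarrow> nat \<Rightarrow> 'a measure \<Rightarrow>
   (stick \<Rightarrow> 'a \<Rightarrow> nat \<Rightarrow> real) \<Rightarrow> (stick \<Rightarrow> 'a \<Rightarrow> bool) \<Rightarrow> bool" where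
  "fragmentation_process k r D R M X A \<longleftrightarrow>
     (let V = sticks k R; W = {v \<in> V. snd v \<noteq> []} in
      prob_space M \<and>
      prob_space.indep_vars M (\<lambda>_. D) X V \<and>
      (\<forall>v\<in>V. distr M D (X v) = D) \<and>
      prob_space.indep_vars M (\<lambda>_. count_space UNIV) A W \<and>
      (\<forall>v\<in>W. measure M {\<omega> \<in> space M. A v \<omega>} = r) \<and>
      prob_space.indep_set M
        (sets (vimage_algebra (space M) (\<lambda>\<omega>. \<lambda>v\<in>V. X v \<omega>) (\<Pi>\<^sub>M v\<in>V. D)))
        (sets (vimage_algebra (space M) (\<lambda>\<omega>. \<lambda>v\<in>W. A v \<omega>) (\<Pi>\<^sub>M v\<in>W. count_space UNIV))))"

end

theory Submission
  imports Defs "HOL-Library.Sublist"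
begin

text \<open>Let \<open>g = log B s\<close>. By \<open>moments_bounded_by_square_error\<close> both limits follow once
  the mean of \<open>(P R - g)\<^sup>2\<close> tends to 0. As statuses are independent of cut points, the set \<open>F\<close> of
  ending sticks may be fixed and only the cut points averaged (\<open>nn_integral_independent_pair\<close>). The
  mean square is then the average over pairs \<open>v\<close>, \<open>v'\<close> in \<open>F\<close> of the correlation of
  \<open>below v - g\<close> and \<open>below v' - g\<close>, where \<open>below v\<close> indicates that the significand of the length of
  \<open>v\<close> is at most \<open>s\<close>.

  Such a correlation is small as soon as one of the two sticks, say \<open>v\<close>, has a long private tail: the
  last \<open>n\<close> cuts leading to it leave \<open>v'\<close> unaffected. Along the tail the logarithm of the length
  gains \<open>n\<close> independent summands. A gap has a density, so the Fourier coefficients of its logarithm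
  modulo 1, other than the zeroth, have modulus below 1 (\<open>phase_expectation_less_1\<close>). Those of the length
  of \<open>v\<close>, weighted by the factor for \<open>v'\<close>, hence decay geometrically in \<open>n\<close> (\<open>phase_decay\<close>), and
  Weyl's criterion in a form uniform over all probability spaces (\<open>weyl_arc\<close>) bounds the correlation
  (\<open>below_decorrelated\<close>).

  Two sticks of which neither has a private tail either both lie on low levels, or are close relatives
  (\<open>no_private_tails\<close>). There are at most \<open>(R * a)\<^sup>2 + b * card F\<close> such pairs, with \<open>a\<close> and
  \<open>b\<close> depending on \<open>n\<close> and \<open>k\<close> only. This is negligible against \<open>(card F)\<^sup>2\<close> because the
  branching is critical: every level of a tree after the initial one contains \<open>k - 1\<close> dead sticks on average, so by
  Chebyshev's inequality the first \<open>m\<close> levels alone hold at least \<open>R * m / 2\<close> of them, with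
  probability tending to 1 as \<open>R\<close> grows, for any \<open>m\<close> (\<open>prob_few_dead\<close>).

  That the process ends is the extinction of a critical branching process: with every further
  level the probability \<open>q\<close> of surviving so far drops to at most \<open>q - q\<^sup>2 / k\<close>, so it tends
  to 0 (\<open>AE_extinction\<close>).\<close>

section \<open>Significands and fractional parts of logarithms\<close>

lemma significand_eq_powr_frac:
  assumes "B > 1" "x > 0"
  shows "significand B x = B powr frac (log B x)"
  unfolding significand_def
proof (rule the_equality)
  have "x = B powr (log B x)" using assms by simp
  also have "\<dots> = B powr (frac (log B x)) * B powr (of_int \<lfloor>log B x\<rfloor>)"
    by (simp add: frac_def flip: powr_add)
  also have "B powr (of_int \<lfloor>log B x\<rfloor>) = B powi \<lfloor>log B x\<rfloor>"
    using assms by (simp add: powr_real_of_int')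
  finally have "x = B powr frac (log B x) * B powi \<lfloor>log B x\<rfloor>" .
  moreover have "1 \<le> B powr frac (log B x)" using assms by (simp add: ge_one_powr_ge_zero)
  moreover have "B powr frac (log B x) < B"
    using powr_less_mono[of "frac (log B x)" 1 B] assms by (simp add: frac_lt_1)
  ultimately show "1 \<le> B powr frac (log B x) \<and> B powr frac (log B x) < B \<and>
      (\<exists>j. x = B powr frac (log B x) * B powi j)" by blast
next
  fix y assume y: "1 \<le> y \<and> y < B \<and> (\<exists>j. x = y * B powi j)"
  then obtain j where j: "x = y * B powi j" by auto
  have "log B x = log B y + of_int j"
    using j y assms by (simp add: log_mult powr_real_of_int'[symmetric])
  moreover have "0 \<le> log B y" "log B y < 1"
    using y assms by auto
  ultimately have "frac (log B x) = log B y" unfolding frac_unique_iff by simp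
  thus "y = B powr frac (log B x)" using y assms by simp
qed

lemma significand_le_iff:
  assumes "B > 1" "x > 0" "1 \<le> s"
  shows "significand B x \<le> s \<longleftrightarrow> frac (log B x) \<le> log B s"
proof -
  have "B powr log B s = s" using assms by (intro powr_log_cancel) auto
  hence "significand B x \<le> s \<longleftrightarrow> B powr frac (log B x) \<le> B powr log B s"
    using significand_eq_powr_frac[of B x] assms by (metis (no_types))
  also have "\<dots> \<longleftrightarrow> frac (log B x) \<le> log B s" using assms by (intro powr_le_cancel_iff) auto
  finally show ?thesis .
qed

lemma significand_nonpos:
  assumes "B > 1" "x \<le> 0"
  shows "significand B x = (THE y. False)"
proof -
  have "(1 \<le> y \<and> y < B \<and> (\<exists>j::int. x = y * B powi j)) = False" for y
    unfolding eq_False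
  proof
    assume "1 \<le> y \<and> y < B \<and> (\<exists>j::int. x = y * B powi j)"
    then obtain j where "x = y * B powi j" "1 \<le> y" by auto
    moreover have "B powi j > 0" using assms by simp
    ultimately have "x > 0" by simp
    thus False using assms by simp
  qed
  thus ?thesis unfolding significand_def by (simp only:)
qed

text \<open>Away from the positive reals the significand takes a single unspecified value, which does
  not spoil measurability.\<close>

lemma borel_significand_le:
  assumes "B > 1" "1 \<le> s"
  shows "{x. significand B x \<le> s} \<in> sets borel"
proof -
  have "{x. significand B x \<le> s} = {x. 0 < x \<and> frac (log B x) \<le> log B s} \<union>
     {x. x \<le> 0 \<and> (THE y::real. False) \<le> s}"
  proof (intro set_eqI)
    fix x
    show "x \<in> {x. significand B x \<le> s} \<longleftrightarrow> x \<in> {x. 0 < x \<and> frac (log B x) \<le> log B s} \<union>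
     {x. x \<le> 0 \<and> (THE y::real. False) \<le> s}"
      using significand_le_iff[of B x s] significand_nonpos[of B x] assms
      by (cases "0 < x") (simp_all only: mem_Collect_eq Un_iff, auto)
  qed
  also have "\<dots> \<in> sets borel" unfolding frac_def by measurable
  finally show ?thesis .
qed

section \<open>Trigonometric polynomials and arcs of the circle\<close>

definition circle_mean :: "(complex \<Rightarrow> 'b::euclidean_space) \<Rightarrow> 'b" where
  "circle_mean f = integral {0..1} (\<lambda>u. f (cis (2 * pi * u)))"

lemma circle_mean_powi:
  assumes "m \<noteq> 0"
  shows "((\<lambda>u. cis (2 * pi * u) powi m) has_integral 0) {0..1}"
proof -
  define F :: "real \<Rightarrow> complex" where "F = (\<lambda>u. cis (2 * pi * of_int m * u) / (2 * pi * \<i> * of_int m))"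
  have d: "(F has_vector_derivative cis (2 * pi * of_int m * u)) (at u within {0..1})" for u
  proof -
    have "((\<lambda>u. exp (\<i> * of_real (2 * pi * of_int m) * of_real u) / (2 * pi * \<i> * of_int m)) has_vector_derivative
        exp (\<i> * of_real (2 * pi * of_int m) * of_real u)) (at u within {0..1})"
      using assms by (auto intro!: derivative_eq_intros has_vector_derivative_real_field simp: field_simps)
    thus ?thesis unfolding F_def cis_conv_exp by (simp add: mult.assoc)
  qed
  have "((\<lambda>u. cis (2 * pi * of_int m * u)) has_integral (F 1 - F 0)) {0..1}"
    by (rule fundamental_theorem_of_calculus) (use d in auto)
  moreover have "F 1 = F 0" unfolding F_def
    by (simp add: cis_multiple_2pi)
  ultimately show ?thesis by (simp add: cis_power_int mult_ac)
qed

text \<open>Sums of monomials, so that a property linear in the function has to be checked on monomials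
  only. Negative exponents stand for the powers of the conjugate, on the unit circle.\<close>

inductive trig_polynomial :: "(complex \<Rightarrow> complex) \<Rightarrow> bool" where
  monomial: "trig_polynomial (\<lambda>z. c * z powi m)"
| add: "trig_polynomial f \<Longrightarrow> trig_polynomial g \<Longrightarrow> trig_polynomial (\<lambda>z. f z + g z)"

lemma trig_polynomial_integrable:
  assumes "trig_polynomial f"
  shows "(\<lambda>u. f (cis (2 * pi * u))) integrable_on {0..1}"
  using assms
proof (rule trig_polynomial.induct)
  fix c :: complex and m :: int
  show "(\<lambda>u. c * cis (2 * pi * u) powi m) integrable_on {0..1}"
    unfolding cis_power_int by (intro integrable_continuous_real continuous_intros)
qed (rule integrable_add)

lemma trig_polynomial_measurable:
  assumes "trig_polynomial f" shows "f \<in> borel_measurable borel"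
  using assms
proof (rule trig_polynomial.induct)
  fix c :: complex and m :: int
  show "(\<lambda>z. c * z powi m) \<in> borel_measurable borel"
    unfolding power_int_def by measurable
qed (rule borel_measurable_add)

lemma trig_polynomial_bounded:
  assumes "trig_polynomial f"
  shows "\<exists>C. \<forall>z. norm z = 1 \<longrightarrow> norm (f z) \<le> C"
  using assms
proof (rule trig_polynomial.induct)
  fix c :: complex and m :: int
  show "\<exists>C. \<forall>z. norm z = 1 \<longrightarrow> norm (c * z powi m) \<le> C"
    by (intro exI[of _ "norm c"]) (auto simp: norm_mult norm_power_int)
next
  fix f g :: "complex \<Rightarrow> complex"
  assume "\<exists>C. \<forall>z. norm z = 1 \<longrightarrow> norm (f z) \<le> C" "\<exists>C. \<forall>z. norm z = 1 \<longrightarrow> norm (g z) \<le> C"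
  then obtain C C' where "\<forall>z. norm z = 1 \<longrightarrow> norm (f z) \<le> C" "\<forall>z. norm z = 1 \<longrightarrow> norm (g z) \<le> C'" by blast
  thus "\<exists>C. \<forall>z. norm z = 1 \<longrightarrow> norm (f z + g z) \<le> C"
    by (intro exI[of _ "C + C'"]) (meson add_mono norm_triangle_ineq order_trans)
qed

lemma trig_polynomial_mult:
  assumes "trig_polynomial f" "trig_polynomial g"
  shows "\<exists>h. trig_polynomial h \<and> (\<forall>z. norm z = 1 \<longrightarrow> h z = f z * g z)"
  using assms(1)
proof induction
  case (monomial c m)
  show ?case using assms(2)
  proof induction
    case (monomial d l)
    have "z powi (m + l) = z powi m * z powi l" if "norm z = 1" for z :: complex
      using that by (intro power_int_add) auto
    thus ?case
      by (intro exI[of _ "\<lambda>z. (c * d) * z powi (m + l)"] conjI trig_polynomial.monomial) auto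
  next
    case (add f g)
    then obtain h h' where "trig_polynomial h" "trig_polynomial h'"
      "\<forall>z. norm z = 1 \<longrightarrow> h z = c * z powi m * f z" "\<forall>z. norm z = 1 \<longrightarrow> h' z = c * z powi m * g z" by blast
    thus ?case
      by (intro exI[of _ "\<lambda>z. h z + h' z"] conjI trig_polynomial.add) (auto simp: algebra_simps)
  qed
next
  case (add f f')
  then obtain h h' where "trig_polynomial h" "trig_polynomial h'"
      "\<forall>z. norm z = 1 \<longrightarrow> h z = f z * g z" "\<forall>z. norm z = 1 \<longrightarrow> h' z = f' z * g z" by blast
  thus ?case
    by (intro exI[of _ "\<lambda>z. h z + h' z"] conjI trig_polynomial.add) (auto simp: algebra_simps)
qed

text \<open>On the unit circle \<open>Re z\<close> and \<open>Im z\<close> are combinations of \<open>z\<close> and its inverse. This makes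
  Stone--Weierstrass approximation by real polynomials an approximation by trigonometric polynomials.\<close>

lemma real_polynomial_is_trig_polynomial:
  fixes p :: "complex \<Rightarrow> real"
  assumes "real_polynomial_function p"
  shows "\<exists>h. trig_polynomial h \<and> (\<forall>z. norm z = 1 \<longrightarrow> h z = of_real (p z))"
  using assms
proof induction
  case (linear f)
  interpret bounded_linear f by fact
  define a where "a = complex_of_real (f 1)"
  define b where "b = complex_of_real (f \<i>)"
  have f: "complex_of_real (f z) = Re z * a + Im z * b" for z
  proof -
    have "f z = f (Re z *\<^sub>R 1 + Im z *\<^sub>R \<i>)" by (rule arg_cong[of _ _ f]) (simp add: complex_eq_iff)
    also have "\<dots> = Re z * f 1 + Im z * f \<i>" by (simp add: add scaleR)
    finally show ?thesis by (simp add: a_def b_def)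
  qed
  have "((a - \<i> * b) / 2) * z powi 1 + ((a + \<i> * b) / 2) * z powi (-1) = of_real (f z)"
    if "norm z = 1" for z
  proof -
    have inv: "inverse z = cnj z"
      using that by (metis complex_div_cnj complex_norm_square div_by_1 inverse_eq_divide mult_cancel_right2 mult_1 of_real_1 power_one)
    have "(a - \<i> * b) / 2 * z + (a + \<i> * b) / 2 * cnj z = a * ((z + cnj z) / 2) + b * ((z - cnj z) / (2 * \<i>))"
      by (simp add: field_simps)
    also have "(z + cnj z) / 2 = of_real (Re z)" by (simp add: complex_eq_iff)
    also have "(z - cnj z) / (2 * \<i>) = of_real (Im z)" by (simp add: complex_eq_iff)
    finally show ?thesis by (simp add: power_int_minus inv f mult.commute)
  qed
  thus ?case
    by (intro exI[of _ "\<lambda>z. ((a - \<i> * b) / 2) * z powi 1 + ((a + \<i> * b) / 2) * z powi (-1)"] conjI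
        trig_polynomial.intros) auto
next
  case (const c)
  show ?case by (intro exI[of _ "\<lambda>z. of_real c * z powi 0"] conjI trig_polynomial.intros) auto
next
  case (add f g)
  then obtain h h' where "trig_polynomial h" "trig_polynomial h'"
    "\<forall>z. norm z = 1 \<longrightarrow> h z = of_real (f z)" "\<forall>z. norm z = 1 \<longrightarrow> h' z = of_real (g z)" by blast
  thus ?case
    by (intro exI[of _ "\<lambda>z. h z + h' z"] conjI trig_polynomial.add) (auto simp: algebra_simps)
next
  case (mult f g)
  then obtain h h' where h: "trig_polynomial h" "trig_polynomial h'"
    "\<forall>z. norm z = 1 \<longrightarrow> h z = of_real (f z)" "\<forall>z. norm z = 1 \<longrightarrow> h' z = of_real (g z)" by blast
  obtain h'' where "trig_polynomial h''" "\<forall>z. norm z = 1 \<longrightarrow> h'' z = h z * h' z"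
    using trig_polynomial_mult[OF h(1,2)] by blast
  thus ?case using h by (intro exI[of _ h'']) auto
qed

definition arc :: "real \<Rightarrow> real \<Rightarrow> complex set" where
  "arc a b = (\<lambda>u. cis (2 * pi * u)) ` {a..b}"

lemma compact_arc: "compact (arc a b)"
  unfolding arc_def by (intro compact_continuous_image continuous_intros) auto

lemma cis_eq_iff_frac: "cis (2 * pi * u) = cis (2 * pi * v) \<longleftrightarrow> frac u = frac v"
proof -
  have "cis (2 * pi * u) = cis (2 * pi * v) \<longleftrightarrow> (\<exists>n::int. u = v + of_int n)"
  proof -
    have "cis (2 * pi * u) = cis (2 * pi * v) \<longleftrightarrow> cos (2 * pi * u) = cos (2 * pi * v) \<and> sin (2 * pi * u) = sin (2 * pi * v)"
      by (auto simp: complex_eq_iff)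
    also have "\<dots> \<longleftrightarrow> (\<exists>n::int. 2 * pi * u = 2 * pi * v + 2 * pi * of_int n)"
      using sin_cos_eq_iff[of "2 * pi * u" "2 * pi * v"] by auto
    also have "\<dots> \<longleftrightarrow> (\<exists>n::int. u = v + of_int n)"
      by (simp flip: distrib_left)
    finally show ?thesis .
  qed
  also have "\<dots> \<longleftrightarrow> frac u = frac v"
  proof
    assume "frac u = frac v"
    hence "u = v + of_int (\<lfloor>u\<rfloor> - \<lfloor>v\<rfloor>)" by (simp add: frac_def algebra_simps)
    thus "\<exists>n::int. u = v + of_int n" by blast
  qed auto
  finally show ?thesis .
qed

lemma cis_in_arc_iff:
  assumes "0 \<le> g" "g < 1"
  shows "cis (2 * pi * u) \<in> arc 0 g \<longleftrightarrow> frac u \<le> g"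
proof
  assume "cis (2 * pi * u) \<in> arc 0 g"
  then obtain v where v: "0 \<le> v" "v \<le> g" "frac u = frac v"
    unfolding arc_def using cis_eq_iff_frac by auto
  moreover have "frac v = v" using v assms by (simp add: frac_eq)
  ultimately show "frac u \<le> g" by simp
next
  assume "frac u \<le> g"
  moreover have "cis (2 * pi * u) = cis (2 * pi * frac u)"
    by (simp add: cis_eq_iff_frac frac_eq frac_lt_1)
  ultimately show "cis (2 * pi * u) \<in> arc 0 g" unfolding arc_def by auto
qed

text \<open>The values 0 and 1 of \<open>u\<close> are left out because both name the point 1, which is an end point of
  the arc.\<close>

lemma cis_in_arc_iff_complement:
  assumes "0 \<le> g" "g < 1" "0 < u" "u < 1"
  shows "cis (2 * pi * u) \<in> arc g 1 \<longleftrightarrow> g \<le> u"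
proof
  assume "cis (2 * pi * u) \<in> arc g 1"
  then obtain v where v: "g \<le> v" "v \<le> 1" "frac u = frac v"
    unfolding arc_def using cis_eq_iff_frac by auto
  show "g \<le> u"
  proof (cases "v = 1")
    case True
    thus ?thesis using v assms by (metis frac_1_eq frac_eq frac_of_int less_irrefl add_0 less_eq_real_def of_int_1)
  next
    case False
    hence "frac v = v" using v assms by (simp add: frac_eq)
    moreover have "frac u = u" using assms by (simp add: frac_eq)
    ultimately show ?thesis using v by simp
  qed
qed (use assms in \<open>auto simp: arc_def\<close>)

text \<open>These ramps are continuous, vanish on the closed set \<open>S\<close> and increase to the indicator of its
  complement.\<close>

lemma infdist_ramp_tendsto:
  assumes "closed S" "S \<noteq> {}"
  shows "(\<lambda>n. min 1 (real n * infdist z S)) \<longlonglongrightarrow> of_bool (z \<notin> S)"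
proof (cases "z \<in> S")
  case False
  hence pos: "infdist z S > 0"
    using assms by (metis in_closed_iff_infdist_zero infdist_nonneg less_eq_real_def)
  obtain N where N: "inverse (infdist z S) < real N" using reals_Archimedean2 by blast
  have "\<forall>\<^sub>F n in sequentially. min 1 (real n * infdist z S) = 1"
    using eventually_ge_at_top[of N]
  proof eventually_elim
    case (elim n)
    have "1 = inverse (infdist z S) * infdist z S" using pos by simp
    also have "\<dots> \<le> real n * infdist z S" using N elim pos by (intro mult_right_mono) auto
    finally show ?case by simp
  qed
  thus ?thesis using False by (simp add: tendsto_eventually)
qed simp

lemma circle_mean_ramp:
  assumes "closed S" "S \<noteq> {}"
    and "((\<lambda>u. of_bool (cis (2 * pi * u) \<notin> S)) has_integral c) {0..1}"
  shows "(\<lambda>n. circle_mean (\<lambda>z. min 1 (real n * infdist z S))) \<longlonglongrightarrow> c"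
proof -
  have "(\<lambda>n. integral {0..1} (\<lambda>u. min 1 (real n * infdist (cis (2 * pi * u)) S))) \<longlonglongrightarrow>
      integral {0..1} (\<lambda>u. of_bool (cis (2 * pi * u) \<notin> S))"
  proof (rule dominated_convergence(2)[where h = "\<lambda>_. 1"])
    show "(\<lambda>u. min 1 (real n * infdist (cis (2 * pi * u)) S)) integrable_on {0..1}" for n
      by (intro integrable_continuous_real continuous_intros)
    show "(\<lambda>n. min 1 (real n * infdist (cis (2 * pi * u)) S)) \<longlonglongrightarrow> of_bool (cis (2 * pi * u) \<notin> S)" for u
      by (rule infdist_ramp_tendsto) fact+
      show "norm (min 1 (real n * infdist (cis (2 * pi * u)) S)) \<le> 1" for n u
      using mult_nonneg_nonneg[OF of_nat_0_le_iff[of n] infdist_nonneg[of "cis (2 * pi * u)" S]]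
      by (simp add: min_def)
  qed auto
  thus ?thesis using assms(3) by (simp add: circle_mean_def integral_unique)
qed

text \<open>The minorant is a ramp away from the complementary closed arc, and the majorant is 1 minus a ramp
  away from the arc itself. As the ramps get steeper, dominated convergence makes both means tend to
  the length \<open>g\<close>, since the two closed arcs share only end points.\<close>

lemma arc_sandwich:
  assumes g: "0 \<le> g" "g < 1" and e: "0 < e"
  obtains f f' :: "complex \<Rightarrow> real"
  where "continuous_on UNIV f" "continuous_on UNIV f'"
    and "\<And>z. norm z = 1 \<Longrightarrow> f z \<le> of_bool (z \<in> arc 0 g)"
    and "\<And>z. norm z = 1 \<Longrightarrow> of_bool (z \<in> arc 0 g) \<le> f' z"
    and "\<bar>circle_mean f - g\<bar> \<le> e" "\<bar>circle_mean f' - g\<bar> \<le> e"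
proof -
  have cl: "closed (arc 0 g)" "closed (arc g 1)" "arc 0 g \<noteq> {}" "arc g 1 \<noteq> {}"
    using compact_arc compact_imp_closed g by (auto simp: arc_def)
  have spike: "((\<lambda>u. of_bool (u < g)) has_integral g) {0..1::real}"
    "((\<lambda>u. of_bool (g < u)) has_integral (1 - g)) {0..1::real}"
  proof -
    have "((\<lambda>u. 1::real) has_integral g) {0..g}" using g has_integral_const_real[of "1::real" 0 g] by simp
    hence "((\<lambda>u. if u \<in> {0..g} then 1 else 0::real) has_integral g) {0..1}"
      using g by (subst has_integral_restrict) auto
    thus "((\<lambda>u. of_bool (u < g)) has_integral g) {0..1::real}"
      by (rule has_integral_spike_finite[where S = "{0, g, 1}", rotated 2]) auto
    have "((\<lambda>u. 1::real) has_integral (1 - g)) {g..1}" using g has_integral_const_real[of "1::real" g 1] by simp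
    hence "((\<lambda>u. if u \<in> {g..1} then 1 else 0::real) has_integral (1 - g)) {0..1}"
      using g by (subst has_integral_restrict) auto
    thus "((\<lambda>u. of_bool (g < u)) has_integral (1 - g)) {0..1::real}"
      by (rule has_integral_spike_finite[where S = "{0, g, 1}", rotated 2]) auto
  qed
  have "((\<lambda>u. of_bool (cis (2 * pi * u) \<notin> arc g 1)) has_integral g) {0..1::real}"
    by (rule has_integral_spike_finite[OF _ _ spike(1), where S = "{0, 1}"])
       (use g in \<open>auto simp: cis_in_arc_iff_complement not_le\<close>)
  from circle_mean_ramp[OF cl(2,4) this]
  obtain n where n: "\<bar>circle_mean (\<lambda>z. min 1 (real n * infdist z (arc g 1))) - g\<bar> < e"
    using e unfolding lim_sequentially dist_real_def by blast
  have "((\<lambda>u. of_bool (cis (2 * pi * u) \<notin> arc 0 g)) has_integral (1 - g)) {0..1::real}"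
    by (rule has_integral_spike_finite[OF _ _ spike(2), where S = "{0, 1}"])
       (use g in \<open>auto simp: cis_in_arc_iff not_le frac_eq\<close>)
  from circle_mean_ramp[OF cl(1,3) this]
  obtain n' where n': "\<bar>circle_mean (\<lambda>z. min 1 (real n' * infdist z (arc 0 g))) - (1 - g)\<bar> < e"
    using e unfolding lim_sequentially dist_real_def by blast
  define f where "f = (\<lambda>z. min 1 (real n * infdist z (arc g 1)))"
  define f' where "f' = (\<lambda>z. 1 - min 1 (real n' * infdist z (arc 0 g)))"
  have "(\<lambda>u. min 1 (real n' * infdist (cis (2 * pi * u)) (arc 0 g))) integrable_on {0..1}"
    by (intro integrable_continuous_real continuous_intros)
  hence "circle_mean f' = 1 - circle_mean (\<lambda>z. min 1 (real n' * infdist z (arc 0 g)))"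
    unfolding circle_mean_def f'_def by (subst integral_diff) (auto intro: integrable_on_const)
  hence 1: "\<bar>circle_mean f' - g\<bar> \<le> e" using n' by linarith
  have cover: "z \<in> arc 0 g \<or> z \<in> arc g 1" if "norm z = 1" for z
  proof -
    obtain u where z: "z = cis (2 * pi * u)"
    proof (rule that[of "Arg z / (2 * pi)"])
      show "z = cis (2 * pi * (Arg z / (2 * pi)))" using \<open>norm z = 1\<close>
        by (metis cis_Arg_unique cis_Arg norm_zero zero_neq_one sgn_div_norm scaleR_one inverse_1
            nonzero_mult_div_cancel_left pi_neq_zero mult_eq_0_iff zero_neq_numeral times_divide_eq_right)
    qed
    hence "z = cis (2 * pi * frac u)" by (simp add: cis_eq_iff_frac frac_eq frac_lt_1)
    moreover have "0 \<le> frac u" "frac u \<le> 1" by (simp_all add: frac_lt_1 less_imp_le)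
    ultimately show ?thesis unfolding arc_def by (cases "frac u \<le> g") auto
  qed
  show ?thesis
  proof (rule that[of f f'])
    show "f z \<le> of_bool (z \<in> arc 0 g)" if "norm z = 1" for z
      using cover[OF that] by (auto simp: f_def of_bool_def)
    show "of_bool (z \<in> arc 0 g) \<le> f' z" if "norm z = 1" for z
      by (auto simp: f'_def of_bool_def)
    show "\<bar>circle_mean f - g\<bar> \<le> e" using n by (simp add: f_def)
  qed (use 1 in \<open>auto simp: f_def f'_def intro!: continuous_intros\<close>)
qed

section \<open>A quantitative Weyl criterion\<close>

text \<open>The weight \<open>\<psi>\<close> is whatever is observed together with the point \<open>Z\<close> of the circle; the
  weight 1 leaves the plain law of \<open>Z\<close>.\<close>

definition weighted_phase :: "'a measure \<Rightarrow> ('a \<Rightarrow> complex) \<Rightarrow> ('a \<Rightarrow> real) \<Rightarrow> bool" where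
  "weighted_phase M Z \<psi> \<longleftrightarrow> prob_space M \<and> Z \<in> borel_measurable M \<and> (\<forall>\<omega>. norm (Z \<omega>) = 1) \<and>
     \<psi> \<in> borel_measurable M \<and> (\<forall>\<omega>. \<bar>\<psi> \<omega>\<bar> \<le> 1)"

definition small_phases :: "nat \<Rightarrow> real \<Rightarrow> 'a measure \<Rightarrow> ('a \<Rightarrow> complex) \<Rightarrow> ('a \<Rightarrow> real) \<Rightarrow> bool" where
  "small_phases N \<delta> M Z \<psi> \<longleftrightarrow>
     (\<forall>m::int. 0 < \<bar>m\<bar> \<and> \<bar>m\<bar> \<le> int N \<longrightarrow> norm (\<integral>\<omega>. Z \<omega> powi m * of_real (\<psi> \<omega>) \<partial>M) \<le> \<delta>)"

lemma small_phases_mono: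
  "small_phases N \<delta> M Z \<psi> \<Longrightarrow> N' \<le> N \<Longrightarrow> \<delta> \<le> \<delta>' \<Longrightarrow> small_phases N' \<delta>' M Z \<psi>"
  unfolding small_phases_def by (meson of_nat_mono order_trans)

lemma norm_integral_le:
  fixes f :: "'a \<Rightarrow> 'b::{banach, second_countable_topology}"
  assumes "integrable M f" "integrable M g" "\<And>x. x \<in> space M \<Longrightarrow> norm (f x) \<le> g x"
  shows "norm (\<integral>x. f x \<partial>M) \<le> (\<integral>x. g x \<partial>M)"
  by (rule order_trans[OF integral_norm_bound integral_mono]) (use assms in auto)

lemma weighted_phase_integrable:
  fixes f :: "complex \<Rightarrow> 'b::{banach, second_countable_topology, real_normed_field}"
  assumes "weighted_phase M Z \<psi>" "f \<in> borel_measurable borel" "\<And>z. norm z = 1 \<Longrightarrow> norm (f z) \<le> C"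
  shows "integrable M (\<lambda>\<omega>. (f (Z \<omega>) - c) * of_real (\<psi> \<omega>))"
proof -
  interpret prob_space M using assms(1) by (simp add: weighted_phase_def)
  have [measurable]: "Z \<in> borel_measurable M" "\<psi> \<in> borel_measurable M" "f \<in> borel_measurable borel"
    using assms by (auto simp: weighted_phase_def)
  show ?thesis
  proof (rule integrable_const_bound[where B = "C + norm c"])
    show "AE \<omega> in M. norm ((f (Z \<omega>) - c) * of_real (\<psi> \<omega>)) \<le> C + norm c"
    proof (rule AE_I2)
      fix \<omega>
      have "norm ((f (Z \<omega>) - c) * of_real (\<psi> \<omega>)) = norm (f (Z \<omega>) - c) * \<bar>\<psi> \<omega>\<bar>"
        by (simp add: norm_mult)
      also have "\<dots> \<le> norm (f (Z \<omega>) - c) * 1"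
        using assms(1) by (intro mult_left_mono) (auto simp: weighted_phase_def)
      also have "\<dots> \<le> norm (f (Z \<omega>)) + norm c" by (simp add: norm_triangle_ineq4)
      also have "\<dots> \<le> C + norm c" using assms(1,3) by (auto simp: weighted_phase_def)
      finally show "norm ((f (Z \<omega>) - c) * of_real (\<psi> \<omega>)) \<le> C + norm c" .
    qed
    show "(\<lambda>\<omega>. (f (Z \<omega>) - c) * of_real (\<psi> \<omega>)) \<in> borel_measurable M"
      by measurable
  qed
qed

text \<open>Weyl's criterion is stated with an explicit order \<open>N\<close> and tolerance \<open>\<delta>\<close> chosen before
  the probability space. This uniformity is what the application needs: the space changes with the
  number of initial sticks.\<close>

lemma weyl_trig_polynomial:
  assumes "trig_polynomial f" "0 < e"
  shows "\<exists>N \<delta>. 0 < \<delta> \<and> (\<forall>(M :: 'a measure) Z \<psi>. weighted_phase M Z \<psi> \<longrightarrow> small_phases N \<delta> M Z \<psi> \<longrightarrow>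
            norm (\<integral>\<omega>. (f (Z \<omega>) - circle_mean f) * of_real (\<psi> \<omega>) \<partial>M) \<le> e)"
  using assms
proof (induction arbitrary: e)
  case (monomial c m)
  show ?case
  proof (cases "m = 0")
    case True
    thus ?thesis using monomial by (intro exI[of _ "0::nat"] exI[of _ "1::real"]) (auto simp: circle_mean_def)
  next
    case False
    have "circle_mean (\<lambda>z. c * z powi m) = c * 0"
      unfolding circle_mean_def by (intro integral_unique has_integral_mult_right circle_mean_powi False)
    moreover have "norm (\<integral>\<omega>. c * Z \<omega> powi m * of_real (\<psi> \<omega>) \<partial>M) \<le> e"
      if "small_phases (nat \<bar>m\<bar>) (e / (norm c + 1)) M Z \<psi>" for M :: "'a measure" and Z \<psi>
    proof -
      have le: "norm (\<integral>\<omega>. Z \<omega> powi m * of_real (\<psi> \<omega>) \<partial>M) \<le> e / (norm c + 1)"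
        using that False by (auto simp: small_phases_def)
      have "norm (\<integral>\<omega>. c * Z \<omega> powi m * of_real (\<psi> \<omega>) \<partial>M) = norm (c * (\<integral>\<omega>. Z \<omega> powi m * of_real (\<psi> \<omega>) \<partial>M))"
        by (simp add: mult.assoc)
      also have "\<dots> \<le> norm c * (e / (norm c + 1))"
        unfolding norm_mult using le by (intro mult_left_mono) auto
      also have "\<dots> \<le> e" using \<open>0 < e\<close> norm_ge_zero[of c]
        by (simp add: divide_simps add_nonneg_pos)
      finally show ?thesis .
    qed
    moreover have "0 < e / (norm c + 1)" using \<open>0 < e\<close> by (simp add: add_nonneg_pos)
    ultimately show ?thesis
      by (intro exI[of _ "nat \<bar>m\<bar>"] exI[of _ "e / (norm c + 1)"]) simp
  qed
next
  case (add f g)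
  have half: "0 < e / 2" using add.prems by simp
  obtain N \<delta> where 1: "0 < \<delta>" "\<And>M Z \<psi>. weighted_phase (M::'a measure) Z \<psi> \<Longrightarrow> small_phases N \<delta> M Z \<psi> \<Longrightarrow>
            norm (\<integral>\<omega>. (f (Z \<omega>) - circle_mean f) * of_real (\<psi> \<omega>) \<partial>M) \<le> e / 2"
    using add.IH(1)[OF half] by blast
  obtain N' \<delta>' where 2: "0 < \<delta>'" "\<And>M Z \<psi>. weighted_phase (M::'a measure) Z \<psi> \<Longrightarrow> small_phases N' \<delta>' M Z \<psi> \<Longrightarrow>
            norm (\<integral>\<omega>. (g (Z \<omega>) - circle_mean g) * of_real (\<psi> \<omega>) \<partial>M) \<le> e / 2"
    using add.IH(2)[OF half] by blast
  have mean: "circle_mean (\<lambda>z. f z + g z) = circle_mean f + circle_mean g"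
    unfolding circle_mean_def by (intro integral_add trig_polynomial_integrable add.hyps)
  have "norm (\<integral>\<omega>. (f (Z \<omega>) + g (Z \<omega>) - (circle_mean f + circle_mean g)) * of_real (\<psi> \<omega>) \<partial>M) \<le> e"
    if w: "weighted_phase M Z \<psi>" and s: "small_phases (max N N') (min \<delta> \<delta>') M Z \<psi>" for M :: "'a measure" and Z \<psi>
  proof -
    obtain C where C: "\<And>z. norm z = 1 \<Longrightarrow> norm (f z) \<le> C" using trig_polynomial_bounded[OF add.hyps(1)] by blast
    obtain C' where C': "\<And>z. norm z = 1 \<Longrightarrow> norm (g z) \<le> C'" using trig_polynomial_bounded[OF add.hyps(2)] by blast
    note i = weighted_phase_integrable[OF w trig_polynomial_measurable[OF add.hyps(1)] C]
    note i' = weighted_phase_integrable[OF w trig_polynomial_measurable[OF add.hyps(2)] C']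
    have "(\<integral>\<omega>. (f (Z \<omega>) + g (Z \<omega>) - (circle_mean f + circle_mean g)) * of_real (\<psi> \<omega>) \<partial>M) =
       (\<integral>\<omega>. (f (Z \<omega>) - circle_mean f) * of_real (\<psi> \<omega>) + (g (Z \<omega>) - circle_mean g) * of_real (\<psi> \<omega>) \<partial>M)"
      by (simp add: algebra_simps)
    also have "\<dots> = (\<integral>\<omega>. (f (Z \<omega>) - circle_mean f) * of_real (\<psi> \<omega>) \<partial>M) + (\<integral>\<omega>. (g (Z \<omega>) - circle_mean g) * of_real (\<psi> \<omega>) \<partial>M)"
      by (rule Bochner_Integration.integral_add[OF i i'])
    also have "norm \<dots> \<le> e / 2 + e / 2"
      by (intro norm_triangle_le add_mono 1(2) 2(2) w small_phases_mono[OF s]) auto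
    finally show ?thesis by simp
  qed
  thus ?case unfolding mean using 1(1) 2(1)
    by (intro exI[of _ "max N N'"] exI[of _ "min \<delta> \<delta>'"]) auto
qed

lemma weyl_continuous:
  fixes f :: "complex \<Rightarrow> real"
  assumes f: "continuous_on UNIV f" and "0 < e"
  shows "\<exists>N \<delta>. 0 < \<delta> \<and> (\<forall>(M :: 'a measure) Z \<psi>. weighted_phase M Z \<psi> \<longrightarrow> small_phases N \<delta> M Z \<psi> \<longrightarrow>
            \<bar>\<integral>\<omega>. (f (Z \<omega>) - circle_mean f) * \<psi> \<omega> \<partial>M\<bar> \<le> e)"
proof -
  obtain p where p: "real_polynomial_function p" "\<And>z. z \<in> sphere 0 1 \<Longrightarrow> \<bar>f z - p z\<bar> < e / 3"
    using Stone_Weierstrass_real_polynomial_function[of "sphere (0::complex) 1" f "e / 3"]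
      continuous_on_subset[OF f] \<open>0 < e\<close> by auto
  obtain h where h: "trig_polynomial h" "\<And>z. norm z = 1 \<Longrightarrow> h z = of_real (p z)"
    using real_polynomial_is_trig_polynomial[OF p(1)] by blast
  have close: "norm (of_real (f z) - h z) \<le> e / 3" if "norm z = 1" for z
    using p(2)[of z] h(2)[of z] that by (simp flip: of_real_diff)
  obtain N \<delta> where N: "0 < \<delta>" "\<And>M Z \<psi>. weighted_phase (M::'a measure) Z \<psi> \<Longrightarrow> small_phases N \<delta> M Z \<psi> \<Longrightarrow>
            norm (\<integral>\<omega>. (h (Z \<omega>) - circle_mean h) * of_real (\<psi> \<omega>) \<partial>M) \<le> e / 3"
    using weyl_trig_polynomial[OF h(1), of "e / 3"] \<open>0 < e\<close> by auto
  have cf: "continuous_on {0..1} (\<lambda>u. f (cis (2 * pi * u)))"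
    by (intro continuous_on_compose2[OF f] continuous_intros) auto
  have "((\<lambda>u. f (cis (2 * pi * u))) has_integral circle_mean f) {0..1}"
    unfolding circle_mean_def by (intro integrable_integral integrable_continuous_real cf)
  hence "((\<lambda>u. complex_of_real (f (cis (2 * pi * u)))) has_integral of_real (circle_mean f)) {0..1}"
    by (rule has_integral_of_real)
  moreover have "((\<lambda>u. h (cis (2 * pi * u))) has_integral circle_mean h) {0..1}"
    unfolding circle_mean_def by (intro integrable_integral trig_polynomial_integrable h)
  ultimately have "((\<lambda>u. complex_of_real (f (cis (2 * pi * u))) - h (cis (2 * pi * u))) has_integral
      (of_real (circle_mean f) - circle_mean h)) {0..1}"
    by (rule has_integral_diff)
  moreover have "norm (complex_of_real (f (cis (2 * pi * u))) - h (cis (2 * pi * u))) \<le> e / 3" for u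
    by (rule close) simp
  ultimately have "norm (of_real (circle_mean f) - circle_mean h) \<le> e / 3 * measure lborel {0..1::real}"
    using \<open>0 < e\<close> by (intro has_integral_bound_real[where S = "{}" and B = "e / 3"]) auto
  hence mean: "norm (of_real (circle_mean f) - circle_mean h) \<le> e / 3" by simp
  have "\<bar>\<integral>\<omega>. (f (Z \<omega>) - circle_mean f) * \<psi> \<omega> \<partial>M\<bar> \<le> e"
    if w: "weighted_phase M Z \<psi>" and s: "small_phases N \<delta> M Z \<psi>" for M :: "'a measure" and Z \<psi>
  proof -
    interpret prob_space M using w by (simp add: weighted_phase_def)
    obtain C where C: "\<And>z. norm z = 1 \<Longrightarrow> norm (h z) \<le> C" using trig_polynomial_bounded[OF h(1)] by blast
    note ih = weighted_phase_integrable[OF w trig_polynomial_measurable[OF h(1)] C]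
    have fC: "norm (complex_of_real (f z)) \<le> C + e / 3" if "norm z = 1" for z
      using C[OF that] close[OF that] norm_triangle_ineq2[of "complex_of_real (f z)" "h z"] by linarith
    have fm: "(\<lambda>z. complex_of_real (f z)) \<in> borel_measurable borel"
      using borel_measurable_continuous_onI[OF f] by simp
    note if' = weighted_phase_integrable[OF w fm fC]
    define a where "a = complex_of_real (circle_mean f)"
    have "complex_of_real (\<integral>\<omega>. (f (Z \<omega>) - circle_mean f) * \<psi> \<omega> \<partial>M) =
        (\<integral>\<omega>. (of_real (f (Z \<omega>)) - a) * of_real (\<psi> \<omega>) \<partial>M)"
      by (simp add: a_def flip: integral_complex_of_real)
    also have "(\<integral>\<omega>. (of_real (f (Z \<omega>)) - a) * of_real (\<psi> \<omega>) \<partial>M) =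
       (\<integral>\<omega>. (h (Z \<omega>) - circle_mean h) * of_real (\<psi> \<omega>) \<partial>M) +
       (\<integral>\<omega>. (of_real (f (Z \<omega>)) - a) * of_real (\<psi> \<omega>) - (h (Z \<omega>) - circle_mean h) * of_real (\<psi> \<omega>) \<partial>M)"
      using Bochner_Integration.integral_diff[OF if'[of a] ih[of "circle_mean h"]] by (simp add: eq_diff_eq add.commute)
    finally have eq: "complex_of_real (\<integral>\<omega>. (f (Z \<omega>) - circle_mean f) * \<psi> \<omega> \<partial>M) = \<dots>" .
    have b: "norm ((of_real (f (Z \<omega>)) - a) * of_real (\<psi> \<omega>) - (h (Z \<omega>) - circle_mean h) * of_real (\<psi> \<omega>)) \<le> 2 * e / 3" for \<omega>
    proof -
      have z: "norm (Z \<omega>) = 1" "\<bar>\<psi> \<omega>\<bar> \<le> 1" using w by (auto simp: weighted_phase_def)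
      have "norm ((of_real (f (Z \<omega>)) - a) * of_real (\<psi> \<omega>) - (h (Z \<omega>) - circle_mean h) * of_real (\<psi> \<omega>))
        = norm ((of_real (f (Z \<omega>)) - h (Z \<omega>)) - (a - circle_mean h)) * \<bar>\<psi> \<omega>\<bar>"
      proof -
        have "(of_real (f (Z \<omega>)) - a) * of_real (\<psi> \<omega>) - (h (Z \<omega>) - circle_mean h) * of_real (\<psi> \<omega>)
          = ((of_real (f (Z \<omega>)) - h (Z \<omega>)) - (a - circle_mean h)) * of_real (\<psi> \<omega>)"
          by (simp only: algebra_simps)
        thus ?thesis by (simp only: norm_mult norm_of_real)
      qed
      also have "\<dots> \<le> norm ((of_real (f (Z \<omega>)) - h (Z \<omega>)) - (a - circle_mean h)) * 1"
        using z by (intro mult_left_mono) auto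
      also have "\<dots> \<le> norm (of_real (f (Z \<omega>)) - h (Z \<omega>)) + norm (a - circle_mean h)"
        by (simp add: norm_triangle_ineq4)
      also have "\<dots> \<le> e / 3 + e / 3" using close[OF z(1)] mean by (intro add_mono) (auto simp: a_def)
      finally show ?thesis by simp
    qed
    have "norm (\<integral>\<omega>. (of_real (f (Z \<omega>)) - a) * of_real (\<psi> \<omega>) - (h (Z \<omega>) - circle_mean h) * of_real (\<psi> \<omega>) \<partial>M) \<le>
       (\<integral>\<omega>. 2 * e / 3 \<partial>M)"
      by (rule norm_integral_le) (use b if' ih in auto)
    hence b': "norm (\<integral>\<omega>. (of_real (f (Z \<omega>)) - a) * of_real (\<psi> \<omega>) - (h (Z \<omega>) - circle_mean h) * of_real (\<psi> \<omega>) \<partial>M) \<le> 2 * e / 3"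
      by (simp add: prob_space)
    have "\<bar>\<integral>\<omega>. (f (Z \<omega>) - circle_mean f) * \<psi> \<omega> \<partial>M\<bar> = norm (complex_of_real (\<integral>\<omega>. (f (Z \<omega>) - circle_mean f) * \<psi> \<omega> \<partial>M))"
      by simp
    also have "\<dots> \<le> e / 3 + 2 * e / 3"
      unfolding eq by (intro norm_triangle_le add_mono N(2) w s b')
    finally show ?thesis by simp
  qed
  thus ?thesis using N(1) by blast
qed

text \<open>Since the weight may change sign, the sandwich cannot be applied to the weighted integral. The
  indicator of the arc is instead replaced by its majorant \<open>f'\<close>, at the cost of the mean of
  \<open>f' - f\<close>, which is controlled by the Fourier coefficients for the weight 1.\<close>

lemma weyl_arc:
  assumes g: "0 \<le> g" "g < 1" and "0 < e"
  shows "\<exists>N \<delta>. 0 < \<delta> \<and> (\<forall>(M :: 'a measure) Z \<psi>. weighted_phase M Z \<psi> \<longrightarrow>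
            small_phases N \<delta> M Z \<psi> \<longrightarrow> small_phases N \<delta> M Z (\<lambda>_. 1) \<longrightarrow>
            \<bar>\<integral>\<omega>. (of_bool (Z \<omega> \<in> arc 0 g) - g) * \<psi> \<omega> \<partial>M\<bar> \<le> e)"
proof -
  define d where "d = e / 6"
  have d: "0 < d" using assms by (simp add: d_def)
  obtain f f' :: "complex \<Rightarrow> real" where f: "continuous_on UNIV f" "continuous_on UNIV f'"
    "\<And>z. norm z = 1 \<Longrightarrow> f z \<le> of_bool (z \<in> arc 0 g)"
    "\<And>z. norm z = 1 \<Longrightarrow> of_bool (z \<in> arc 0 g) \<le> f' z"
    "\<bar>circle_mean f - g\<bar> \<le> d" "\<bar>circle_mean f' - g\<bar> \<le> d"
    using arc_sandwich[OF g d] by metis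
  obtain N \<delta> where N: "0 < \<delta>" "\<And>M Z \<psi>. weighted_phase (M::'a measure) Z \<psi> \<Longrightarrow> small_phases N \<delta> M Z \<psi> \<Longrightarrow>
            \<bar>\<integral>\<omega>. (f (Z \<omega>) - circle_mean f) * \<psi> \<omega> \<partial>M\<bar> \<le> d"
    using weyl_continuous[OF f(1) d] by blast
  obtain N' \<delta>' where N': "0 < \<delta>'" "\<And>M Z \<psi>. weighted_phase (M::'a measure) Z \<psi> \<Longrightarrow> small_phases N' \<delta>' M Z \<psi> \<Longrightarrow>
            \<bar>\<integral>\<omega>. (f' (Z \<omega>) - circle_mean f') * \<psi> \<omega> \<partial>M\<bar> \<le> d"
    using weyl_continuous[OF f(2) d] by blast
  have "\<bar>\<integral>\<omega>. (of_bool (Z \<omega> \<in> arc 0 g) - g) * \<psi> \<omega> \<partial>M\<bar> \<le> e"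
    if w: "weighted_phase M Z \<psi>" and s: "small_phases (max N N') (min \<delta> \<delta>') M Z \<psi>"
      and s1: "small_phases (max N N') (min \<delta> \<delta>') M Z (\<lambda>_. 1)" for M :: "'a measure" and Z \<psi>
  proof -
    interpret prob_space M using w by (simp add: weighted_phase_def)
    have w1: "weighted_phase M Z (\<lambda>_. 1)" using w by (simp add: weighted_phase_def)
    have z: "norm (Z \<omega>) = 1" "\<bar>\<psi> \<omega>\<bar> \<le> 1" for \<omega> using w by (auto simp: weighted_phase_def)
    have bdd: "\<exists>C. \<forall>z. norm z = 1 \<longrightarrow> norm (F z) \<le> C" if "continuous_on UNIV F" for F :: "complex \<Rightarrow> real"
    proof -
      have "bounded (F ` sphere 0 1)"
        by (intro compact_imp_bounded compact_continuous_image continuous_on_subset[OF that]) auto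
      thus ?thesis unfolding bounded_iff by (metis image_eqI mem_sphere_0)
    qed
    have int: "integrable M (\<lambda>\<omega>. (F (Z \<omega>) - c) * \<theta> \<omega>)"
      if F: "continuous_on UNIV F" "weighted_phase M Z \<theta>" for F :: "complex \<Rightarrow> real" and c \<theta>
    proof -
      obtain C where "\<And>z. norm z = 1 \<Longrightarrow> norm (F z) \<le> C" using bdd[OF F(1)] by blast
      from weighted_phase_integrable[OF F(2) borel_measurable_continuous_onI[OF F(1)] this, of c]
      show ?thesis by simp
    qed
    have "(\<lambda>z. of_bool (z \<in> arc 0 g) :: real) \<in> borel_measurable borel"
      using borel_closed[OF compact_imp_closed[OF compact_arc[of 0 g]]] by measurable
    from weighted_phase_integrable[OF w this, of 1] weighted_phase_integrable[OF w1 this, of 1]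
    have ia: "integrable M (\<lambda>\<omega>. (of_bool (Z \<omega> \<in> arc 0 g) - c) * \<psi> \<omega>)"
      "integrable M (\<lambda>\<omega>. of_bool (Z \<omega> \<in> arc 0 g) - c)" for c by auto
    have i1: "integrable M (\<lambda>\<omega>. f (Z \<omega>) - c)" "integrable M (\<lambda>\<omega>. f' (Z \<omega>) - c)" for c
      using int[OF f(1) w1] int[OF f(2) w1] by auto
    note i10 = i1(1)[of 0, simplified] i1(2)[of 0, simplified]
    have "(\<integral>\<omega>. f' (Z \<omega>) - f (Z \<omega>) \<partial>M) =
        (\<integral>\<omega>. f' (Z \<omega>) - circle_mean f' \<partial>M) - (\<integral>\<omega>. f (Z \<omega>) - circle_mean f \<partial>M) + (circle_mean f' - circle_mean f)"
      using i10 by (simp add: prob_space)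
    also have "\<dots> \<le> d + d + 2 * d"
      using N(2)[OF w1 small_phases_mono[OF s1]] N'(2)[OF w1 small_phases_mono[OF s1]] f(5,6) by simp
    finally have gap: "(\<integral>\<omega>. f' (Z \<omega>) - f (Z \<omega>) \<partial>M) \<le> 4 * d" by simp
    have "(\<integral>\<omega>. (of_bool (Z \<omega> \<in> arc 0 g) - g) * \<psi> \<omega> \<partial>M) =
       (\<integral>\<omega>. (of_bool (Z \<omega> \<in> arc 0 g) - g) * \<psi> \<omega> - (f' (Z \<omega>) - g) * \<psi> \<omega> \<partial>M)
       + (\<integral>\<omega>. (f' (Z \<omega>) - g) * \<psi> \<omega> - (f' (Z \<omega>) - circle_mean f') * \<psi> \<omega> \<partial>M)
       + (\<integral>\<omega>. (f' (Z \<omega>) - circle_mean f') * \<psi> \<omega> \<partial>M)" (is "_ = ?a + ?b + ?c")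
      using ia(1) int[OF f(2) w] by (simp add: Bochner_Integration.integral_diff)
    moreover have "\<bar>?c\<bar> \<le> d" using N'(2)[OF w small_phases_mono[OF s]] by simp
    moreover have "norm ?a \<le> (\<integral>\<omega>. f' (Z \<omega>) - f (Z \<omega>) \<partial>M)"
    proof (rule norm_integral_le)
      fix \<omega>
      have "(of_bool (Z \<omega> \<in> arc 0 g) - g) * \<psi> \<omega> - (f' (Z \<omega>) - g) * \<psi> \<omega> =
          - ((f' (Z \<omega>) - of_bool (Z \<omega> \<in> arc 0 g)) * \<psi> \<omega>)"
        by (simp only: algebra_simps)
      hence "norm ((of_bool (Z \<omega> \<in> arc 0 g) - g) * \<psi> \<omega> - (f' (Z \<omega>) - g) * \<psi> \<omega>) =
          \<bar>f' (Z \<omega>) - of_bool (Z \<omega> \<in> arc 0 g)\<bar> * \<bar>\<psi> \<omega>\<bar>"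
        by (simp only: real_norm_def abs_minus_cancel abs_mult)
      also have "\<dots> \<le> \<bar>f' (Z \<omega>) - of_bool (Z \<omega> \<in> arc 0 g)\<bar> * 1" using z by (intro mult_left_mono) auto
      also have "\<dots> \<le> f' (Z \<omega>) - f (Z \<omega>)" using f(3)[OF z(1)] f(4)[OF z(1)] by (simp add: abs_of_nonneg)
      finally show "norm ((of_bool (Z \<omega> \<in> arc 0 g) - g) * \<psi> \<omega> - (f' (Z \<omega>) - g) * \<psi> \<omega>) \<le> f' (Z \<omega>) - f (Z \<omega>)" .
    qed (use ia(1) int[OF f(2) w] i10 in auto)
    moreover have "norm ?b \<le> (\<integral>\<omega>. d \<partial>M)"
    proof (rule norm_integral_le)
      fix \<omega>
      have "norm ((f' (Z \<omega>) - g) * \<psi> \<omega> - (f' (Z \<omega>) - circle_mean f') * \<psi> \<omega>) = \<bar>circle_mean f' - g\<bar> * \<bar>\<psi> \<omega>\<bar>"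
        by (simp add: algebra_simps flip: abs_mult)
      also have "\<dots> \<le> d * 1" using z f(6) d by (intro mult_mono) auto
      finally show "norm ((f' (Z \<omega>) - g) * \<psi> \<omega> - (f' (Z \<omega>) - circle_mean f') * \<psi> \<omega>) \<le> d" by simp
    qed (use int[OF f(2) w] in auto)
    ultimately show ?thesis using gap unfolding d_def by (simp add: prob_space)
  qed
  thus ?thesis using N(1) N'(1) by (intro exI[of _ "max N N'"] exI[of _ "min \<delta> \<delta>'"]) auto
qed

section \<open>Phases of stick lengths and their decay\<close>

text \<open>The equality case of \<open>norm (expectation Z) \<le> expectation (norm Z)\<close>: after a rotation the
  real part of \<open>Z\<close> is at most 1 and has mean 1.\<close>

lemma (in prob_space) constant_of_norm_expectation_eq_1:
  fixes Z :: "'a \<Rightarrow> complex"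
  assumes [measurable]: "Z \<in> borel_measurable M" and Z: "\<And>\<omega>. norm (Z \<omega>) = 1"
    and one: "norm (expectation Z) = 1"
  shows "AE \<omega> in M. Z \<omega> = expectation Z"
proof -
  define c where "c = expectation Z"
  have iZ: "integrable M Z" by (rule integrable_const_bound[where B = 1]) (auto simp: Z)
  have cc: "cnj c * c = 1" using one by (simp add: c_def mult.commute complex_norm_square[symmetric])
  have le: "Re (cnj c * Z \<omega>) \<le> 1" for \<omega>
    using complex_Re_le_cmod[of "cnj c * Z \<omega>"] one by (simp add: norm_mult Z c_def)
  have "(\<integral>\<omega>. 1 - Re (cnj c * Z \<omega>) \<partial>M) = 1 - Re (\<integral>\<omega>. cnj c * Z \<omega> \<partial>M)"
    using iZ by (subst Bochner_Integration.integral_diff) (auto simp: prob_space simp del: times_complex.simps)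
  also have "(\<integral>\<omega>. cnj c * Z \<omega> \<partial>M) = 1" using cc by (simp add: c_def)
  finally have "(\<integral>\<omega>. 1 - Re (cnj c * Z \<omega>) \<partial>M) = 0" by simp
  moreover have "integrable M (\<lambda>\<omega>. 1 - Re (cnj c * Z \<omega>))"
    using iZ by (intro Bochner_Integration.integrable_diff integrable_Re integrable_mult_right) auto
  ultimately have "AE \<omega> in M. 1 - Re (cnj c * Z \<omega>) = 0"
    using le by (subst (asm) integral_nonneg_eq_0_iff_AE) (auto simp del: times_complex.simps)
  thus ?thesis
  proof eventually_elim
    case (elim \<omega>)
    have "norm (cnj c * Z \<omega>) = 1" using one by (simp add: norm_mult Z c_def)
    hence "Im (cnj c * Z \<omega>) = 0" using elim unfolding cmod_def by simp
    hence "cnj c * Z \<omega> = cnj c * c" unfolding cc complex_eq_iff using elim by simp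
    moreover have "cnj c \<noteq> 0" using one by (auto simp: c_def)
    ultimately show ?case by (simp add: c_def)
  qed
qed

lemma AE_notin_of_lborel_density:
  fixes f :: "real \<Rightarrow> ennreal"
  assumes "distributed D lborel G f" and A: "A \<in> sets borel" and "AE x in lborel. x \<in> A \<longrightarrow> f x = 0"
  shows "AE y in D. G y \<notin> A"
proof -
  have "emeasure D (G -` A \<inter> space D) = (\<integral>\<^sup>+ x. f x * indicator A x \<partial>lborel)"
    using assms by (intro distributed_emeasure) auto
  also have "\<dots> = (\<integral>\<^sup>+ x. 0 \<partial>(lborel :: real measure))"
  proof (rule nn_integral_cong_AE)
    show "AE x in lborel. f x * indicator A x = 0"
      using assms(3) by eventually_elim (auto split: split_indicator)
  qed
  finally have "G -` A \<inter> space D \<in> null_sets D"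
    using measurable_sets[OF distributed_measurable[OF assms(1)], of A] A by auto
  thus ?thesis by (rule AE_I') auto
qed

lemma gap_positive:
  assumes d: "distributed D lborel G (\<lambda>x. ennreal (f x * indicator {0..} x))"
  shows "AE y in D. (0::real) < G y"
proof -
  have "AE x in lborel. x \<noteq> (0::real)" by (rule AE_lborel_singleton)
  hence "AE x in lborel. x \<in> {..0} \<longrightarrow> ennreal (f x * indicator {0..} x) = 0"
    by eventually_elim (auto split: split_indicator)
  hence "AE y in D. G y \<notin> {..0}" by (rule AE_notin_of_lborel_density[OF d, rotated]) auto
  thus ?thesis by eventually_elim auto
qed

definition phase :: "real \<Rightarrow> int \<Rightarrow> real \<Rightarrow> complex" where
  "phase B m l = cis (2 * pi * of_int m * log B l)"

lemma norm_phase [simp]: "norm (phase B m l) = 1"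
  by (simp add: phase_def)

lemma phase_measurable [measurable]: "phase B m \<in> borel_measurable borel"
  unfolding phase_def cis_conv_exp by measurable

lemma phase_mult: "0 < a \<Longrightarrow> 0 < b \<Longrightarrow> phase B m (a * b) = phase B m a * phase B m b"
  by (simp add: phase_def cis_mult log_mult ring_distribs)

lemma phase_powi: "phase B 1 l powi m = phase B m l"
  by (simp add: phase_def cis_power_int mult_ac)

text \<open>If the modulus were 1, the phase would be almost surely constant. But the numbers \<open>l\<close> with a
  given phase form a geometric progression, a countable set, which a law with a density does not
  charge.\<close>

lemma phase_expectation_less_1:
  assumes D: "prob_space D" and d: "distributed D lborel G (\<lambda>x. ennreal (f x * indicator {0..} x))"
    and B: "1 < B" and m: "m \<noteq> 0"
  shows "norm (\<integral>y. phase B m (G y) \<partial>D) < 1"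
proof -
  interpret prob_space D by fact
  have [measurable]: "G \<in> borel_measurable D" using distributed_measurable[OF d] by simp
  have le: "norm (\<integral>y. phase B m (G y) \<partial>D) \<le> (\<integral>y. 1 \<partial>D)"
    by (rule norm_integral_le, rule integrable_const_bound[where B = 1]) auto
  show ?thesis
  proof (rule ccontr)
    assume "\<not> ?thesis"
    hence one: "norm (\<integral>y. phase B m (G y) \<partial>D) = 1" using le by (simp add: prob_space)
    define c where "c = (\<integral>y. phase B m (G y) \<partial>D)"
    have const: "AE y in D. phase B m (G y) = c"
      unfolding c_def by (rule constant_of_norm_expectation_eq_1) (use one in auto)
    define S where "S = {l. 0 < l \<and> phase B m l = c}"
    \<comment> \<open>The logarithms of the elements of \<open>S\<close> lie in a translate of the multiples of \<open>1 / m\<close>.\<close>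
    have "countable S"
    proof (rule countable_subset)
      show "S \<subseteq> range (\<lambda>n::int. B powr ((Arg c / (2 * pi) + of_int n) / of_int m))"
      proof
        fix l assume l: "l \<in> S"
        hence c: "cis (2 * pi * (of_int m * log B l)) = c" by (simp add: S_def phase_def mult.assoc)
        hence "norm c = 1" by (metis norm_cis)
        moreover from this have "c \<noteq> 0" by auto
        ultimately have "c = cis (2 * pi * (Arg c / (2 * pi)))" using cis_Arg[of c] by (auto simp: sgn_div_norm)
        hence "frac (of_int m * log B l) = frac (Arg c / (2 * pi))" using c cis_eq_iff_frac by metis
        hence "of_int m * log B l = Arg c / (2 * pi) + of_int (\<lfloor>of_int m * log B l\<rfloor> - \<lfloor>Arg c / (2 * pi)\<rfloor>)"
          by (simp add: frac_def algebra_simps)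
        then obtain n :: int where "of_int m * log B l = Arg c / (2 * pi) + of_int n" by blast
        hence "log B l = (Arg c / (2 * pi) + of_int n) / of_int m" using m by (simp add: field_simps)
        moreover have "l = B powr log B l" using l B by (simp add: S_def)
        ultimately show "l \<in> range (\<lambda>n::int. B powr ((Arg c / (2 * pi) + of_int n) / of_int m))" by auto
      qed
    qed auto
    hence "S \<in> null_sets lborel" by (rule countable_imp_null_set_lborel)
    hence "AE x in lborel. x \<notin> S" by (rule AE_not_in)
    hence "AE y in D. G y \<notin> S"
      using \<open>S \<in> null_sets lborel\<close> by (intro AE_notin_of_lborel_density[OF d]) (auto elim: eventually_mono)
    with const gap_positive[OF d] have "AE y in D. False" by eventually_elim (auto simp: S_def)
    thus False by simp
  qed
qed

lemma strict_suffix_Cons_iff: "strict_suffix q (i # w) \<longleftrightarrow> suffix q w"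
  by (auto simp: strict_suffix_def suffix_Cons dest: suffix_length_le)

text \<open>Ancestors are suffixes of the address, and a length is determined by the cut points of the strict
  ancestors.\<close>

lemma stick_length_cong:
  assumes "\<And>q. strict_suffix q w \<Longrightarrow> x (j, q) = y (j, q)"
  shows "stick_length k L x (j, w) = stick_length k L y (j, w)"
  using assms
proof (induction w)
  case (Cons i w)
  thus ?case by (simp add: strict_suffix_Cons_iff suffix_order.dual_order.order_iff_strict)
qed simp

lemma suffix_sticks: "(j, w) \<in> sticks k R \<Longrightarrow> suffix q w \<Longrightarrow> (j, q) \<in> sticks k R"
  by (auto simp: sticks_def suffix_def)

lemma stick_length_restrict:
  assumes "(j, w) \<in> sticks k R"
  shows "stick_length k L (\<lambda>v\<in>sticks k R. X v \<omega>) (j, w) = stick_length k L (\<lambda>v. X v \<omega>) (j, w)"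
  by (rule stick_length_cong) (use suffix_sticks[OF assms] in \<open>auto simp: strict_suffix_def\<close>)

lemma countable_sticks: "countable (sticks k R)"
  by (auto simp: sticks_def)

text \<open>The half of the process that concerns cut points. Positivity of the gaps is kept because it makes
  the logarithm of a length a constant plus the sum of the logarithms of the gaps.\<close>

locale stick_cuts = prob_space M for M :: "'a measure" +
  fixes k R :: nat and D :: "(nat \<Rightarrow> real) measure" and X :: "stick \<Rightarrow> 'a \<Rightarrow> nat \<Rightarrow> real"
  assumes indep_cuts: "indep_vars (\<lambda>_. D) X (sticks k R)"
    and law: "v \<in> sticks k R \<Longrightarrow> distr M D (X v) = D"
    and gap_measurable: "i < k \<Longrightarrow> (\<lambda>y. gap (k - 1) y i) \<in> borel_measurable D"
    and gap_pos: "i < k \<Longrightarrow> AE y in D. 0 < gap (k - 1) y i"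
begin

abbreviation "V \<equiv> sticks k R"

abbreviation cuts :: "'a \<Rightarrow> stick \<Rightarrow> nat \<Rightarrow> real" where
  "cuts \<omega> \<equiv> \<lambda>v\<in>V. X v \<omega>"

lemma X_measurable [measurable]: "v \<in> V \<Longrightarrow> X v \<in> measurable M D"
  using indep_cuts by (auto simp: indep_vars_def)

lemma cuts_measurable [measurable]: "cuts \<in> measurable M (PiM V (\<lambda>_. D))"
  by (intro measurable_restrict) auto

lemma stick_length_measurable:
  "(j, w) \<in> V \<Longrightarrow> (\<lambda>x. stick_length k L x (j, w)) \<in> borel_measurable (PiM V (\<lambda>_. D))"
proof (induction w)
  case (Cons i w)
  have w: "(j, w) \<in> V" and i: "i < k" using Cons.prems by (auto simp: sticks_def)
  have "(\<lambda>x. gap (k - 1) (x (j, w)) i) \<in> borel_measurable (PiM V (\<lambda>_. D))"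
    by (rule measurable_compose[OF measurable_component_singleton[OF w] gap_measurable[OF i]])
  thus ?case using Cons.IH[OF w] by (auto intro!: borel_measurable_times)
qed simp

lemma AE_gap_pos:
  assumes "v \<in> V" "i < k"
  shows "AE \<omega> in M. 0 < gap (k - 1) (X v \<omega>) i"
proof -
  note [measurable] = gap_measurable[OF assms(2)]
  have "AE y in distr M D (X v). 0 < gap (k - 1) y i"
    unfolding law[OF assms(1)] by (rule gap_pos[OF assms(2)])
  moreover have "{y \<in> space D. 0 < gap (k - 1) y i} \<in> sets D" by measurable
  ultimately show ?thesis using X_measurable[OF assms(1)] by (subst (asm) AE_distr_iff)
qed

lemma AE_stick_length_pos:
  assumes "0 < L" "(j, w) \<in> V"
  shows "AE \<omega> in M. 0 < stick_length k L (cuts \<omega>) (j, w)"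
  using assms(2)
proof (induction w)
  case (Cons i w)
  have w: "(j, w) \<in> V" and i: "i < k" using Cons.prems by (auto simp: sticks_def)
  show ?case using Cons.IH[OF w] AE_gap_pos[OF w i]
    by eventually_elim (simp add: w)
qed (simp add: \<open>0 < L\<close>)

text \<open>That \<open>G\<close> ignores the cut points of \<open>p\<close> is expressed by invariance under updates at \<open>p\<close>. It
  allows the functions describing the process to be used on the full index set \<open>V\<close>, without
  rewriting them on smaller ones.\<close>

lemma expectation_mult_independent_cut:
  fixes G :: "(stick \<Rightarrow> nat \<Rightarrow> real) \<Rightarrow> complex" and H :: "(nat \<Rightarrow> real) \<Rightarrow> complex"
  assumes p: "p \<in> V"
    and G: "G \<in> borel_measurable (PiM V (\<lambda>_. D))" "\<And>x. norm (G x) \<le> 1"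
    and G_upd: "\<And>x y. G (x(p := y)) = G x"
    and H: "H \<in> borel_measurable D" "\<And>y. norm (H y) \<le> 1"
  shows "(\<integral>\<omega>. G (cuts \<omega>) * H (X p \<omega>) \<partial>M) = (\<integral>\<omega>. G (cuts \<omega>) \<partial>M) * (\<integral>y. H y \<partial>D)"
proof -
  obtain \<omega>0 where "\<omega>0 \<in> space M" using not_empty by blast
  hence y0: "X p \<omega>0 \<in> space D" using measurable_space[OF X_measurable[OF p]] by blast
  \<comment> \<open>\<open>G\<close> as a function of the other cut points only, with an arbitrary value filled in at \<open>p\<close>.\<close>
  define G' where "G' = (\<lambda>x. G (x(p := X p \<omega>0)))"
  have "insert p (V - {p}) = V" using p by blast
  hence "(\<lambda>x. x(p := X p \<omega>0)) \<in> measurable (PiM (V - {p}) (\<lambda>_. D)) (PiM V (\<lambda>_. D))"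
    using measurable_compose[OF measurable_Pair[OF measurable_ident_sets[OF refl] measurable_const[OF y0]]
        measurable_add_dim[of p "V - {p}" "\<lambda>_. D"]] by (simp add: id_def)
  hence G': "G' \<in> borel_measurable (PiM (V - {p}) (\<lambda>_. D))"
    unfolding G'_def by (rule measurable_compose[OF _ G(1)])
  have H': "(\<lambda>x. H (x p)) \<in> borel_measurable (PiM {p} (\<lambda>_. D))"
    by (rule measurable_compose[OF _ H(1)], rule measurable_component_singleton) simp
  have "indep_var borel (G' \<circ> (\<lambda>\<omega>. \<lambda>v\<in>V - {p}. X v \<omega>)) borel ((\<lambda>x. H (x p)) \<circ> (\<lambda>\<omega>. \<lambda>v\<in>{p}. X v \<omega>))"
    by (rule indep_var_compose[OF indep_var_restrict[OF indep_cuts] G' H']) (use p in auto)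
  moreover have "G' \<circ> (\<lambda>\<omega>. \<lambda>v\<in>V - {p}. X v \<omega>) = (\<lambda>\<omega>. G (cuts \<omega>))"
  proof
    fix \<omega>
    have "(\<lambda>v\<in>V - {p}. X v \<omega>)(p := X p \<omega>0) = (cuts \<omega>)(p := X p \<omega>0)" by auto
    thus "(G' \<circ> (\<lambda>\<omega>. \<lambda>v\<in>V - {p}. X v \<omega>)) \<omega> = G (cuts \<omega>)"
      using G_upd[of "cuts \<omega>"] by (simp add: G'_def)
  qed
  moreover have "(\<lambda>x. H (x p)) \<circ> (\<lambda>\<omega>. \<lambda>v\<in>{p}. X v \<omega>) = (\<lambda>\<omega>. H (X p \<omega>))" by auto
  ultimately have ind: "indep_var borel (\<lambda>\<omega>. G (cuts \<omega>)) borel (\<lambda>\<omega>. H (X p \<omega>))" by simp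
  have "integrable M (\<lambda>\<omega>. G (cuts \<omega>))" "integrable M (\<lambda>\<omega>. H (X p \<omega>))"
    using G H p by (auto intro!: integrable_const_bound[where B = 1] measurable_compose[OF cuts_measurable]
        measurable_compose[OF X_measurable])
  from indep_var_lebesgue_integral[OF ind this]
  have "(\<integral>\<omega>. G (cuts \<omega>) * H (X p \<omega>) \<partial>M) = (\<integral>\<omega>. G (cuts \<omega>) \<partial>M) * (\<integral>\<omega>. H (X p \<omega>) \<partial>M)" .
  also have "(\<integral>\<omega>. H (X p \<omega>) \<partial>M) = (\<integral>y. H y \<partial>distr M D (X p))"
    by (rule integral_distr[symmetric]) (use p H in auto)
  finally show ?thesis unfolding law[OF p] .
qed

text \<open>Here \<open>t\<close> is the part of the address of a stick added since its ancestor \<open>(j, u)\<close>,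
  most recent piece first. For a strict suffix \<open>q\<close> of \<open>t\<close> the cut points of \<open>(j, q @ u)\<close> enter neither \<open>\<Psi>\<close> nor
  the length of that stick, so passing to its next piece multiplies the expectation by that of the
  phase of a single gap.\<close>

lemma phase_decay:
  fixes \<Psi> :: "(stick \<Rightarrow> nat \<Rightarrow> real) \<Rightarrow> complex"
  assumes L: "0 < L" and \<rho>: "\<And>i. i < k \<Longrightarrow> norm (\<integral>y. phase B m (gap (k - 1) y i) \<partial>D) \<le> \<rho>"
    and v: "(j, t @ u) \<in> V"
    and \<Psi>: "\<Psi> \<in> borel_measurable (PiM V (\<lambda>_. D))" "\<And>x. norm (\<Psi> x) \<le> 1"
    and \<Psi>_upd: "\<And>x y q. strict_suffix q t \<Longrightarrow> \<Psi> (x((j, q @ u) := y)) = \<Psi> x"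
  shows "norm (\<integral>\<omega>. phase B m (stick_length k L (cuts \<omega>) (j, t @ u)) * \<Psi> (cuts \<omega>) \<partial>M) \<le> \<rho> ^ length t"
  using v \<Psi>_upd
proof (induction t)
  case Nil
  have [measurable]: "(\<lambda>x. stick_length k L x (j, u)) \<in> borel_measurable (PiM V (\<lambda>_. D))"
    using stick_length_measurable Nil by simp
  note [measurable] = \<Psi>(1)
  have "norm (\<integral>\<omega>. phase B m (stick_length k L (cuts \<omega>) (j, u)) * \<Psi> (cuts \<omega>) \<partial>M) \<le> (\<integral>\<omega>. 1 \<partial>M)"
    by (rule norm_integral_le, rule integrable_const_bound[where B = 1]) (auto simp: norm_mult \<Psi>)
  also have "(\<integral>\<omega>. 1 \<partial>M) = (1::real)" by (simp add: prob_space)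
  finally show ?case by (simp only: append_Nil list.size(3) power_0)
next
  case (Cons i t)
  define p where "p = (j, t @ u)"
  have p: "p \<in> V" and i: "i < k" using Cons.prems(1) by (auto simp: sticks_def p_def)
  have [measurable]: "(\<lambda>x. stick_length k L x p) \<in> borel_measurable (PiM V (\<lambda>_. D))"
    using stick_length_measurable p by (simp add: p_def)
  note [measurable] = \<Psi>(1) gap_measurable[OF i]
  have "(\<integral>\<omega>. phase B m (stick_length k L (cuts \<omega>) (j, (i # t) @ u)) * \<Psi> (cuts \<omega>) \<partial>M) =
    (\<integral>\<omega>. (phase B m (stick_length k L (cuts \<omega>) p) * \<Psi> (cuts \<omega>)) * phase B m (gap (k - 1) (X p \<omega>) i) \<partial>M)"
  proof (rule integral_cong_AE)
    have [measurable]: "(\<lambda>x. stick_length k L x (j, (i # t) @ u)) \<in> borel_measurable (PiM V (\<lambda>_. D))"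
      using stick_length_measurable Cons.prems(1) by blast
    show "(\<lambda>\<omega>. phase B m (stick_length k L (cuts \<omega>) (j, (i # t) @ u)) * \<Psi> (cuts \<omega>)) \<in> borel_measurable M"
      by measurable
    show "(\<lambda>\<omega>. phase B m (stick_length k L (cuts \<omega>) p) * \<Psi> (cuts \<omega>) * phase B m (gap (k - 1) (X p \<omega>) i)) \<in> borel_measurable M"
      using p by measurable
    show "AE \<omega> in M. phase B m (stick_length k L (cuts \<omega>) (j, (i # t) @ u)) * \<Psi> (cuts \<omega>) =
       phase B m (stick_length k L (cuts \<omega>) p) * \<Psi> (cuts \<omega>) * phase B m (gap (k - 1) (X p \<omega>) i)"
      using AE_stick_length_pos[OF L p[unfolded p_def]] AE_gap_pos[OF p i]
      by eventually_elim (use p in \<open>simp add: p_def phase_mult\<close>)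
  qed
  also have "\<dots> = (\<integral>\<omega>. phase B m (stick_length k L (cuts \<omega>) p) * \<Psi> (cuts \<omega>) \<partial>M) *
      (\<integral>y. phase B m (gap (k - 1) y i) \<partial>D)"
  proof (rule expectation_mult_independent_cut[OF p])
    fix x y
    have "stick_length k L (x(p := y)) p = stick_length k L x p"
      unfolding p_def by (rule stick_length_cong) (auto simp: strict_suffix_def)
    moreover have "\<Psi> (x(p := y)) = \<Psi> x"
      unfolding p_def by (rule Cons.prems(2)) (simp add: strict_suffix_Cons_iff)
    ultimately show "phase B m (stick_length k L (x(p := y)) p) * \<Psi> (x(p := y)) = phase B m (stick_length k L x p) * \<Psi> x"
      by simp
    show "(\<lambda>y. phase B m (gap (k - 1) y i)) \<in> borel_measurable D" by measurable
  qed (auto simp: norm_mult \<Psi>)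
  also have "norm \<dots> \<le> \<rho> ^ length t * \<rho>"
    unfolding norm_mult p_def
  proof (intro mult_mono \<rho> i Cons.IH)
    show "(j, t @ u) \<in> V" using p by (simp add: p_def)
    show "\<Psi> (x((j, q @ u) := y)) = \<Psi> x" if "strict_suffix q t" for x y q
      by (rule Cons.prems(2)) (use that[unfolded strict_suffix_def] in \<open>simp only: strict_suffix_Cons_iff\<close>)
    show "0 \<le> \<rho> ^ length t" using \<rho>[OF i] by (meson norm_ge_zero order_trans zero_le_power)
  qed simp
  finally show ?case by (simp only: length_Cons power_Suc2)
qed

end

text \<open>The last \<open>n\<close> cuts on the way to \<open>v\<close> leave the length of \<open>v'\<close> unaffected: the first stick
  to be cut among these is \<open>drop n (snd v)\<close>, and if it is not a strict ancestor of \<open>v'\<close>, then no later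
  one is.\<close>

definition private_tail :: "nat \<Rightarrow> stick \<Rightarrow> stick \<Rightarrow> bool" where
  "private_tail n v v' \<longleftrightarrow> n \<le> length (snd v) \<and> (fst v \<noteq> fst v' \<or> \<not> strict_suffix (drop n (snd v)) (snd v'))"

definition below :: "nat \<Rightarrow> real \<Rightarrow> real \<Rightarrow> real \<Rightarrow> (stick \<Rightarrow> nat \<Rightarrow> real) \<Rightarrow> stick \<Rightarrow> real" where
  "below k L B s x v = of_bool (significand B (stick_length k L x v) \<le> s)"

lemma (in stick_cuts) below_measurable:
  assumes "1 < B" "1 \<le> s" "v \<in> V"
  shows "(\<lambda>x. below k L B s x v) \<in> borel_measurable (PiM V (\<lambda>_. D))"
proof -
  obtain j w where v: "v = (j, w)" by force
  have [measurable]: "(\<lambda>x. stick_length k L x v) \<in> borel_measurable (PiM V (\<lambda>_. D))"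
    using stick_length_measurable assms v by simp
  have [measurable]: "Measurable.pred borel (\<lambda>l. significand B l \<le> s)"
    using borel_significand_le[OF assms(1,2)] by (simp add: pred_def)
  show ?thesis unfolding below_def by measurable
qed

lemma good_distribution_gap:
  assumes "good_distribution (k - 1) D" "i < k"
  obtains f where "distributed D lborel (\<lambda>y. gap (k - 1) y i) (\<lambda>x. ennreal (f x * indicator {0..} x))"
  using assms unfolding good_distribution_def by (metis Suc_pred' gr0I less_Suc_eq_le not_less_zero)

text \<open>Only finitely many orders and gaps are involved, so the strict bounds for each of them combine into
  one.\<close>

lemma good_distribution_phase_bound:
  assumes D: "good_distribution (k - 1) D" and B: "1 < B"
  obtains \<rho> where "0 \<le> \<rho>" "\<rho> < 1"
    "\<And>m i. 0 < \<bar>m\<bar> \<Longrightarrow> \<bar>m\<bar> \<le> int N \<Longrightarrow> i < k \<Longrightarrow> norm (\<integral>y. phase B m (gap (k - 1) y i) \<partial>D) \<le> \<rho>"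
proof -
  have pD: "prob_space D" using D by (simp add: good_distribution_def distribution_on_cube_def)
  define S where "S = (\<lambda>(m, i). norm (\<integral>y. phase B m (gap (k - 1) y i) \<partial>D)) ` (({- int N..int N} - {0}) \<times> {..<k})"
  have S: "finite (insert 0 S)" by (auto simp: S_def)
  have lt: "r < 1" if r: "r \<in> insert 0 S" for r
  proof (cases "r = 0")
    case False
    then obtain m i where m: "m \<noteq> 0" "i < k" "r = norm (\<integral>y. phase B m (gap (k - 1) y i) \<partial>D)"
      using r by (auto simp: S_def)
    show ?thesis unfolding m(3)
      by (rule good_distribution_gap[OF D m(2)], rule phase_expectation_less_1[OF pD _ B m(1)])
  qed simp
  show ?thesis
  proof (rule that[of "Max (insert 0 S)"])
    show "norm (\<integral>y. phase B m (gap (k - 1) y i) \<partial>D) \<le> Max (insert 0 S)"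
      if "0 < \<bar>m\<bar>" "\<bar>m\<bar> \<le> int N" "i < k" for m i
      using S that by (intro Max_ge) (force simp: S_def)+
    show "Max (insert 0 S) < 1" using S lt by (subst Max_less_iff) auto
  qed (use S in auto)
qed

text \<open>With the factor for \<open>v'\<close> as the weight, the Fourier coefficients of the length of \<open>v\<close>, from
  order 1 up to the order \<open>N\<close> that Weyl's criterion asks for, are at most \<open>\<rho> ^ n\<close>. As \<open>\<rho>\<close>
  does not involve the probability space, one \<open>n\<close> serves all numbers of initial sticks.\<close>

lemma below_decorrelated:
  assumes D: "good_distribution (k - 1) D" and B: "1 < B" and s: "1 \<le> s" "s < B" and e: "0 < e"
  shows "\<exists>n. \<forall>(M :: 'a measure) R X L v v'. stick_cuts M k R D X \<longrightarrow> 0 < L \<longrightarrow>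
     v \<in> sticks k R \<longrightarrow> v' \<in> sticks k R \<longrightarrow> private_tail n v v' \<longrightarrow>
     \<bar>\<integral>\<omega>. (below k L B s (\<lambda>v\<in>sticks k R. X v \<omega>) v - log B s) * (below k L B s (\<lambda>v\<in>sticks k R. X v \<omega>) v' - log B s) \<partial>M\<bar> \<le> e"
proof -
  have g: "0 \<le> log B s" "log B s < 1" using B s by auto
  obtain N \<delta> where N: "0 < \<delta>" "\<And>M Z \<psi>. weighted_phase (M::'a measure) Z \<psi> \<Longrightarrow>
      small_phases N \<delta> M Z \<psi> \<Longrightarrow> small_phases N \<delta> M Z (\<lambda>_. 1) \<Longrightarrow>
            \<bar>\<integral>\<omega>. (of_bool (Z \<omega> \<in> arc 0 (log B s)) - log B s) * \<psi> \<omega> \<partial>M\<bar> \<le> e"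
    using weyl_arc[OF g e, where 'a = 'a] by blast
  obtain \<rho> where \<rho>: "0 \<le> \<rho>" "\<rho> < 1"
    "\<And>m i. 0 < \<bar>m\<bar> \<Longrightarrow> \<bar>m\<bar> \<le> int N \<Longrightarrow> i < k \<Longrightarrow> norm (\<integral>y. phase B m (gap (k - 1) y i) \<partial>D) \<le> \<rho>"
    using good_distribution_phase_bound[OF D B] by blast
  obtain n where n: "\<rho> ^ n < \<delta>" using real_arch_pow_inv[OF N(1) \<rho>(2)] by blast
  have "\<bar>\<integral>\<omega>. (below k L B s (\<lambda>v\<in>sticks k R. X v \<omega>) v - log B s) * (below k L B s (\<lambda>v\<in>sticks k R. X v \<omega>) v' - log B s) \<partial>M\<bar> \<le> e"
    if cuts: "stick_cuts M k R D X" and L: "0 < L" and v: "v \<in> sticks k R" and v': "v' \<in> sticks k R"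
      and tail: "private_tail n v v'" for M :: "'a measure" and R X L v v'
  proof -
    interpret stick_cuts M k R D X by fact
    obtain j w where vw: "v = (j, w)" by force
    define t u where "t = take n w" and "u = drop n w"
    have w: "w = t @ u" by (simp add: t_def u_def)
    have len: "length t = n" using tail by (simp add: private_tail_def t_def vw)
    note bm = below_measurable[OF B s(1)]
    define \<Psi> where "\<Psi> = (\<lambda>x. below k L B s x v' - log B s)"
    have \<Psi>m: "\<Psi> \<in> borel_measurable (PiM V (\<lambda>_. D))" unfolding \<Psi>_def using bm[OF v'] by measurable
    have \<Psi>1: "\<bar>\<Psi> x\<bar> \<le> 1" for x using g by (auto simp: \<Psi>_def below_def)
    \<comment> \<open>A private tail of \<open>v\<close> avoids all strict ancestors of \<open>v'\<close>.\<close>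
    have \<Psi>_upd: "\<Psi> (x((j, q @ u) := y)) = \<Psi> x" for x y q
    proof -
      obtain j' w' where vw': "v' = (j', w')" by force
      have "stick_length k L (x((j, q @ u) := y)) (j', w') = stick_length k L x (j', w')"
      proof (rule stick_length_cong)
        fix q' assume q': "strict_suffix q' w'"
        have "(j, q @ u) \<noteq> (j', q')"
        proof
          assume "(j, q @ u) = (j', q')"
          hence "j = j'" "strict_suffix u w'"
            using q' by (auto simp: strict_suffix_def suffix_def)
          thus False using tail by (simp add: private_tail_def vw vw' u_def)
        qed
        thus "(x((j, q @ u) := y)) (j', q') = x (j', q')" by auto
      qed
      thus ?thesis by (simp add: \<Psi>_def below_def vw')
    qed
    define Z where "Z = (\<lambda>\<omega>. phase B 1 (stick_length k L (cuts \<omega>) v))"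
    have lm: "(\<lambda>x. stick_length k L x v) \<in> borel_measurable (PiM V (\<lambda>_. D))"
      using stick_length_measurable v vw by simp
    note [measurable] = lm bm[OF v] bm[OF v'] \<Psi>m
    have wp: "weighted_phase M Z (\<lambda>\<omega>. \<Psi> (cuts \<omega>))"
      unfolding weighted_phase_def Z_def by (auto simp: \<Psi>1 prob_space_axioms)
    have small: "small_phases N \<delta> M Z (\<lambda>\<omega>. \<theta> (cuts \<omega>))"
      if \<theta>: "\<theta> \<in> borel_measurable (PiM V (\<lambda>_. D))" "\<And>x. \<bar>\<theta> x\<bar> \<le> 1" "\<And>x y q. \<theta> (x((j, q @ u) := y)) = \<theta> x"
      for \<theta> :: "_ \<Rightarrow> real"
      unfolding small_phases_def
    proof (intro allI impI)
      fix m :: int assume m: "0 < \<bar>m\<bar> \<and> \<bar>m\<bar> \<le> int N"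
      have "norm (\<integral>\<omega>. phase B m (stick_length k L (cuts \<omega>) (j, t @ u)) * of_real (\<theta> (cuts \<omega>)) \<partial>M) \<le> \<rho> ^ length t"
      proof (rule phase_decay[OF L])
        show "norm (\<integral>y. phase B m (gap (k - 1) y i) \<partial>D) \<le> \<rho>" if "i < k" for i
          using \<rho>(3) m that by blast
        show "(j, t @ u) \<in> V" using v vw w by simp
        show "complex_of_real (\<theta> (x((j, q @ u) := y))) = complex_of_real (\<theta> x)" for x y q
          by (simp only: \<theta>(3))
      qed (use \<theta> in auto)
      thus "norm (\<integral>\<omega>. Z \<omega> powi m * of_real (\<theta> (cuts \<omega>)) \<partial>M) \<le> \<delta>"
        using n by (simp add: Z_def phase_powi vw w[symmetric] len)
    qed
    have "\<bar>\<integral>\<omega>. (of_bool (Z \<omega> \<in> arc 0 (log B s)) - log B s) * \<Psi> (cuts \<omega>) \<partial>M\<bar> \<le> e"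
    proof (rule N(2)[OF wp])
      show "small_phases N \<delta> M Z (\<lambda>\<omega>. \<Psi> (cuts \<omega>))" by (rule small[OF \<Psi>m \<Psi>1 \<Psi>_upd])
      show "small_phases N \<delta> M Z (\<lambda>\<omega>. 1)" using small[of "\<lambda>_. 1"] by simp
    qed
    also have "(\<integral>\<omega>. (of_bool (Z \<omega> \<in> arc 0 (log B s)) - log B s) * \<Psi> (cuts \<omega>) \<partial>M) =
       (\<integral>\<omega>. (below k L B s (cuts \<omega>) v - log B s) * \<Psi> (cuts \<omega>) \<partial>M)"
    proof (rule integral_cong_AE)
      have [measurable]: "Z \<in> borel_measurable M" using wp by (simp add: weighted_phase_def)
      have [measurable]: "Measurable.pred borel (\<lambda>z. z \<in> arc 0 (log B s))"
        using borel_closed[OF compact_imp_closed[OF compact_arc[of 0 "log B s"]]] by simp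
      show "(\<lambda>\<omega>. (of_bool (Z \<omega> \<in> arc 0 (log B s)) - log B s) * \<Psi> (cuts \<omega>)) \<in> borel_measurable M" by measurable
      show "(\<lambda>\<omega>. (below k L B s (cuts \<omega>) v - log B s) * \<Psi> (cuts \<omega>)) \<in> borel_measurable M" by measurable
      show "AE \<omega> in M. (of_bool (Z \<omega> \<in> arc 0 (log B s)) - log B s) * \<Psi> (cuts \<omega>) =
         (below k L B s (cuts \<omega>) v - log B s) * \<Psi> (cuts \<omega>)"
        using AE_stick_length_pos[OF L v[unfolded vw]]
      proof eventually_elim
        case (elim \<omega>)
        hence "Z \<omega> \<in> arc 0 (log B s) \<longleftrightarrow> significand B (stick_length k L (cuts \<omega>) v) \<le> s"
          unfolding Z_def phase_def vw significand_le_iff[OF B elim s(1)]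
          using cis_in_arc_iff[OF g] by simp
        thus ?case by (simp add: below_def)
      qed
    qed
    finally show ?thesis by (simp add: \<Psi>_def)
  qed
  thus ?thesis by blast
qed

section \<open>Extinction of the critical branching process\<close>

text \<open>If each of \<open>k\<close> children survives independently with probability \<open>x\<close>, the probability that some child
  survives is smaller than \<open>k * x\<close> by at least \<open>x\<^sup>2\<close>. This loss is the reason why a critical
  branching process dies out.\<close>

lemma one_minus_power_lower_bound:
  fixes x :: real
  assumes "2 \<le> k" "0 \<le> x" "x \<le> 1"
  shows "1 - real k * x + x\<^sup>2 \<le> (1 - x) ^ k"
  using assms(1)
proof (induction k rule: dec_induct)
  case base
  show ?case by (simp add: power2_eq_square algebra_simps)
next
  case (step n)
  have "1 - real (Suc n) * x + x\<^sup>2 \<le> (1 - real n * x + x\<^sup>2) * (1 - x)"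
  proof -
    have "(1 - real n * x + x\<^sup>2) * (1 - x) - (1 - real (Suc n) * x + x\<^sup>2) = x\<^sup>2 * (real n - x)"
      by (simp add: power2_eq_square algebra_simps)
    also have "\<dots> \<ge> 0" using step(1) assms by (intro mult_nonneg_nonneg) auto
    finally show ?thesis by simp
  qed
  also have "\<dots> \<le> (1 - x) ^ n * (1 - x)" using step assms by (intro mult_right_mono) auto
  finally show ?case by (simp add: mult.commute)
qed

lemma quadratic_decrease_tendsto_0:
  fixes x :: "nat \<Rightarrow> real"
  assumes "0 < c" "\<And>n. 0 \<le> x n" "\<And>n. x (Suc n) \<le> x n - c * (x n)\<^sup>2"
  shows "x \<longlonglongrightarrow> 0"
proof -
  have "decseq x"
  proof (rule decseq_SucI)
    fix n
    have "0 \<le> c * (x n)\<^sup>2" using assms(1) by simp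
    thus "x (Suc n) \<le> x n" using assms(3)[of n] by linarith
  qed
  moreover have "bdd_below (range x)" using assms(2) by (intro bdd_belowI[of _ 0]) auto
  ultimately obtain l where l: "x \<longlonglongrightarrow> l"
    using decseq_convergent[of x 0] assms(2) by (metis)
  have "(\<lambda>n. x n - c * (x n)\<^sup>2) \<longlonglongrightarrow> l - c * l\<^sup>2" by (intro tendsto_intros l)
  with LIMSEQ_Suc[OF l] have "l \<le> l - c * l\<^sup>2" by (rule LIMSEQ_le) (use assms(3) in auto)
  hence "l = 0" using assms(1) by (auto simp: mult_le_0_iff)
  thus ?thesis using l by simp
qed

text \<open>Some line of descent of \<open>n\<close> further levels issues from the stick, whose own status counts too.
  In this way the events for the \<open>k\<close> pieces of a stick depend on disjoint families of statuses.\<close>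

primrec survives :: "nat \<Rightarrow> (stick \<Rightarrow> bool) \<Rightarrow> nat \<Rightarrow> nat \<Rightarrow> nat list \<Rightarrow> bool" where
  "survives k a 0 j w \<longleftrightarrow> a (j, w)"
| "survives k a (Suc n) j w \<longleftrightarrow> a (j, w) \<and> (\<exists>i<k. survives k a n j (i # w))"

lemma survives_cong:
  assumes "\<And>q. q \<in> lists {..<k} \<Longrightarrow> a (j, q @ w) = b (j, q @ w)"
  shows "survives k a n j w = survives k b n j w"
  using assms
proof (induction n arbitrary: w)
  case 0
  thus ?case using 0[of "[]"] by simp
next
  case (Suc n)
  have "survives k a n j (i # w) = survives k b n j (i # w)" if "i < k" for i
  proof (rule Suc.IH)
    fix q assume "q \<in> lists {..<k}"
    thus "a (j, q @ i # w) = b (j, q @ i # w)" using Suc.prems[of "q @ [i]"] that by simp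
  qed
  thus ?case using Suc.prems[of "[]"] by auto
qed

lemma survives_measurable:
  assumes "\<And>q. q \<in> lists {..<k} \<Longrightarrow> (j, q @ w) \<in> K"
  shows "Measurable.pred (PiM K (\<lambda>_. count_space UNIV)) (\<lambda>a. survives k a n j w)"
  using assms
proof (induction n arbitrary: w)
  case 0
  have "(j, w) \<in> K" using 0[of "[]"] by simp
  hence "(\<lambda>a. a (j, w)) \<in> measurable (PiM K (\<lambda>_. count_space UNIV)) (count_space UNIV)"
    by (rule measurable_component_singleton)
  thus ?case by simp
next
  case (Suc n)
  have "(j, w) \<in> K" using Suc.prems[of "[]"] by simp
  hence [measurable]: "(\<lambda>a. a (j, w)) \<in> measurable (PiM K (\<lambda>_. count_space UNIV)) (count_space UNIV)"
    by (rule measurable_component_singleton)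
  have [measurable]: "Measurable.pred (PiM K (\<lambda>_. count_space UNIV)) (\<lambda>a. survives k a n j (i # w))" if "i < k" for i
  proof (rule Suc.IH)
    fix q assume "q \<in> lists {..<k}"
    thus "(j, q @ i # w) \<in> K" using Suc.prems[of "q @ [i]"] that by simp
  qed
  have "(\<lambda>a. \<exists>i<k. survives k a n j (i # w)) = (\<lambda>a. \<exists>i\<in>{..<k}. survives k a n j (i # w))" by auto
  moreover have "Measurable.pred (PiM K (\<lambda>_. count_space UNIV)) (\<lambda>a. \<exists>i\<in>{..<k}. survives k a n j (i # w))"
    by (intro pred_intros_finite) auto
  ultimately show ?case by simp
qed

lemma living_suffix: "living a (j, q @ w) \<Longrightarrow> living a (j, w)"
  by (induction q) auto

lemma living_iff: "living a (j, w) \<longleftrightarrow> (\<forall>q. q \<noteq> [] \<and> suffix q w \<longrightarrow> a (j, q))"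
proof (induction w)
  case (Cons i w)
  show ?case by (auto simp: Cons.IH suffix_Cons)
qed simp

lemma living_imp_survives:
  assumes "living a (j, q @ w)" "w \<noteq> []" "q \<in> lists {..<k}"
  shows "survives k a (length q) j w"
  using assms
proof (induction q arbitrary: w rule: rev_induct)
  case Nil
  thus ?case by (cases w) auto
next
  case (snoc i q)
  have "survives k a (length q) j (i # w)" using snoc by (intro snoc.IH) auto
  moreover have "a (j, w)" using living_suffix[of a j "q @ [i]" w] snoc by (cases w) auto
  ultimately show ?case using snoc by auto
qed

lemma finite_sticks_level_le: "finite {v \<in> sticks k R. length (snd v) \<le> m}"
proof -
  have "{v \<in> sticks k R. length (snd v) \<le> m} = {..<R} \<times> {w. set w \<subseteq> {..<k} \<and> length w \<le> m}"
    by (auto simp: sticks_def)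
  thus ?thesis by (simp add: finite_lists_length_le)
qed

lemma finite_dead_sticks:
  assumes "living_sticks k R a n = {}"
  shows "finite {v \<in> sticks k R. dead a v}"
proof (rule finite_subset[OF _ finite_sticks_level_le[of k R n]], safe)
  fix j w assume v: "(j, w) \<in> sticks k R" "dead a (j, w)"
  then obtain i w' where w: "w = i # w'" "living a (j, w')" by (cases w) auto
  show "length (snd (j, w)) \<le> n"
  proof (rule ccontr)
    assume "\<not> ?thesis"
    hence n: "n \<le> length w'" using w by simp
    define u where "u = drop (length w' - n) w'"
    have "living a (j, u)" using w(2) living_suffix[of a j "take (length w' - n) w'" u] by (simp add: u_def)
    moreover have "(j, u) \<in> sticks k R"
      using suffix_sticks[OF v(1)] by (auto simp: w u_def suffix_Cons suffix_drop)
    moreover have "length u = n" using n by (simp add: u_def)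
    ultimately show False using assms by (auto simp: living_sticks_def)
  qed
qed

locale branching = prob_space M for M :: "'a measure" +
  fixes k R :: nat and A :: "stick \<Rightarrow> 'a \<Rightarrow> bool"
  assumes k_ge_2: "2 \<le> k"
    and indep_statuses: "indep_vars (\<lambda>_. count_space UNIV) A {v \<in> sticks k R. snd v \<noteq> []}"
    and alive_prob: "v \<in> {v \<in> sticks k R. snd v \<noteq> []} \<Longrightarrow> prob {\<omega> \<in> space M. A v \<omega>} = 1 / real k"
begin

abbreviation W :: "stick set" where "W \<equiv> {v \<in> sticks k R. snd v \<noteq> []}"

abbreviation status :: "'a \<Rightarrow> stick \<Rightarrow> bool" where "status \<omega> \<equiv> \<lambda>v. A v \<omega>"

lemma A_measurable: "v \<in> W \<Longrightarrow> Measurable.pred M (A v)"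
  using indep_statuses unfolding indep_vars_def by blast

lemma statuses_measurable: "K \<subseteq> W \<Longrightarrow> (\<lambda>\<omega>. \<lambda>v\<in>K. A v \<omega>) \<in> measurable M (PiM K (\<lambda>_. count_space UNIV))"
  by (intro measurable_restrict A_measurable) auto

lemma survives_event:
  assumes "(j, w) \<in> W"
  shows "{\<omega> \<in> space M. survives k (status \<omega>) n j w} \<in> events"
proof -
  have K: "(j, q @ w) \<in> W" if "q \<in> lists {..<k}" for q
    using that assms by (auto simp: sticks_def)
  have "Measurable.pred M (\<lambda>\<omega>. survives k (\<lambda>v\<in>W. A v \<omega>) n j w)"
    by (rule measurable_compose[OF statuses_measurable survives_measurable]) (use K in auto)
  moreover have "survives k (\<lambda>v\<in>W. A v \<omega>) n j w = survives k (status \<omega>) n j w" for \<omega>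
    by (rule survives_cong) (use K in auto)
  ultimately show ?thesis by (simp add: pred_def)
qed

primrec survival_prob :: "nat \<Rightarrow> real" where
  "survival_prob 0 = 1 / real k"
| "survival_prob (Suc n) = (1 - (1 - survival_prob n) ^ k) / real k"

text \<open>A stick survives \<open>n + 1\<close> levels if it is alive and not all of its pieces fail to survive \<open>n\<close>
  levels; these \<open>k + 1\<close> conditions involve disjoint sets of statuses.\<close>

lemma prob_survives:
  assumes "(j, w) \<in> W"
  shows "prob {\<omega> \<in> space M. survives k (status \<omega>) n j w} = survival_prob n"
  using assms
proof (induction n arbitrary: w)
  case 0
  thus ?case using alive_prob by simp
next
  case (Suc n)
  \<comment> \<open>The index \<open>k\<close>, which is not the number of a piece, is given to the stick itself.\<close>
  define K :: "nat \<Rightarrow> stick set"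
    where "K = (\<lambda>i. if i < k then (\<lambda>q. (j, q @ i # w)) ` lists {..<k} else {(j, w)})"
  define Y where "Y = (\<lambda>i a. if i < k then \<not> survives k a n j (i # w) else a (j, w))"
  have KW: "K i \<subseteq> W" for i using Suc.prems by (auto simp: K_def sticks_def split: if_splits)
  have "disjoint_family_on K {..k}"
  proof (unfold disjoint_family_on_def, intro ballI impI)
    fix i i' assume "i \<in> {..k}" "i' \<in> {..k}" "i \<noteq> i'"
    moreover have "q @ i # w = q' @ i' # w \<Longrightarrow> i = i'" for q q'
      using append_same_eq[of "q @ [i]" w "q' @ [i']"] by simp
    moreover have "q @ i # w \<noteq> w" for q i
      by (metis append_self_conv2 append.assoc append_Cons append_Nil append_is_Nil_conv list.distinct(1))
    moreover have "w \<noteq> q @ i # w" for q i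
      by (metis append_self_conv2 append.assoc append_Cons append_Nil append_is_Nil_conv list.distinct(1))
    ultimately show "K i \<inter> K i' = {}" by (auto simp: K_def split: if_splits)
  qed
  hence "indep_vars (\<lambda>i. PiM (K i) (\<lambda>_. count_space UNIV)) (\<lambda>i \<omega>. \<lambda>v\<in>K i. A v \<omega>) {..k}"
    by (intro indep_vars_restrict[OF indep_statuses] KW)
  hence ind: "indep_vars (\<lambda>_. count_space UNIV) (\<lambda>i \<omega>. Y i (\<lambda>v\<in>K i. A v \<omega>)) {..k}"
  proof (rule indep_vars_compose2)
    fix i assume "i \<in> {..k}"
    show "Y i \<in> measurable (PiM (K i) (\<lambda>_. count_space UNIV)) (count_space UNIV)"
    proof (cases "i < k")
      case True
      have [measurable]: "Measurable.pred (PiM (K i) (\<lambda>_. count_space UNIV)) (\<lambda>a. survives k a n j (i # w))"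
        by (rule survives_measurable) (use True in \<open>auto simp: K_def\<close>)
      show ?thesis using True by (simp add: Y_def)
    next
      case False
      hence "(j, w) \<in> K i" by (simp add: K_def)
      hence "(\<lambda>a. a (j, w)) \<in> measurable (PiM (K i) (\<lambda>_. count_space UNIV)) (count_space UNIV)"
        by (rule measurable_component_singleton)
      thus ?thesis using False by (simp add: Y_def)
    qed
  qed
  have Y: "Y i (\<lambda>v\<in>K i. A v \<omega>) = (if i < k then \<not> survives k (status \<omega>) n j (i # w) else A (j, w) \<omega>)" for i \<omega>
  proof -
    have "survives k (\<lambda>v\<in>K i. A v \<omega>) n j (i # w) = survives k (status \<omega>) n j (i # w)" if "i < k"
      by (rule survives_cong) (use that in \<open>auto simp: K_def\<close>)
    thus ?thesis by (auto simp: Y_def K_def)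
  qed
  define a where "a = {\<omega> \<in> space M. A (j, w) \<omega>}"
  define b where "b = (\<lambda>i. {\<omega> \<in> space M. survives k (status \<omega>) n j (i # w)})"
  have a: "a \<in> events" "prob a = 1 / real k"
    using A_measurable[OF Suc.prems] alive_prob[OF Suc.prems] by (auto simp: a_def pred_def)
  have iw: "(j, i # w) \<in> W" if "i < k" for i using Suc.prems that by (auto simp: sticks_def)
  have b: "b i \<in> events" "prob (b i) = survival_prob n" if "i < k" for i
    using survives_event[OF iw[OF that]] Suc.IH[OF iw[OF that]] by (auto simp: b_def)
  define c where "c = {\<omega> \<in> space M. A (j, w) \<omega> \<and> (\<forall>i<k. \<not> survives k (status \<omega>) n j (i # w))}"
  have c_eq: "c = (\<Inter>i\<in>{..k}. (\<lambda>\<omega>. Y i (\<lambda>v\<in>K i. A v \<omega>)) -` {True} \<inter> space M)"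
  proof (rule set_eqI)
    fix \<omega>
    have "(\<forall>i\<in>{..k}. if i < k then P i else Q) \<longleftrightarrow> Q \<and> (\<forall>i<k. P i)" for P Q
      by (metis atMost_iff le_eq_less_or_eq less_irrefl)
    from this[of "\<lambda>i. \<not> survives k (status \<omega>) n j (i # w)" "A (j, w) \<omega>"]
    show "\<omega> \<in> c \<longleftrightarrow> \<omega> \<in> (\<Inter>i\<in>{..k}. (\<lambda>\<omega>. Y i (\<lambda>v\<in>K i. A v \<omega>)) -` {True} \<inter> space M)"
      unfolding c_def Y by simp blast
  qed
  have "prob c = (\<Prod>i\<in>{..k}. prob ((\<lambda>\<omega>. Y i (\<lambda>v\<in>K i. A v \<omega>)) -` {True} \<inter> space M))"
    unfolding c_eq by (rule indep_varsD_finite[OF ind]) auto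
  also have "\<dots> = (\<Prod>i\<in>{..k}. if i < k then 1 - survival_prob n else 1 / real k)"
  proof (rule prod.cong[OF refl])
    fix i assume "i \<in> {..k}"
    show "prob ((\<lambda>\<omega>. Y i (\<lambda>v\<in>K i. A v \<omega>)) -` {True} \<inter> space M) = (if i < k then 1 - survival_prob n else 1 / real k)"
    proof (cases "i < k")
      case True
      have "(\<lambda>\<omega>. Y i (\<lambda>v\<in>K i. A v \<omega>)) -` {True} \<inter> space M = space M - b i"
        unfolding Y b_def using True by auto
      thus ?thesis using True b[OF True] prob_compl by simp
    next
      case False
      have "(\<lambda>\<omega>. Y i (\<lambda>v\<in>K i. A v \<omega>)) -` {True} \<inter> space M = a"
        unfolding Y a_def using False by auto
      thus ?thesis using False a by simp
    qed
  qed
  also have "\<dots> = (1 - survival_prob n) ^ k / real k"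
    by (simp add: lessThan_Suc_atMost[symmetric])
  finally have pc: "prob c = (1 - survival_prob n) ^ k / real k" .
  have "{\<omega> \<in> space M. survives k (status \<omega>) (Suc n) j w} = a - c"
    by (auto simp: a_def c_def)
  moreover have "c = a - (\<Union>i\<in>{..<k}. b i)" by (auto simp: a_def b_def c_def)
  hence "c \<in> events" using a b by auto
  moreover have "c \<subseteq> a" by (auto simp: a_def c_def)
  ultimately have "prob {\<omega> \<in> space M. survives k (status \<omega>) (Suc n) j w} = prob a - prob c"
    using a by (simp add: finite_measure_Diff)
  thus ?case using a pc by (simp add: diff_divide_distrib)
qed

lemma survival_prob_tendsto_0: "survival_prob \<longlonglongrightarrow> 0"
proof (rule quadratic_decrease_tendsto_0)
  have bnd: "0 \<le> survival_prob n \<and> survival_prob n \<le> 1" for n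
  proof (induction n)
    case (Suc n)
    have "0 \<le> (1 - survival_prob n) ^ k" "(1 - survival_prob n) ^ k \<le> 1"
      using Suc by (auto intro: power_le_one)
    thus ?case using k_ge_2 by (auto simp: divide_simps)
  qed (use k_ge_2 in auto)
  thus "0 \<le> survival_prob n" for n by blast
  show "0 < 1 / real k" using k_ge_2 by simp
  fix n
  have "1 - real k * survival_prob n + (survival_prob n)\<^sup>2 \<le> (1 - survival_prob n) ^ k"
    using one_minus_power_lower_bound[OF k_ge_2] bnd by blast
  hence "(1 - (1 - survival_prob n) ^ k) / real k \<le> (real k * survival_prob n - (survival_prob n)\<^sup>2) / real k"
    by (intro divide_right_mono) auto
  also have "\<dots> = survival_prob n - 1 / real k * (survival_prob n)\<^sup>2"
    using k_ge_2 by (simp add: diff_divide_distrib)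
  finally show "survival_prob (Suc n) \<le> survival_prob n - 1 / real k * (survival_prob n)\<^sup>2" by simp
qed

text \<open>If level \<open>n + 1\<close> is inhabited, then one of the \<open>R * k\<close> pieces of the initial sticks survives
  \<open>n\<close> levels. The union bound suffices, as \<open>R\<close> is fixed.\<close>

lemma AE_extinction: "AE \<omega> in M. \<exists>n. living_sticks k R (status \<omega>) n = {}"
proof -
  define S where "S = (\<lambda>n. \<Union>v\<in>{..<R} \<times> {..<k}. {\<omega> \<in> space M. survives k (status \<omega>) n (fst v) [snd v]})"
  have W: "(fst v, [snd v]) \<in> W" if "v \<in> {..<R} \<times> {..<k}" for v using that by (auto simp: sticks_def)
  have ev: "S n \<in> events" for n unfolding S_def using survives_event[OF W] by auto
  have le: "prob (S n) \<le> real (R * k) * survival_prob n" for n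
  proof -
    have "prob (S n) \<le> (\<Sum>v\<in>{..<R} \<times> {..<k}. prob {\<omega> \<in> space M. survives k (status \<omega>) n (fst v) [snd v]})"
      unfolding S_def using survives_event[OF W] by (intro finite_measure_subadditive_finite) auto
    also have "\<dots> = (\<Sum>v\<in>{..<R} \<times> {..<k}. survival_prob n)"
      using prob_survives[OF W] by (intro sum.cong) auto
    finally show ?thesis by (simp add: card_cartesian_product)
  qed
  have "(\<lambda>n. real (R * k) * survival_prob n) \<longlonglongrightarrow> real (R * k) * 0"
    by (intro tendsto_intros survival_prob_tendsto_0)
  moreover have "prob (\<Inter>n. S n) \<le> real (R * k) * survival_prob n" for n
    by (rule order_trans[OF finite_measure_mono[OF _ ev] le]) auto
  ultimately have "prob (\<Inter>n. S n) \<le> 0"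
    by (intro LIMSEQ_le_const[of _ 0]) auto
  hence "prob (\<Inter>n. S n) = 0" by (simp add: measure_le_0_iff)
  hence "(\<Inter>n. S n) \<in> null_sets M" using ev by (auto simp: emeasure_eq_measure null_sets_def)
  moreover have "{\<omega> \<in> space M. \<not> (\<exists>n. living_sticks k R (status \<omega>) n = {})} \<subseteq> (\<Inter>n. S n)"
  proof safe
    fix \<omega> n assume \<omega>: "\<omega> \<in> space M" "\<nexists>n. living_sticks k R (status \<omega>) n = {}"
    hence "living_sticks k R (status \<omega>) (Suc n) \<noteq> {}" by blast
    then obtain j w where w: "(j, w) \<in> sticks k R" "length w = Suc n" "living (status \<omega>) (j, w)"
      by (auto simp: living_sticks_def)
    then obtain q i where q: "w = q @ [i]" by (metis append_butlast_last_id list.size(3) nat.distinct(1))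
    have "survives k (status \<omega>) (length q) j [i]"
      using w q by (intro living_imp_survives) (auto simp: sticks_def)
    thus "\<omega> \<in> S n" using w q \<omega> by (auto simp: S_def sticks_def)
  qed
  ultimately show ?thesis by (rule AE_I')
qed

end

section \<open>Dead sticks on the first levels\<close>

text \<open>The sticks whose statuses decide whether \<open>v\<close> comes into being and is dead: \<open>v\<close> itself and its
  ancestors, without the initial stick.\<close>

definition ancestry :: "stick \<Rightarrow> stick set" where
  "ancestry v = (\<lambda>n. (fst v, drop n (snd v))) ` {..<length (snd v)}"

lemma finite_ancestry: "finite (ancestry v)"
  by (simp add: ancestry_def)

lemma ancestry_eq: "ancestry (j, w) = {(j, q) | q. q \<noteq> [] \<and> suffix q w}"
proof (intro set_eqI iffI)
  fix u assume "u \<in> {(j, q) | q. q \<noteq> [] \<and> suffix q w}"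
  then obtain q p where "u = (j, q)" "q \<noteq> []" "w = p @ q" by (auto simp: suffix_def)
  thus "u \<in> ancestry (j, w)" unfolding ancestry_def by (intro image_eqI[of _ _ "length p"]) auto
qed (auto simp: ancestry_def suffix_drop)

lemma dead_iff_ancestry:
  "dead a v \<longleftrightarrow> snd v \<noteq> [] \<and> (\<forall>u\<in>ancestry v. a u \<longleftrightarrow> u \<noteq> v)"
proof -
  obtain j w where v: "v = (j, w)" by force
  show ?thesis
  proof (cases w)
    case (Cons i w')
    have "(\<forall>u\<in>ancestry v. a u \<longleftrightarrow> u \<noteq> v) \<longleftrightarrow> (\<forall>q. q \<noteq> [] \<and> suffix q (i # w') \<longrightarrow> (a (j, q) \<longleftrightarrow> q \<noteq> i # w'))"
      unfolding v Cons ancestry_eq by blast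
    also have "\<dots> \<longleftrightarrow> (\<forall>q. q \<noteq> [] \<and> suffix q w' \<longrightarrow> a (j, q)) \<and> \<not> a (j, i # w')"
    proof -
      have "\<not> suffix (i # w') w'" using suffix_length_le[of "i # w'" w'] by auto
      moreover have "i # w' \<noteq> []" by simp
      ultimately show ?thesis unfolding suffix_Cons by metis
    qed
    finally show ?thesis by (simp add: v Cons living_iff)
  qed (simp add: v)
qed

lemma card_lists_level_eq: "card {w \<in> lists {..<k}. length w = l} = k ^ l"
  using card_lists_length_eq[of "{..<k}" l] by (simp add: lists_eq_set)

lemma finite_lists_level_eq: "finite {w \<in> lists {..<k::nat}. length w = l}"
  using finite_lists_length_eq[of "{..<k}" l] by (simp add: lists_eq_set)

lemma finite_lists_level_le: "finite {w \<in> lists {..<k::nat}. length w \<le> m}"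
  using finite_lists_length_le[of "{..<k}" m] by (simp add: lists_eq_set)

definition tree_size :: "nat \<Rightarrow> nat \<Rightarrow> nat" where
  "tree_size k m = card {w \<in> lists {..<k}. length w \<le> m}"

lemma sticks_level_le: "{v \<in> sticks k R. length (snd v) \<le> m} = {..<R} \<times> {w \<in> lists {..<k}. length w \<le> m}"
  by (auto simp: sticks_def)

context branching
begin

lemma prob_statuses:
  assumes "finite J" "J \<subseteq> W"
  shows "prob {\<omega> \<in> space M. \<forall>u\<in>J. A u \<omega> \<longleftrightarrow> u \<notin> N} = (\<Prod>u\<in>J. if u \<in> N then 1 - 1 / real k else 1 / real k)"
proof (cases "J = {}")
  case True
  thus ?thesis by (simp add: prob_space)
next
  case False
  have "{\<omega> \<in> space M. \<forall>u\<in>J. A u \<omega> \<longleftrightarrow> u \<notin> N} = (\<Inter>u\<in>J. A u -` {u \<notin> N} \<inter> space M)"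
    using False by auto
  also have "prob \<dots> = (\<Prod>u\<in>J. prob (A u -` {u \<notin> N} \<inter> space M))"
    by (rule indep_varsD[OF indep_statuses False]) (use assms in simp_all)
  also have "\<dots> = (\<Prod>u\<in>J. if u \<in> N then 1 - 1 / real k else 1 / real k)"
  proof (rule prod.cong[OF refl])
    fix u assume "u \<in> J"
    hence u: "u \<in> W" using assms by blast
    have "A u -` {False} \<inter> space M = space M - {\<omega> \<in> space M. A u \<omega>}" by auto
    hence "prob (A u -` {False} \<inter> space M) = 1 - 1 / real k"
      using prob_compl[of "{\<omega> \<in> space M. A u \<omega>}"] A_measurable[OF u] alive_prob[OF u] by (simp add: pred_def)
    moreover have "A u -` {True} \<inter> space M = {\<omega> \<in> space M. A u \<omega>}" by auto
    hence "prob (A u -` {True} \<inter> space M) = 1 / real k" using alive_prob[OF u] by simp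
    ultimately show "prob (A u -` {u \<notin> N} \<inter> space M) = (if u \<in> N then 1 - 1 / real k else 1 / real k)"
      by simp
  qed
  finally show ?thesis .
qed

lemma ancestry_subset: "v \<in> sticks k R \<Longrightarrow> ancestry v \<subseteq> W"
proof
  fix u assume v: "v \<in> sticks k R" and "u \<in> ancestry v"
  moreover obtain j w where vw: "v = (j, w)" by force
  ultimately obtain q where u: "u = (j, q)" "q \<noteq> []" "suffix q w" by (auto simp: ancestry_eq)
  hence "(j, q) \<in> sticks k R" using suffix_sticks v vw by blast
  thus "u \<in> W" using u by simp
qed

lemma dead_event:
  assumes "v \<in> sticks k R"
  shows "Measurable.pred M (\<lambda>\<omega>. dead (status \<omega>) v)"
proof -
  have "Measurable.pred M (\<lambda>\<omega>. \<forall>u\<in>ancestry v. A u \<omega> \<longleftrightarrow> u \<noteq> v)"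
  proof (rule pred_intros_finite[OF finite_ancestry])
    fix u assume "u \<in> ancestry v"
    hence A: "Measurable.pred M (A u)" using ancestry_subset[OF assms] A_measurable by blast
    show "Measurable.pred M (\<lambda>\<omega>. A u \<omega> = (u \<noteq> v))"
      using A pred_intros_logic(2)[OF A] by (cases "u = v") auto
  qed
  thus ?thesis unfolding dead_iff_ancestry by simp
qed

lemma prob_dead:
  assumes "v \<in> sticks k R" "snd v \<noteq> []"
  shows "prob {\<omega> \<in> space M. dead (status \<omega>) v} = (1 - 1 / real k) * (1 / real k) ^ (length (snd v) - 1)"
proof -
  obtain j w where v: "v = (j, w)" by force
  obtain l where l: "length w = Suc l" using assms v by (cases w) auto
  have inj: "inj_on (\<lambda>n. (j, drop n w)) {..<length w}"
  proof (rule inj_onI)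
    fix n n' assume "n \<in> {..<length w}" "n' \<in> {..<length w}" "(j, drop n w) = (j, drop n' w)"
    moreover from this have "length (drop n w) = length (drop n' w)" by simp
    ultimately show "n = n'" by (simp only: length_drop lessThan_iff)
  qed
  have "prob {\<omega> \<in> space M. dead (status \<omega>) v} = prob {\<omega> \<in> space M. \<forall>u\<in>ancestry v. A u \<omega> \<longleftrightarrow> u \<notin> {v}}"
    using assms(2) by (simp add: dead_iff_ancestry)
  also have "\<dots> = (\<Prod>u\<in>ancestry v. if u \<in> {v} then 1 - 1 / real k else 1 / real k)"
    by (rule prob_statuses[OF finite_ancestry ancestry_subset[OF assms(1)]])
  also have "\<dots> = (\<Prod>n<length w. if (j, drop n w) = v then 1 - 1 / real k else 1 / real k)"
    unfolding ancestry_def v using inj by (simp add: prod.reindex)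
  also have "\<dots> = (\<Prod>n<Suc l. if n = 0 then 1 - 1 / real k else 1 / real k)"
    unfolding l
  proof (rule prod.cong[OF refl])
    fix n assume "n \<in> {..<Suc l}"
    have "drop n w = w \<longleftrightarrow> n = 0"
    proof
      assume "drop n w = w"
      hence "length (drop n w) = length w" by simp
      thus "n = 0" using l by simp
    qed simp
    thus "(if (j, drop n w) = v then 1 - 1 / real k else 1 / real k) = (if n = 0 then 1 - 1 / real k else 1 / real k)"
      by (simp add: v)
  qed
  also have "\<dots> = (1 - 1 / real k) * (1 / real k) ^ l"
    by (subst prod.lessThan_Suc_shift) simp
  finally show ?thesis by (simp add: v l)
qed

lemma prob_dead_dead:
  assumes v: "v \<in> sticks k R" "snd v \<noteq> []" and v': "v' \<in> sticks k R" "snd v' \<noteq> []" and ne: "fst v \<noteq> fst v'"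
  shows "prob {\<omega> \<in> space M. dead (status \<omega>) v \<and> dead (status \<omega>) v'} =
     prob {\<omega> \<in> space M. dead (status \<omega>) v} * prob {\<omega> \<in> space M. dead (status \<omega>) v'}"
proof -
  have eq: "(\<forall>u\<in>ancestry v. a u \<longleftrightarrow> u \<noteq> v) \<longleftrightarrow> (\<forall>u\<in>ancestry v. a u \<longleftrightarrow> u \<notin> {v, v'})"
    "(\<forall>u\<in>ancestry v'. a u \<longleftrightarrow> u \<noteq> v') \<longleftrightarrow> (\<forall>u\<in>ancestry v'. a u \<longleftrightarrow> u \<notin> {v, v'})" for a
  proof -
    have "u \<noteq> v'" if "u \<in> ancestry v" for u using that ne by (cases v) (auto simp: ancestry_eq)
    thus "(\<forall>u\<in>ancestry v. a u \<longleftrightarrow> u \<noteq> v) \<longleftrightarrow> (\<forall>u\<in>ancestry v. a u \<longleftrightarrow> u \<notin> {v, v'})" by auto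
    have "u \<noteq> v" if "u \<in> ancestry v'" for u using that ne by (cases v') (auto simp: ancestry_eq)
    thus "(\<forall>u\<in>ancestry v'. a u \<longleftrightarrow> u \<noteq> v') \<longleftrightarrow> (\<forall>u\<in>ancestry v'. a u \<longleftrightarrow> u \<notin> {v, v'})" by auto
  qed
  have disj: "ancestry v \<inter> ancestry v' = {}" using ne by (cases v; cases v') (auto simp: ancestry_eq)
  have "prob {\<omega> \<in> space M. dead (status \<omega>) v \<and> dead (status \<omega>) v'} =
     prob {\<omega> \<in> space M. \<forall>u\<in>ancestry v \<union> ancestry v'. A u \<omega> \<longleftrightarrow> u \<notin> {v, v'}}"
    unfolding dead_iff_ancestry eq using v v' by (simp only: ball_Un simp_thms)
  also have "\<dots> = (\<Prod>u\<in>ancestry v \<union> ancestry v'. if u \<in> {v, v'} then 1 - 1 / real k else 1 / real k)"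
    using ancestry_subset v v' by (intro prob_statuses) (auto simp: finite_ancestry)
  also have "\<dots> = (\<Prod>u\<in>ancestry v. if u \<in> {v, v'} then 1 - 1 / real k else 1 / real k) *
      (\<Prod>u\<in>ancestry v'. if u \<in> {v, v'} then 1 - 1 / real k else 1 / real k)"
    by (rule prod.union_disjoint[OF finite_ancestry finite_ancestry disj])
  also have "\<dots> = prob {\<omega> \<in> space M. \<forall>u\<in>ancestry v. A u \<omega> \<longleftrightarrow> u \<notin> {v, v'}} *
      prob {\<omega> \<in> space M. \<forall>u\<in>ancestry v'. A u \<omega> \<longleftrightarrow> u \<notin> {v, v'}}"
    using ancestry_subset v v' by (simp only: prob_statuses finite_ancestry)
  also have "\<dots> = prob {\<omega> \<in> space M. dead (status \<omega>) v} * prob {\<omega> \<in> space M. dead (status \<omega>) v'}"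
    unfolding dead_iff_ancestry eq using v v' by (simp only: simp_thms)
  finally show ?thesis .
qed

text \<open>Criticality: on level \<open>l \<ge> 1\<close> of a tree there are \<open>k ^ l\<close> addresses, each dead with
  probability \<open>(1 - 1 / k) * (1 / k) ^ (l - 1)\<close>, so that every level contributes \<open>k - 1\<close>.\<close>

lemma sum_prob_dead:
  assumes "j < R"
  shows "(\<Sum>w\<in>{w \<in> lists {..<k}. length w \<le> m}. prob {\<omega> \<in> space M. dead (status \<omega>) (j, w)}) = real m * (real k - 1)"
proof (induction m)
  case 0
  have "{w \<in> lists {..<k}. length w \<le> 0} = {[]}" by auto
  thus ?case by simp
next
  case (Suc m)
  have split: "{w \<in> lists {..<k}. length w \<le> Suc m} = {w \<in> lists {..<k}. length w \<le> m} \<union> {w \<in> lists {..<k}. length w = Suc m}"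
    by auto
  have "(\<Sum>w\<in>{w \<in> lists {..<k}. length w = Suc m}. prob {\<omega> \<in> space M. dead (status \<omega>) (j, w)}) =
     (\<Sum>w\<in>{w \<in> lists {..<k}. length w = Suc m}. (1 - 1 / real k) * (1 / real k) ^ m)"
  proof (rule sum.cong[OF refl])
    fix w assume "w \<in> {w \<in> lists {..<k}. length w = Suc m}"
    thus "prob {\<omega> \<in> space M. dead (status \<omega>) (j, w)} = (1 - 1 / real k) * (1 / real k) ^ m"
      using prob_dead[of "(j, w)"] assms by (cases w) (auto simp: sticks_def)
  qed
  also have "\<dots> = real (k ^ Suc m) * ((1 - 1 / real k) * (1 / real k) ^ m)"
    by (simp only: sum_constant card_lists_level_eq)
  also have "\<dots> = (real k * (1 / real k)) ^ m * (real k * (1 - 1 / real k))"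
    by (simp only: power_mult_distrib of_nat_power of_nat_mult power_Suc mult_ac)
  also have "\<dots> = real k - 1" using k_ge_2 by (simp add: right_diff_distrib)
  finally show ?case unfolding split
    by (subst sum.union_disjoint[OF finite_lists_level_le finite_lists_level_eq])
       (auto simp: Suc.IH algebra_simps)
qed

text \<open>Sticks of different trees are uncorrelated, and a covariance is at most 1, so the variance is at
  most the number of pairs in a common tree. It is linear in \<open>R\<close>, like the mean.\<close>

lemma expected_square_deviation_dead:
  fixes m :: nat
  defines "T \<equiv> {v \<in> sticks k R. length (snd v) \<le> m}"
  shows "(\<integral>\<omega>. (\<Sum>v\<in>T. of_bool (dead (status \<omega>) v) - prob {\<omega> \<in> space M. dead (status \<omega>) v})\<^sup>2 \<partial>M)
    \<le> real R * (real (tree_size k m))\<^sup>2"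
proof -
  define p where "p = (\<lambda>v. prob {\<omega> \<in> space M. dead (status \<omega>) v})"
  define \<xi> where "\<xi> = (\<lambda>v \<omega>. of_bool (dead (status \<omega>) v) - p v)"
  have T: "v \<in> sticks k R" if "v \<in> T" for v using that by (simp add: T_def)
  have fin: "finite T" unfolding T_def by (rule finite_sticks_level_le)
  have p: "0 \<le> p v" "p v \<le> 1" for v by (auto simp: p_def)
  have \<xi>1: "\<bar>\<xi> v \<omega>\<bar> \<le> 1" for v \<omega> using p[of v] by (auto simp: \<xi>_def)
  have m: "\<xi> v \<in> borel_measurable M" if "v \<in> T" for v
    using dead_event[OF T[OF that]] unfolding \<xi>_def by measurable
  have int: "integrable M (\<lambda>\<omega>. \<xi> v \<omega> * \<xi> v' \<omega>)" if "v \<in> T" "v' \<in> T" for v v'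
  proof (rule integrable_const_bound[where B = 1])
    show "AE \<omega> in M. norm (\<xi> v \<omega> * \<xi> v' \<omega>) \<le> 1"
      using \<xi>1 by (intro AE_I2) (simp add: abs_mult mult_le_one)
    show "(\<lambda>\<omega>. \<xi> v \<omega> * \<xi> v' \<omega>) \<in> borel_measurable M" using m that by measurable
  qed
  have int1: "integrable M (\<lambda>\<omega>. of_bool (dead (status \<omega>) v) :: real)" if "v \<in> T" for v
    using dead_event[OF T[OF that]] by (intro integrable_const_bound[where B = 1]) auto
  have E1: "(\<integral>\<omega>. of_bool (dead (status \<omega>) v) \<partial>M) = p v" if "v \<in> T" for v
  proof -
    have "(\<integral>\<omega>. of_bool (dead (status \<omega>) v) \<partial>M) = (\<integral>\<omega>. indicator {\<omega> \<in> space M. dead (status \<omega>) v} \<omega> \<partial>M)"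
      by (rule Bochner_Integration.integral_cong) (auto simp: indicator_def)
    also have "\<dots> = p v" using dead_event[OF T[OF that]] by (simp add: p_def pred_def)
    finally show ?thesis .
  qed
  have cov: "(\<integral>\<omega>. \<xi> v \<omega> * \<xi> v' \<omega> \<partial>M) \<le> of_bool (fst v = fst v')" if v: "v \<in> T" "v' \<in> T" for v v'
  proof (cases "fst v = fst v'")
    case True
    have "\<xi> v \<omega> * \<xi> v' \<omega> \<le> 1" for \<omega>
    proof -
      have "\<xi> v \<omega> * \<xi> v' \<omega> \<le> \<bar>\<xi> v \<omega>\<bar> * \<bar>\<xi> v' \<omega>\<bar>" by (simp flip: abs_mult)
      also have "\<dots> \<le> 1" using \<xi>1 by (intro mult_le_one) auto
      finally show ?thesis .
    qed
    hence "(\<integral>\<omega>. \<xi> v \<omega> * \<xi> v' \<omega> \<partial>M) \<le> (\<integral>\<omega>. 1 \<partial>M)" using int[OF v] by (intro integral_mono) auto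
    thus ?thesis using True by (simp add: prob_space)
  next
    case False
    define d :: "stick \<Rightarrow> 'a \<Rightarrow> real" where "d = (\<lambda>v \<omega>. of_bool (dead (status \<omega>) v))"
    have "(\<integral>\<omega>. d v \<omega> * d v' \<omega> \<partial>M) = p v * p v'"
    proof (cases "snd v = [] \<or> snd v' = []")
      case True
      hence "p v * p v' = 0" by (auto simp: p_def dead_iff_ancestry)
      moreover have "d v \<omega> * d v' \<omega> = 0" for \<omega> using True by (auto simp: d_def dead_iff_ancestry)
      ultimately show ?thesis by (simp only: Bochner_Integration.integral_zero)
    next
      case nonroot: False
      have "(\<integral>\<omega>. d v \<omega> * d v' \<omega> \<partial>M) =
        (\<integral>\<omega>. indicator {\<omega> \<in> space M. dead (status \<omega>) v \<and> dead (status \<omega>) v'} \<omega> \<partial>M)"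
        by (rule Bochner_Integration.integral_cong) (auto simp: indicator_def d_def)
      also have "\<dots> = prob {\<omega> \<in> space M. dead (status \<omega>) v \<and> dead (status \<omega>) v'}"
        using dead_event[OF T[OF v(1)]] dead_event[OF T[OF v(2)]] by simp
      also have "\<dots> = p v * p v'"
        unfolding p_def using prob_dead_dead T v False nonroot by blast
      finally show ?thesis .
    qed
    moreover have "integrable M (\<lambda>\<omega>. d v \<omega> * d v' \<omega>)"
      using dead_event[OF T[OF v(1)]] dead_event[OF T[OF v(2)]] unfolding d_def
      by (intro integrable_const_bound[where B = 1]) auto
    moreover have "\<xi> v \<omega> * \<xi> v' \<omega> = d v \<omega> * d v' \<omega> - p v' * d v \<omega> - p v * d v' \<omega> + p v * p v'" for \<omega>
      by (simp only: \<xi>_def d_def algebra_simps)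
    moreover have "integrable M (d v)" "integrable M (d v')" "(\<integral>\<omega>. d v \<omega> \<partial>M) = p v" "(\<integral>\<omega>. d v' \<omega> \<partial>M) = p v'"
      using int1 E1 v by (simp_all add: d_def)
    ultimately have "(\<integral>\<omega>. \<xi> v \<omega> * \<xi> v' \<omega> \<partial>M) = p v * p v' - p v' * p v - p v * p v' + p v * p v'"
      by (simp add: prob_space)
    thus ?thesis using False by simp
  qed
  have "(\<integral>\<omega>. (\<Sum>v\<in>T. \<xi> v \<omega>)\<^sup>2 \<partial>M) = (\<integral>\<omega>. (\<Sum>v\<in>T. \<Sum>v'\<in>T. \<xi> v \<omega> * \<xi> v' \<omega>) \<partial>M)"
    by (simp add: power2_eq_square sum_product)
  also have "\<dots> = (\<Sum>v\<in>T. \<Sum>v'\<in>T. \<integral>\<omega>. \<xi> v \<omega> * \<xi> v' \<omega> \<partial>M)"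
    using int by (simp add: Bochner_Integration.integral_sum)
  also have "\<dots> \<le> (\<Sum>v\<in>T. \<Sum>v'\<in>T. of_bool (fst v = fst v'))"
    by (intro sum_mono cov)
  also have "\<dots> = (\<Sum>v\<in>T. real (tree_size k m))"
  proof (rule sum.cong[OF refl])
    fix v assume "v \<in> T"
    hence v: "fst v < R" by (auto simp: T_def sticks_def)
    have "(\<Sum>v'\<in>T. of_bool (fst v = fst v')) = real (card {v' \<in> T. fst v = fst v'})"
      using fin by (simp add: of_bool_def sum.If_cases Int_def)
    also have "{v' \<in> T. fst v = fst v'} = {fst v} \<times> {w \<in> lists {..<k}. length w \<le> m}"
      using v by (auto simp: T_def sticks_def)
    finally show "(\<Sum>v'\<in>T. of_bool (fst v = fst v')) = real (tree_size k m)"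
      by (simp add: tree_size_def card_cartesian_product)
  qed
  also have "\<dots> = real R * (real (tree_size k m))\<^sup>2"
    by (simp add: T_def sticks_level_le card_cartesian_product tree_size_def power2_eq_square)
  finally show ?thesis by (simp add: \<xi>_def p_def)
qed

text \<open>The mean is \<open>R * m * (k - 1)\<close>, and \<open>k - 1 \<ge> 1\<close>. As \<open>m\<close> is arbitrary, the ending
  sticks far outnumber the initial ones when \<open>R\<close> is large, with probability close to 1.\<close>

lemma prob_few_dead:
  fixes m :: nat
  assumes m: "1 \<le> m" and R: "1 \<le> R"
  defines "T \<equiv> {v \<in> sticks k R. length (snd v) \<le> m}"
  shows "{\<omega> \<in> space M. real (card {v \<in> T. dead (status \<omega>) v}) < real (R * m) / 2} \<in> events"
    and "prob {\<omega> \<in> space M. real (card {v \<in> T. dead (status \<omega>) v}) < real (R * m) / 2} \<le>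
      4 * (real (tree_size k m))\<^sup>2 / real R"
proof -
  define Y where "Y = (\<lambda>\<omega>. \<Sum>v\<in>T. of_bool (dead (status \<omega>) v) - prob {\<omega> \<in> space M. dead (status \<omega>) v})"
  have fin: "finite T" unfolding T_def by (rule finite_sticks_level_le)
  have T: "v \<in> sticks k R" if "v \<in> T" for v using that by (simp add: T_def)
  have card: "real (card {v \<in> T. dead (status \<omega>) v}) = (\<Sum>v\<in>T. of_bool (dead (status \<omega>) v))" for \<omega>
    using fin by (simp add: of_bool_def sum.If_cases Int_def)
  have cm: "(\<lambda>\<omega>. real (card {v \<in> T. dead (status \<omega>) v})) \<in> borel_measurable M"
    unfolding card
  proof (rule borel_measurable_sum)
    fix v assume "v \<in> T"
    note [measurable] = dead_event[OF T[OF this]]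
    show "(\<lambda>\<omega>. of_bool (dead (status \<omega>) v) :: real) \<in> borel_measurable M" by measurable
  qed
  thus ev: "{\<omega> \<in> space M. real (card {v \<in> T. dead (status \<omega>) v}) < real (R * m) / 2} \<in> events"
    by measurable
  have mean: "(\<Sum>v\<in>T. prob {\<omega> \<in> space M. dead (status \<omega>) v}) = real R * (real m * (real k - 1))"
  proof -
    have "(\<Sum>v\<in>T. prob {\<omega> \<in> space M. dead (status \<omega>) v}) =
      (\<Sum>j<R. \<Sum>w\<in>{w \<in> lists {..<k}. length w \<le> m}. prob {\<omega> \<in> space M. dead (status \<omega>) (j, w)})"
      unfolding T_def sticks_level_le by (simp add: sum.cartesian_product)
    also have "\<dots> = (\<Sum>j<R. real m * (real k - 1))" by (intro sum.cong sum_prob_dead) auto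
    finally show ?thesis by simp
  qed
  have Ycard: "Y \<omega> = real (card {v \<in> T. dead (status \<omega>) v}) - real R * (real m * (real k - 1))" for \<omega>
    unfolding Y_def card by (simp add: sum_subtractf mean)
  have Ym[measurable]: "Y \<in> borel_measurable M" using cm unfolding Ycard by measurable
  have sub: "{\<omega> \<in> space M. real (card {v \<in> T. dead (status \<omega>) v}) < real (R * m) / 2} \<subseteq>
      {\<omega> \<in> space M. (real (R * m) / 2)\<^sup>2 \<le> (Y \<omega>)\<^sup>2}"
  proof safe
    fix \<omega> assume "real (card {v \<in> T. dead (status \<omega>) v}) < real (R * m) / 2"
    moreover have "real (R * m) * 1 \<le> real (R * m) * (real k - 1)" using k_ge_2 by (intro mult_left_mono) auto
    ultimately have "real (R * m) / 2 \<le> - Y \<omega>" by (simp add: Ycard algebra_simps)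
    hence "(real (R * m) / 2)\<^sup>2 \<le> (- Y \<omega>)\<^sup>2" by (intro power_mono) auto
    thus "(real (R * m) / 2)\<^sup>2 \<le> (Y \<omega>)\<^sup>2" by simp
  qed
  have bnd: "\<bar>Y \<omega>\<bar> \<le> real (card T)" for \<omega>
  proof -
    have "\<bar>Y \<omega>\<bar> \<le> (\<Sum>v\<in>T. \<bar>of_bool (dead (status \<omega>) v) - prob {\<omega> \<in> space M. dead (status \<omega>) v}\<bar>)"
      unfolding Y_def by (rule sum_abs)
    also have "\<dots> \<le> (\<Sum>v\<in>T. 1)"
    proof (rule sum_mono)
      fix v
      show "\<bar>of_bool (dead (status \<omega>) v) - prob {\<omega> \<in> space M. dead (status \<omega>) v}\<bar> \<le> 1"
        using prob_le_1[of "{\<omega> \<in> space M. dead (status \<omega>) v}"]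
          measure_nonneg[of M "{\<omega> \<in> space M. dead (status \<omega>) v}"] by (cases "dead (status \<omega>) v") auto
    qed
    finally show ?thesis by simp
  qed
  have intY: "integrable M (\<lambda>\<omega>. (Y \<omega>)\<^sup>2)"
  proof (rule integrable_const_bound[where B = "(real (card T))\<^sup>2"])
    show "AE \<omega> in M. norm ((Y \<omega>)\<^sup>2) \<le> (real (card T))\<^sup>2"
      using bnd by (intro AE_I2) (simp add: abs_le_square_iff[symmetric])
  qed measurable
  have pos: "0 < (real (R * m) / 2)\<^sup>2" using m R by simp
  have "prob {\<omega> \<in> space M. real (card {v \<in> T. dead (status \<omega>) v}) < real (R * m) / 2} \<le>
     prob {\<omega> \<in> space M. (real (R * m) / 2)\<^sup>2 \<le> (Y \<omega>)\<^sup>2}"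
    by (rule finite_measure_mono[OF sub]) measurable
  also have "\<dots> \<le> (\<integral>\<omega>. (Y \<omega>)\<^sup>2 \<partial>M) / (real (R * m) / 2)\<^sup>2"
    by (rule integral_Markov_inequality_measure[OF intY sets.empty_sets _ pos]) auto
  also have "\<dots> \<le> (real R * (real (tree_size k m))\<^sup>2) / (real R / 2)\<^sup>2"
  proof (rule frac_le)
    show "(\<integral>\<omega>. (Y \<omega>)\<^sup>2 \<partial>M) \<le> real R * (real (tree_size k m))\<^sup>2"
      unfolding Y_def T_def by (rule expected_square_deviation_dead)
    have "real R * 1 \<le> real R * real m" using m by (intro mult_left_mono) auto
    thus "(real R / 2)\<^sup>2 \<le> (real (R * m) / 2)\<^sup>2" by (intro power_mono) auto
  qed (use R in auto)
  also have "\<dots> = 4 * (real (tree_size k m))\<^sup>2 / real R"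
    using R by (simp add: power2_eq_square field_simps)
  finally show "prob {\<omega> \<in> space M. real (card {v \<in> T. dead (status \<omega>) v}) < real (R * m) / 2} \<le>
      4 * (real (tree_size k m))\<^sup>2 / real R" .
qed

end

section \<open>The mean square error\<close>

text \<open>Tonelli for independent \<open>X\<close> and \<open>Y\<close>: the cut points can be averaged out first, for given
  statuses.\<close>

lemma (in prob_space) nn_integral_independent_pair:
  assumes X: "X \<in> measurable M S" and Y: "Y \<in> measurable M T"
    and ind: "\<And>a b. a \<in> sets S \<Longrightarrow> b \<in> sets T \<Longrightarrow>
      prob ((X -` a \<inter> space M) \<inter> (Y -` b \<inter> space M)) = prob (X -` a \<inter> space M) * prob (Y -` b \<inter> space M)"
    and f: "f \<in> borel_measurable (S \<Otimes>\<^sub>M T)"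
  shows "(\<integral>\<^sup>+\<omega>. f (X \<omega>, Y \<omega>) \<partial>M) = (\<integral>\<^sup>+\<omega>. (\<integral>\<^sup>+\<omega>'. f (X \<omega>', Y \<omega>) \<partial>M) \<partial>M)"
proof -
  have ind': "emeasure M ((X -` a \<inter> space M) \<inter> (Y -` b \<inter> space M)) =
      emeasure M (X -` a \<inter> space M) * emeasure M (Y -` b \<inter> space M)" if "a \<in> sets S" "b \<in> sets T" for a b
    using ind[OF that] by (simp add: emeasure_eq_measure ennreal_mult)
  interpret PX: prob_space "distr M S X" by (rule prob_space_distr[OF X])
  interpret PY: prob_space "distr M T Y" by (rule prob_space_distr[OF Y])
  interpret pair_prob_space "distr M S X" "distr M T Y" ..
  have XY: "(\<lambda>\<omega>. (X \<omega>, Y \<omega>)) \<in> measurable M (S \<Otimes>\<^sub>M T)" using X Y by (rule measurable_Pair)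
  have joint: "distr M S X \<Otimes>\<^sub>M distr M T Y = distr M (S \<Otimes>\<^sub>M T) (\<lambda>\<omega>. (X \<omega>, Y \<omega>))"
  proof (rule pair_measure_eqI)
    show "sigma_finite_measure (distr M S X)" "sigma_finite_measure (distr M T Y)" by unfold_locales
    fix a b assume ab: "a \<in> sets (distr M S X)" "b \<in> sets (distr M T Y)"
    have "emeasure (distr M (S \<Otimes>\<^sub>M T) (\<lambda>\<omega>. (X \<omega>, Y \<omega>))) (a \<times> b) = emeasure M ((X -` a \<inter> space M) \<inter> (Y -` b \<inter> space M))"
      using ab by (subst emeasure_distr[OF XY]) (auto intro!: arg_cong[where f = "emeasure M"])
    thus "emeasure (distr M S X) a * emeasure (distr M T Y) b =
        emeasure (distr M (S \<Otimes>\<^sub>M T) (\<lambda>\<omega>. (X \<omega>, Y \<omega>))) (a \<times> b)"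
      using ab ind'[of a b] X Y by (simp add: emeasure_distr)
  qed simp
  have fd: "f \<in> borel_measurable (distr M S X \<Otimes>\<^sub>M distr M T Y)"
    using f by (simp cong: measurable_cong_sets)
  have "(\<integral>\<^sup>+\<omega>. f (X \<omega>, Y \<omega>) \<partial>M) = (\<integral>\<^sup>+z. f z \<partial>distr M (S \<Otimes>\<^sub>M T) (\<lambda>\<omega>. (X \<omega>, Y \<omega>)))"
    using f X Y by (subst nn_integral_distr) auto
  also have "\<dots> = (\<integral>\<^sup>+z. f z \<partial>(distr M S X \<Otimes>\<^sub>M distr M T Y))"
    by (simp only: joint)
  also have "\<dots> = (\<integral>\<^sup>+y. (\<integral>\<^sup>+x. f (x, y) \<partial>distr M S X) \<partial>distr M T Y)"
    by (rule nn_integral_snd[OF fd, symmetric])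
  also have "\<dots> = (\<integral>\<^sup>+\<omega>. (\<integral>\<^sup>+x. f (x, Y \<omega>) \<partial>distr M S X) \<partial>M)"
    using PX.borel_measurable_nn_integral_fst[of "\<lambda>(y, x). f (x, y)" T] f
    by (intro nn_integral_distr Y) (simp cong: measurable_cong_sets)
  also have "\<dots> = (\<integral>\<^sup>+\<omega>. (\<integral>\<^sup>+\<omega>'. f (X \<omega>', Y \<omega>) \<partial>M) \<partial>M)"
  proof (rule nn_integral_cong)
    fix \<omega> assume "\<omega> \<in> space M"
    hence "Y \<omega> \<in> space T" using Y by (simp add: measurable_space)
    hence "(\<lambda>x. f (x, Y \<omega>)) \<in> borel_measurable S" using f by measurable
    thus "(\<integral>\<^sup>+x. f (x, Y \<omega>) \<partial>distr M S X) = (\<integral>\<^sup>+\<omega>'. f (X \<omega>', Y \<omega>) \<partial>M)"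
      by (intro nn_integral_distr X) (simp only: measurable_distr_eq1)
  qed
  finally show ?thesis .
qed

text \<open>Infinite sets are replaced by the empty one, so that the values lie in the countable set of finite
  sets of sticks.\<close>

definition ending_sticks :: "nat \<Rightarrow> nat \<Rightarrow> (stick \<Rightarrow> bool) \<Rightarrow> stick set" where
  "ending_sticks k R a = (if finite {v \<in> sticks k R. dead a v} then {v \<in> sticks k R. dead a v} else {})"

definition mean_below :: "nat \<Rightarrow> real \<Rightarrow> real \<Rightarrow> real \<Rightarrow> (stick \<Rightarrow> nat \<Rightarrow> real) \<Rightarrow> stick set \<Rightarrow> real" where
  "mean_below k L B s x F = (\<Sum>v\<in>F. below k L B s x v) / real (card F)"

lemma significand_proportion_eq:
  "significand_proportion B s (ending_lengths k R L x a) = mean_below k L B s x (ending_sticks k R a)"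
proof (cases "finite {v \<in> sticks k R. dead a v}")
  case True
  define F where "F = {v \<in> sticks k R. dead a v}"
  have F: "finite F" using True by (simp add: F_def)
  have "filter_mset (\<lambda>l. significand B l \<le> s) (image_mset (stick_length k L x) (mset_set F)) =
     image_mset (stick_length k L x) (filter_mset (\<lambda>v. significand B (stick_length k L x v) \<le> s) (mset_set F))"
    by (simp add: filter_mset_image_mset)
  also have "size \<dots> = card {v \<in> F. significand B (stick_length k L x v) \<le> s}"
    using F by (simp add: filter_mset_mset_set)
  also have "real \<dots> = (\<Sum>v\<in>F. below k L B s x v)"
    using F by (simp add: below_def of_bool_def sum.If_cases Int_def)
  finally show ?thesis using True F
    by (simp add: significand_proportion_def ending_lengths_def mean_below_def ending_sticks_def F_def[symmetric])
qed (simp add: significand_proportion_def ending_lengths_def mean_below_def ending_sticks_def)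

lemma ending_sticks_subset: "ending_sticks k R a \<subseteq> sticks k R"
  by (auto simp: ending_sticks_def)

lemma finite_ending_sticks: "finite (ending_sticks k R a)"
  by (simp add: ending_sticks_def)

lemma mean_below_bounds: "0 \<le> mean_below k L B s x F" "mean_below k L B s x F \<le> 1"
proof -
  have "0 \<le> (\<Sum>v\<in>F. below k L B s x v)" by (intro sum_nonneg) (simp add: below_def)
  thus "0 \<le> mean_below k L B s x F" by (simp add: mean_below_def)
  have "(\<Sum>v\<in>F. below k L B s x v) \<le> (\<Sum>v\<in>F. 1)" by (intro sum_mono) (simp add: below_def)
  thus "mean_below k L B s x F \<le> 1" by (cases "card F = 0") (auto simp: mean_below_def divide_le_eq_1)
qed

lemma dead_measurable:
  assumes "ancestry v \<subseteq> W"
  shows "Measurable.pred (PiM W (\<lambda>_. count_space UNIV)) (\<lambda>a. dead a v)"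
proof -
  have "Measurable.pred (PiM W (\<lambda>_. count_space UNIV)) (\<lambda>a. \<forall>u\<in>ancestry v. a u \<longleftrightarrow> u \<noteq> v)"
  proof (rule pred_intros_finite[OF finite_ancestry])
    fix u assume "u \<in> ancestry v"
    hence "(\<lambda>a. a u) \<in> measurable (PiM W (\<lambda>_. count_space UNIV)) (count_space UNIV)"
      using assms by (intro measurable_component_singleton) auto
    thus "Measurable.pred (PiM W (\<lambda>_. count_space UNIV)) (\<lambda>a. a u \<longleftrightarrow> u \<noteq> v)"
      using pred_intros_logic(2) by (cases "u = v") auto
  qed
  thus ?thesis unfolding dead_iff_ancestry by simp
qed

text \<open>As the target is countable, it suffices that preimages of single finite sets are measurable.\<close>

lemma ending_sticks_measurable:
  assumes W: "\<And>v. v \<in> sticks k R \<Longrightarrow> ancestry v \<subseteq> W"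
  shows "ending_sticks k R \<in> measurable (PiM W (\<lambda>_. count_space UNIV)) (count_space {F. finite F \<and> F \<subseteq> sticks k R})"
    (is "_ \<in> measurable ?N (count_space ?I)")
proof -
  have I: "countable ?I" by (rule countable_Collect_finite_subset[OF countable_sticks])
  have E: "{a \<in> space ?N. {v \<in> sticks k R. dead a v} = F} \<in> sets ?N" if "F \<in> ?I" for F
  proof -
    have "{a \<in> space ?N. \<forall>v. v \<in> sticks k R \<longrightarrow> (dead a v \<longleftrightarrow> v \<in> F)} \<in> sets ?N"
    proof (rule sets.sets_Collect_countable_All)
      fix v
      show "{a \<in> space ?N. v \<in> sticks k R \<longrightarrow> (dead a v \<longleftrightarrow> v \<in> F)} \<in> sets ?N"
      proof (cases "v \<in> sticks k R")
        case True
        note d = dead_measurable[OF W[OF True]]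
        have "Measurable.pred ?N (\<lambda>a. dead a v \<longleftrightarrow> v \<in> F)"
          using d pred_intros_logic(2)[OF d] by (cases "v \<in> F") auto
        thus ?thesis using True by (simp add: pred_def)
      qed simp
    qed
    moreover have "{v \<in> sticks k R. dead a v} = F \<longleftrightarrow> (\<forall>v. v \<in> sticks k R \<longrightarrow> (dead a v \<longleftrightarrow> v \<in> F))" for a
      using that by blast
    ultimately show ?thesis by simp
  qed
  show ?thesis
    unfolding measurable_count_space_eq_countable[OF I]
  proof (intro conjI ballI)
    show "ending_sticks k R \<in> space ?N \<rightarrow> ?I"
      using ending_sticks_subset finite_ending_sticks by auto
    fix F assume F: "F \<in> ?I"
    show "ending_sticks k R -` {F} \<inter> space ?N \<in> sets ?N"
    proof (cases "F = {}")
      case False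
      hence "ending_sticks k R -` {F} \<inter> space ?N = {a \<in> space ?N. {v \<in> sticks k R. dead a v} = F}"
      proof -
        have "ending_sticks k R a = F \<longleftrightarrow> {v \<in> sticks k R. dead a v} = F" for a
          unfolding ending_sticks_def using False F by (cases "finite {v \<in> sticks k R. dead a v}") auto
        thus ?thesis by auto
      qed
      thus ?thesis using E[OF F] by simp
    next
      case True
      have "ending_sticks k R -` {F} \<inter> space ?N =
          space ?N - (\<Union>F\<in>?I - {{}}. {a \<in> space ?N. {v \<in> sticks k R. dead a v} = F})"
        unfolding True by (auto simp: ending_sticks_def)
      moreover have "(\<Union>F\<in>?I - {{}}. {a \<in> space ?N. {v \<in> sticks k R. dead a v} = F}) \<in> sets ?N"
        using E by (intro sets.countable_UN'' countable_Diff I) auto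
      ultimately show ?thesis by (simp add: sets.compl_sets)
    qed
  qed
qed

text \<open>If neither stick has a private tail, then either one of them has level below \<open>n\<close>, and the
  other level is below \<open>2 * n\<close>; or they belong to the same tree and \<open>v'\<close> is reached from \<open>v\<close> by going up
  fewer than \<open>2 * n\<close> levels and down \<open>n\<close> levels.\<close>

lemma no_private_tails:
  assumes v: "v \<in> sticks k R" "v' \<in> sticks k R" and no: "\<not> private_tail n v v'" "\<not> private_tail n v' v"
  shows "length (snd v) \<le> 2 * n \<and> length (snd v') \<le> 2 * n \<or>
     v' \<in> (\<lambda>(y, i). (fst v, y @ drop i (snd v))) ` ({y \<in> lists {..<k}. length y = n} \<times> {..<2 * n})"
proof -
  obtain j w j' w' where vw: "v = (j, w)" "v' = (j', w')" by (cases v; cases v') auto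
  have 1: "length w < n \<or> j = j' \<and> strict_suffix (drop n w) w'"
    and 2: "length w' < n \<or> j' = j \<and> strict_suffix (drop n w') w"
    using no by (auto simp: private_tail_def vw)
  have l1: "length w - n < length w'" if "strict_suffix (drop n w) w'" using suffix_length_less[OF that] by simp
  have l2: "length w' - n < length w" if "strict_suffix (drop n w') w" using suffix_length_less[OF that] by simp
  show ?thesis
  proof (cases "length w < n \<or> length w' < n")
    case True
    hence "length w \<le> 2 * n \<and> length w' \<le> 2 * n" using 1 2 l1 l2 by auto
    thus ?thesis by (simp add: vw)
  next
    case False
    hence j: "j = j'" and s: "strict_suffix (drop n w) w'" "strict_suffix (drop n w') w" using 1 2 by auto
    obtain p where p: "w = p @ drop n w'" using s(2) by (auto simp: strict_suffix_def suffix_def)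
    have "length w = length p + (length w' - n)" using p by (metis length_append length_drop)
    hence "length p < 2 * n" using l1[OF s(1)] False by linarith
    moreover have "w' = take n w' @ drop (length p) w"
      using p by (metis append_eq_conv_conj append_take_drop_id)
    moreover have "take n w' \<in> lists {..<k}" "length (take n w') = n"
      using v False set_take_subset[of n w'] by (auto simp: vw sticks_def lists_eq_set)
    ultimately show ?thesis unfolding vw j by (intro disjI2 image_eqI[of _ _ "(take n w', length p)"]) auto
  qed
qed

text \<open>The square counts pairs on low levels, and the other term bounds the relatives of each stick. Both
  are negligible against the square of \<open>card F\<close> when \<open>card F\<close> is large compared to \<open>R\<close>.\<close>

lemma card_no_private_tails:
  assumes F: "finite F" "F \<subseteq> sticks k R"
  shows "card {(v, v') \<in> F \<times> F. \<not> private_tail n v v' \<and> \<not> private_tail n v' v} \<le>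
    (R * tree_size k (2 * n))\<^sup>2 + card F * (2 * n * k ^ n)"
proof -
  define T where "T = {v \<in> sticks k R. length (snd v) \<le> 2 * n}"
  define Q :: "stick \<Rightarrow> stick set" where "Q = (\<lambda>v. (\<lambda>(y, i). (fst v, y @ drop i (snd v))) ` ({y \<in> lists {..<k}. length y = n} \<times> {..<2 * n}))"
  have fT: "finite T" unfolding T_def by (rule finite_sticks_level_le)
  have fQ: "finite (Q v)" for v :: stick unfolding Q_def by (intro finite_imageI finite_cartesian_product finite_lists_level_eq) auto
  have cQ: "card (Q v) \<le> 2 * n * k ^ n" for v :: stick
  proof -
    have "card (Q v) \<le> card ({y \<in> lists {..<k}. length y = n} \<times> {..<2 * n})"
      unfolding Q_def by (intro card_image_le finite_cartesian_product finite_lists_level_eq) auto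
    thus ?thesis by (simp only: card_cartesian_product card_lists_level_eq card_lessThan mult.commute)
  qed
  have "{(v, v') \<in> F \<times> F. \<not> private_tail n v v' \<and> \<not> private_tail n v' v} \<subseteq> T \<times> T \<union> Sigma F Q"
  proof
    fix z assume "z \<in> {(v, v') \<in> F \<times> F. \<not> private_tail n v v' \<and> \<not> private_tail n v' v}"
    then obtain v v' where z: "z = (v, v')" "v \<in> F" "v' \<in> F" "\<not> private_tail n v v'" "\<not> private_tail n v' v"
      by blast
    hence "v \<in> T \<and> v' \<in> T \<or> v' \<in> Q v"
      using no_private_tails[of v k R v' n] F(2) unfolding T_def Q_def by blast
    thus "z \<in> T \<times> T \<union> Sigma F Q" using z by blast
  qed
  hence "card {(v, v') \<in> F \<times> F. \<not> private_tail n v v' \<and> \<not> private_tail n v' v} \<le> card (T \<times> T \<union> Sigma F Q)"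
    using fT fQ F(1) by (intro card_mono) auto
  also have "\<dots> \<le> card (T \<times> T) + card (Sigma F Q)" by (rule card_Un_le)
  also have "card (T \<times> T) = (R * tree_size k (2 * n))\<^sup>2"
    by (simp add: T_def sticks_level_le card_cartesian_product tree_size_def power2_eq_square)
  also have "card (Sigma F Q) = (\<Sum>v\<in>F. card (Q v))" using F(1) fQ by simp
  also have "\<dots> \<le> card F * (2 * n * k ^ n)" using sum_bounded_above[of F "\<lambda>v. card (Q v)"] cQ by simp
  finally show ?thesis by simp
qed

text \<open>The mean square is the average correlation over all pairs in \<open>F\<close>. It suffices that one of the
  two sticks has a private tail.\<close>

lemma (in stick_cuts) expected_square_error:
  assumes B: "1 < B" and s: "1 \<le> s" "s < B" and F: "finite F" "F \<subseteq> V" "F \<noteq> {}" and e: "0 \<le> e"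
    and decorrelated: "\<And>v v'. v \<in> V \<Longrightarrow> v' \<in> V \<Longrightarrow> private_tail n v v' \<Longrightarrow>
      \<bar>\<integral>\<omega>. (below k L B s (cuts \<omega>) v - log B s) * (below k L B s (cuts \<omega>) v' - log B s) \<partial>M\<bar> \<le> e"
  shows "(\<integral>\<omega>. (mean_below k L B s (cuts \<omega>) F - log B s)\<^sup>2 \<partial>M) \<le>
     e + (real (R * tree_size k (2 * n)) / real (card F))\<^sup>2 + real (2 * n * k ^ n) / real (card F)"
proof -
  define g where "g = log B s"
  have g: "0 \<le> g" "g < 1" using B s by (auto simp: g_def)
  define \<xi> where "\<xi> = (\<lambda>v \<omega>. below k L B s (cuts \<omega>) v - g)"
  have \<xi>1: "\<bar>\<xi> v \<omega>\<bar> \<le> 1" for v \<omega> using g by (auto simp: \<xi>_def below_def)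
  have m: "\<xi> v \<in> borel_measurable M" if "v \<in> V" for v
    unfolding \<xi>_def using below_measurable[OF B s(1) that] by measurable
  have int: "integrable M (\<lambda>\<omega>. \<xi> v \<omega> * \<xi> v' \<omega>)" if "v \<in> F" "v' \<in> F" for v v'
  proof (rule integrable_const_bound[where B = 1])
    show "AE \<omega> in M. norm (\<xi> v \<omega> * \<xi> v' \<omega>) \<le> 1"
      using \<xi>1 by (intro AE_I2) (simp add: abs_mult mult_le_one)
    show "(\<lambda>\<omega>. \<xi> v \<omega> * \<xi> v' \<omega>) \<in> borel_measurable M"
      using that F(2) by (intro borel_measurable_times m) blast+
  qed
  define c where "c = (\<lambda>v v'. \<integral>\<omega>. \<xi> v \<omega> * \<xi> v' \<omega> \<partial>M)"
  define bad where "bad = (\<lambda>v v'. \<not> private_tail n v v' \<and> \<not> private_tail n v' v)"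
  have c: "c v v' \<le> e + of_bool (bad v v')" if "v \<in> F" "v' \<in> F" for v v'
  proof (cases "bad v v'")
    case True
    have "\<xi> v \<omega> * \<xi> v' \<omega> \<le> 1" for \<omega>
    proof -
      have "\<xi> v \<omega> * \<xi> v' \<omega> \<le> \<bar>\<xi> v \<omega>\<bar> * \<bar>\<xi> v' \<omega>\<bar>" by (simp flip: abs_mult)
      also have "\<dots> \<le> 1" using \<xi>1 by (intro mult_le_one) auto
      finally show ?thesis .
    qed
    hence "c v v' \<le> (\<integral>\<omega>. 1 \<partial>M)" unfolding c_def using int[OF that] by (intro integral_mono) auto
    thus ?thesis using True e by (simp add: prob_space)
  next
    case False
    have "c v v' = c v' v" by (simp add: c_def mult.commute)
    moreover have "private_tail n v v' \<or> private_tail n v' v" using False by (auto simp: bad_def)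
    ultimately have "\<bar>c v v'\<bar> \<le> e"
      using decorrelated[of v v'] decorrelated[of v' v] that F(2) unfolding c_def \<xi>_def g_def by fastforce
    thus ?thesis using False by simp
  qed
  have card: "real (card F) > 0" using F by (simp add: card_gt_0_iff)
  have mean: "mean_below k L B s (cuts \<omega>) F - g = (\<Sum>v\<in>F. \<xi> v \<omega>) / real (card F)" for \<omega>
    using card by (simp add: mean_below_def \<xi>_def sum_subtractf diff_divide_distrib)
  have "(\<integral>\<omega>. (mean_below k L B s (cuts \<omega>) F - g)\<^sup>2 \<partial>M) = (\<integral>\<omega>. (\<Sum>v\<in>F. \<Sum>v'\<in>F. \<xi> v \<omega> * \<xi> v' \<omega>) / (real (card F))\<^sup>2 \<partial>M)"
    unfolding mean by (simp add: power_divide power2_eq_square sum_product)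
  also have "\<dots> = (\<Sum>v\<in>F. \<Sum>v'\<in>F. c v v') / (real (card F))\<^sup>2"
    using int by (simp add: c_def Bochner_Integration.integral_sum)
  also have "\<dots> \<le> (\<Sum>v\<in>F. \<Sum>v'\<in>F. e + of_bool (bad v v')) / (real (card F))\<^sup>2"
    by (intro divide_right_mono sum_mono c) auto
  also have "(\<Sum>v\<in>F. \<Sum>v'\<in>F. e + of_bool (bad v v')) = e * (real (card F))\<^sup>2 + real (card {(v, v') \<in> F \<times> F. bad v v'})"
  proof -
    have "(\<Sum>v\<in>F. \<Sum>v'\<in>F. of_bool (bad v v')) = (\<Sum>z\<in>F \<times> F. of_bool (bad (fst z) (snd z)) :: real)"
      by (simp add: sum.cartesian_product case_prod_unfold)
    also have "\<dots> = real (card {z \<in> F \<times> F. bad (fst z) (snd z)})"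
      using F by (simp add: of_bool_def sum.If_cases Int_def)
    also have "{z \<in> F \<times> F. bad (fst z) (snd z)} = {(v, v') \<in> F \<times> F. bad v v'}" by auto
    finally show ?thesis by (simp add: sum.distrib power2_eq_square)
  qed
  also have "(\<dots>) / (real (card F))\<^sup>2 \<le>
     (e * (real (card F))\<^sup>2 + real ((R * tree_size k (2 * n))\<^sup>2 + card F * (2 * n * k ^ n))) / (real (card F))\<^sup>2"
    unfolding bad_def
    by (intro divide_right_mono add_left_mono of_nat_mono card_no_private_tails F) auto
  also have "\<dots> = e + (real (R * tree_size k (2 * n)) / real (card F))\<^sup>2 + real (2 * n * k ^ n) / real (card F)"
    using card by (simp add: add_divide_distrib power_divide power2_eq_square)
  finally show ?thesis unfolding g_def .
qed

section \<open>Convergence to strong Benford behavior\<close>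

lemma fragmentation_process_stick_cuts:
  assumes k: "2 \<le> k" and D: "good_distribution (k - 1) D" and P: "fragmentation_process k r D R M X A"
  shows "stick_cuts M k R D X"
proof -
  interpret prob_space M using P by (simp add: fragmentation_process_def Let_def)
  show ?thesis
  proof
    show "indep_vars (\<lambda>_. D) X (sticks k R)" "\<And>v. v \<in> sticks k R \<Longrightarrow> distr M D (X v) = D"
      using P by (auto simp: fragmentation_process_def Let_def)
    fix i assume i: "i < k"
    obtain f where f: "distributed D lborel (\<lambda>y. gap (k - 1) y i) (\<lambda>x. ennreal (f x * indicator {0..} x))"
      using good_distribution_gap[OF D i] .
    show "(\<lambda>y. gap (k - 1) y i) \<in> borel_measurable D" using distributed_measurable[OF f] by simp
    show "AE y in D. 0 < gap (k - 1) y i" by (rule gap_positive[OF f])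
  qed
qed

lemma fragmentation_process_branching:
  assumes k: "2 \<le> k" and P: "fragmentation_process k (1 / real k) D R M X A"
  shows "branching M k R A"
proof -
  interpret prob_space M using P by (simp add: fragmentation_process_def Let_def)
  show ?thesis
    by standard (use P k in \<open>auto simp: fragmentation_process_def Let_def\<close>)
qed

lemma fragmentation_process_independence:
  fixes A :: "stick \<Rightarrow> 'a \<Rightarrow> bool"
  assumes k: "2 \<le> k" and D: "good_distribution (k - 1) D" and P: "fragmentation_process k (1 / real k) D R M X A"
  defines "W \<equiv> {v \<in> sticks k R. snd v \<noteq> []}"
  defines "cuts \<equiv> \<lambda>\<omega>. \<lambda>v\<in>sticks k R. X v \<omega>" and "st \<equiv> \<lambda>\<omega>. \<lambda>v\<in>W. A v \<omega>"
  assumes a: "a \<in> sets (PiM (sticks k R) (\<lambda>_. D))" and b: "b \<in> sets (PiM W (\<lambda>_. count_space UNIV))"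
  shows "measure M ((cuts -` a \<inter> space M) \<inter> (st -` b \<inter> space M)) =
     measure M (cuts -` a \<inter> space M) * measure M (st -` b \<inter> space M)"
proof -
  interpret prob_space M using P by (simp add: fragmentation_process_def Let_def)
  have "indep_set (sets (vimage_algebra (space M) cuts (PiM (sticks k R) (\<lambda>_. D))))
     (sets (vimage_algebra (space M) st (PiM W (\<lambda>_. count_space UNIV))))"
    using P by (simp only: fragmentation_process_def Let_def W_def cuts_def st_def)
  thus ?thesis
    by (rule indep_setD) (use a b in \<open>auto intro: in_vimage_algebra\<close>)
qed

lemma mean_below_measurable:
  assumes cuts: "stick_cuts M k R D X" and B: "1 < B" and s: "1 \<le> s"
    and W: "\<And>v. v \<in> sticks k R \<Longrightarrow> ancestry v \<subseteq> W"
  shows "(\<lambda>z. mean_below k L B s (fst z) (ending_sticks k R (snd z))) \<in>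
    borel_measurable (PiM (sticks k R) (\<lambda>_. D) \<Otimes>\<^sub>M PiM W (\<lambda>_. count_space UNIV))" (is "_ \<in> borel_measurable ?N")
proof (rule measurable_compose_countable'[where f = "\<lambda>F z. mean_below k L B s (fst z) F" and g = "\<lambda>z. ending_sticks k R (snd z)"])
  interpret stick_cuts M k R D X by fact
  show "countable {F. finite F \<and> F \<subseteq> sticks k R}" by (rule countable_Collect_finite_subset[OF countable_sticks])
  show "(\<lambda>z. ending_sticks k R (snd z)) \<in> measurable ?N (count_space {F. finite F \<and> F \<subseteq> sticks k R})"
    by (rule measurable_compose[OF measurable_snd ending_sticks_measurable[OF W]])
  fix F assume F: "F \<in> {F. finite F \<and> F \<subseteq> sticks k R}"
  show "(\<lambda>z. mean_below k L B s (fst z) F) \<in> borel_measurable ?N"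
    unfolding mean_below_def
  proof (intro borel_measurable_divide borel_measurable_sum borel_measurable_const)
    fix v assume "v \<in> F"
    hence "v \<in> V" using F by blast
    thus "(\<lambda>z. below k L B s (fst z) v) \<in> borel_measurable ?N"
      by (intro measurable_compose[OF measurable_fst below_measurable[OF B s]])
  qed
qed

text \<open>For given statuses the error is at most 1 always, and at most that of
  \<open>expected_square_error\<close> with \<open>card F \<ge> R * m / 2\<close> unless the first \<open>m\<close> levels hold few dead sticks. In
  the bound, \<open>e\<close>, then \<open>n\<close> and \<open>m\<close> are to be chosen first, and \<open>R\<close> tends to infinity last.\<close>

lemma second_moment_bound:
  assumes k: "2 \<le> k" and L: "0 < L" and D: "good_distribution (k - 1) D"
    and P: "fragmentation_process k (1 / real k) D R M X A"
    and R: "1 \<le> R" and m: "1 \<le> m" and B: "1 < B" and s: "1 \<le> s" "s < B" and e: "0 \<le> e"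
    and decorrelated: "\<And>v v'. v \<in> sticks k R \<Longrightarrow> v' \<in> sticks k R \<Longrightarrow> private_tail n v v' \<Longrightarrow>
      \<bar>\<integral>\<omega>. (below k L B s (\<lambda>v\<in>sticks k R. X v \<omega>) v - log B s) * (below k L B s (\<lambda>v\<in>sticks k R. X v \<omega>) v' - log B s) \<partial>M\<bar> \<le> e"
  defines "Q \<equiv> \<lambda>\<omega>. significand_proportion B s (ending_lengths k R L (\<lambda>v. X v \<omega>) (\<lambda>v. A v \<omega>))"
  shows "Q \<in> borel_measurable M"
    and "(\<integral>\<omega>. (Q \<omega> - log B s)\<^sup>2 \<partial>M) \<le> e + (2 * real (tree_size k (2 * n)) / real m)\<^sup>2 +
       (2 * real (2 * n * k ^ n) + 4 * (real (tree_size k m))\<^sup>2) / real R"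
proof -
  interpret stick_cuts M k R D X by (rule fragmentation_process_stick_cuts[OF k D P])
  interpret br: branching M k R A by (rule fragmentation_process_branching[OF k P])
  define W where "W = {v \<in> sticks k R. snd v \<noteq> []}"
  define st where "st = (\<lambda>\<omega>. \<lambda>v\<in>W. A v \<omega>)"
  define g where "g = log B s"
  have g: "0 \<le> g" "g < 1" using B s by (auto simp: g_def)
  have anc: "ancestry v \<subseteq> W" if "v \<in> V" for v unfolding W_def by (rule br.ancestry_subset[OF that])
  have st: "st \<in> measurable M (PiM W (\<lambda>_. count_space UNIV))"
    unfolding st_def by (rule br.statuses_measurable) (simp add: W_def)
  have dead_st: "dead (st \<omega>) v = dead (\<lambda>v. A v \<omega>) v" if "v \<in> V" for v \<omega>
    unfolding dead_iff_ancestry st_def using anc[OF that] by auto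
  have ending_st: "ending_sticks k R (st \<omega>) = ending_sticks k R (\<lambda>v. A v \<omega>)" for \<omega>
  proof -
    have "{v \<in> V. dead (st \<omega>) v} = {v \<in> V. dead (\<lambda>v. A v \<omega>) v}" using dead_st by blast
    thus ?thesis by (simp only: ending_sticks_def)
  qed
  have below_cuts: "below k L B s (\<lambda>v. X v \<omega>) v = below k L B s (cuts \<omega>) v" if "v \<in> V" for v \<omega>
    using stick_length_restrict[of "fst v" "snd v" k R L X \<omega>] that by (simp only: below_def prod.collapse)
  have Q: "Q \<omega> = mean_below k L B s (cuts \<omega>) (ending_sticks k R (st \<omega>))" for \<omega>
    unfolding Q_def significand_proportion_eq mean_below_def ending_st
    using ending_sticks_subset by (intro arg_cong2[where f = "(/)"] sum.cong refl below_cuts) blast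
  define f where "f = (\<lambda>z. (mean_below k L B s (fst z) (ending_sticks k R (snd z)) - g)\<^sup>2)"
  have mm: "(\<lambda>z. mean_below k L B s (fst z) (ending_sticks k R (snd z))) \<in>
      borel_measurable (PiM V (\<lambda>_. D) \<Otimes>\<^sub>M PiM W (\<lambda>_. count_space UNIV))"
    by (rule mean_below_measurable[OF stick_cuts_axioms B s(1) anc])
  hence fm: "f \<in> borel_measurable (PiM V (\<lambda>_. D) \<Otimes>\<^sub>M PiM W (\<lambda>_. count_space UNIV))"
    unfolding f_def by measurable
  have pair: "(\<lambda>\<omega>. (cuts \<omega>, st \<omega>)) \<in> measurable M (PiM V (\<lambda>_. D) \<Otimes>\<^sub>M PiM W (\<lambda>_. count_space UNIV))"
    by (rule measurable_Pair[OF cuts_measurable st])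
  show Qm: "Q \<in> borel_measurable M"
    using measurable_compose[OF pair mm] unfolding Q[abs_def] by simp
  have f01: "0 \<le> f z" "f z \<le> 1" for z
  proof -
    show "0 \<le> f z" by (simp add: f_def)
    have "\<bar>mean_below k L B s (fst z) (ending_sticks k R (snd z)) - g\<bar> \<le> 1"
      using mean_below_bounds[of k L B s "fst z" "ending_sticks k R (snd z)"] g by auto
    thus "f z \<le> 1" unfolding f_def by (simp add: abs_square_le_1)
  qed
  define T where "T = {v \<in> sticks k R. length (snd v) \<le> m}"
  define few where "few = {\<omega> \<in> space M. real (card {v \<in> T. dead (\<lambda>v. A v \<omega>) v}) < real (R * m) / 2}"
  have few: "few \<in> events" "prob few \<le> 4 * (real (tree_size k m))\<^sup>2 / real R"
    unfolding few_def T_def by (rule br.prob_few_dead[OF m R])+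
  define \<eta> where "\<eta> = e + (2 * real (tree_size k (2 * n)) / real m)\<^sup>2 + 2 * real (2 * n * k ^ n) / real R"
  have \<eta>: "0 \<le> \<eta>" using e by (simp add: \<eta>_def)
  have "(\<integral>\<^sup>+\<omega>. ennreal (f (cuts \<omega>, st \<omega>)) \<partial>M) = (\<integral>\<^sup>+\<omega>. (\<integral>\<^sup>+\<omega>'. ennreal (f (cuts \<omega>', st \<omega>)) \<partial>M) \<partial>M)"
  proof (rule nn_integral_independent_pair[OF cuts_measurable st])
    fix a :: "(stick \<Rightarrow> nat \<Rightarrow> real) set" and b :: "(stick \<Rightarrow> bool) set"
    assume "a \<in> sets (PiM V (\<lambda>_. D))" "b \<in> sets (PiM W (\<lambda>_. count_space UNIV))"
    thus "prob ((cuts -` a \<inter> space M) \<inter> (st -` b \<inter> space M)) = prob (cuts -` a \<inter> space M) * prob (st -` b \<inter> space M)"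
      unfolding st_def W_def by (rule fragmentation_process_independence[OF k D P])
  qed (use fm in measurable)
  also have "\<dots> \<le> (\<integral>\<^sup>+\<omega>. ennreal \<eta> + indicator few \<omega> \<partial>M)"
  proof (rule nn_integral_mono_AE)
    show "AE \<omega> in M. (\<integral>\<^sup>+\<omega>'. ennreal (f (cuts \<omega>', st \<omega>)) \<partial>M) \<le> ennreal \<eta> + indicator few \<omega>"
      using br.AE_extinction AE_space
    proof eventually_elim
      case (elim \<omega>)
      show ?case
      proof (cases "\<omega> \<in> few")
        case True
        have "(\<integral>\<^sup>+\<omega>'. ennreal (f (cuts \<omega>', st \<omega>)) \<partial>M) \<le> (\<integral>\<^sup>+\<omega>'. 1 \<partial>M)"
          using f01 by (intro nn_integral_mono) simp
        also have "\<dots> = 1" by (simp add: emeasure_space_1)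
        also have "\<dots> \<le> ennreal \<eta> + indicator few \<omega>" using True by simp
        finally show ?thesis .
      next
        case False
        obtain l where "living_sticks k R (\<lambda>v. A v \<omega>) l = {}" using elim by blast
        hence fin: "finite {v \<in> V. dead (\<lambda>v. A v \<omega>) v}" by (rule finite_dead_sticks)
        define F where "F = ending_sticks k R (st \<omega>)"
        have F: "F = {v \<in> V. dead (\<lambda>v. A v \<omega>) v}" using fin by (simp add: F_def ending_st) (simp add: ending_sticks_def)
        have "real (R * m) / 2 \<le> real (card {v \<in> T. dead (\<lambda>v. A v \<omega>) v})"
          using False elim by (simp add: few_def)
        also have "\<dots> \<le> real (card F)" unfolding F using fin by (intro of_nat_mono card_mono) (auto simp: T_def)
        finally have card: "real R * real m / 2 \<le> real (card F)" by simp
        have Rm: "0 < real R" "0 < real m" using R m by auto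
        have card_pos: "0 < real (card F)" using card Rm by (smt (verit) divide_pos_pos mult_pos_pos)
        have "(\<integral>\<omega>'. f (cuts \<omega>', st \<omega>) \<partial>M) \<le>
            e + (real (R * tree_size k (2 * n)) / real (card F))\<^sup>2 + real (2 * n * k ^ n) / real (card F)"
          unfolding f_def fst_conv snd_conv F_def[symmetric] g_def
        proof (rule expected_square_error[OF B s _ _ _ e])
          show "finite F" unfolding F by (rule fin)
          show "F \<subseteq> V" unfolding F by blast
          show "F \<noteq> {}" using card_pos by auto
        qed (rule decorrelated)
        also have "\<dots> \<le> \<eta>"
          unfolding \<eta>_def
        proof (intro add_mono order_refl power_mono)
          have "real (R * tree_size k (2 * n)) / real (card F) \<le> real (R * tree_size k (2 * n)) / (real R * real m / 2)"
            using card Rm by (intro divide_left_mono mult_pos_pos card_pos) auto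
          also have "\<dots> = 2 * real (tree_size k (2 * n)) / real m" using Rm by (simp add: field_simps)
          finally show "real (R * tree_size k (2 * n)) / real (card F) \<le> 2 * real (tree_size k (2 * n)) / real m" .
          have "real R * 1 \<le> real R * real m" using m by (intro mult_left_mono) auto
          hence "real R / 2 \<le> real (card F)" using card by simp
          hence "real (2 * n * k ^ n) / real (card F) \<le> real (2 * n * k ^ n) / (real R / 2)"
            using Rm card_pos by (intro divide_left_mono mult_pos_pos) auto
          thus "real (2 * n * k ^ n) / real (card F) \<le> 2 * real (2 * n * k ^ n) / real R"
            by (simp add: mult.commute)
        qed simp
        finally have le: "(\<integral>\<omega>'. f (cuts \<omega>', st \<omega>) \<partial>M) \<le> \<eta>" .
        have "(\<lambda>\<omega>'. f (cuts \<omega>', st \<omega>)) \<in> borel_measurable M"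
        proof (rule measurable_compose[OF measurable_Pair fm])
          show "cuts \<in> measurable M (PiM V (\<lambda>_. D))" by (rule cuts_measurable)
          show "(\<lambda>_. st \<omega>) \<in> measurable M (PiM W (\<lambda>_. count_space UNIV))"
            using elim st by (intro measurable_const) (simp add: measurable_space)
        qed
        hence "integrable M (\<lambda>\<omega>'. f (cuts \<omega>', st \<omega>))"
          using f01 by (intro integrable_const_bound[where B = 1]) auto
        hence "(\<integral>\<^sup>+\<omega>'. ennreal (f (cuts \<omega>', st \<omega>)) \<partial>M) = ennreal (\<integral>\<omega>'. f (cuts \<omega>', st \<omega>) \<partial>M)"
          using f01 by (intro nn_integral_eq_integral) auto
        also have "\<dots> \<le> ennreal \<eta>" using le by (rule ennreal_leI)
        finally show ?thesis using False by simp
      qed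
    qed
  qed
  also have "\<dots> = ennreal \<eta> + emeasure M few"
    using few(1) by (subst nn_integral_add) (auto simp: emeasure_space_1)
  also have "\<dots> = ennreal (\<eta> + prob few)"
    using \<eta> by (simp add: emeasure_eq_measure)
  finally have le: "(\<integral>\<^sup>+\<omega>. ennreal (f (cuts \<omega>, st \<omega>)) \<partial>M) \<le> ennreal (\<eta> + prob few)" .
  have "(\<lambda>\<omega>. f (cuts \<omega>, st \<omega>)) \<in> borel_measurable M" by (rule measurable_compose[OF pair fm])
  hence "integrable M (\<lambda>\<omega>. f (cuts \<omega>, st \<omega>))"
    using f01 by (intro integrable_const_bound[where B = 1]) auto
  hence "(\<integral>\<^sup>+\<omega>. ennreal (f (cuts \<omega>, st \<omega>)) \<partial>M) = ennreal (\<integral>\<omega>. f (cuts \<omega>, st \<omega>) \<partial>M)"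
    using f01 by (intro nn_integral_eq_integral) auto
  with le have "ennreal (\<integral>\<omega>. f (cuts \<omega>, st \<omega>) \<partial>M) \<le> ennreal (\<eta> + prob few)" by (simp only:)
  hence "(\<integral>\<omega>. f (cuts \<omega>, st \<omega>) \<partial>M) \<le> \<eta> + prob few"
    by (subst (asm) ennreal_le_iff) (use \<eta> in auto)
  also have "(\<integral>\<omega>. f (cuts \<omega>, st \<omega>) \<partial>M) = (\<integral>\<omega>. (Q \<omega> - log B s)\<^sup>2 \<partial>M)"
    unfolding f_def fst_conv snd_conv Q g_def ..
  also have "\<eta> + prob few \<le> \<eta> + 4 * (real (tree_size k m))\<^sup>2 / real R"
    using few(2) by simp
  finally show "(\<integral>\<omega>. (Q \<omega> - log B s)\<^sup>2 \<partial>M) \<le> e + (2 * real (tree_size k (2 * n)) / real m)\<^sup>2 +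
       (2 * real (2 * n * k ^ n) + 4 * (real (tree_size k m))\<^sup>2) / real R"
    by (simp add: \<eta>_def add_divide_distrib)
qed

text \<open>The mean square error splits into the variance and the squared bias.\<close>

lemma (in prob_space) moments_bounded_by_square_error:
  fixes Q :: "'a \<Rightarrow> real"
  assumes [measurable]: "Q \<in> borel_measurable M" and bnd: "\<And>\<omega>. 0 \<le> Q \<omega>" "\<And>\<omega>. Q \<omega> \<le> 1"
  shows "(expectation Q - g)\<^sup>2 \<le> expectation (\<lambda>\<omega>. (Q \<omega> - g)\<^sup>2)"
    and "variance Q \<le> expectation (\<lambda>\<omega>. (Q \<omega> - g)\<^sup>2)"
proof -
  have i1: "integrable M Q" using bnd by (intro integrable_const_bound[where B = 1]) auto
  have i2: "integrable M (\<lambda>\<omega>. (Q \<omega>)\<^sup>2)"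
    using bnd by (intro integrable_const_bound[where B = 1]) (auto simp: power_le_one)
  have "expectation (\<lambda>\<omega>. (Q \<omega> - g)\<^sup>2) = expectation (\<lambda>\<omega>. (Q \<omega>)\<^sup>2 - 2 * g * Q \<omega> + g\<^sup>2)"
    by (simp add: power2_diff algebra_simps)
  also have "\<dots> = expectation (\<lambda>\<omega>. (Q \<omega>)\<^sup>2) - 2 * g * expectation Q + g\<^sup>2"
    using i1 i2 by (simp add: prob_space)
  also have "\<dots> = variance Q + (expectation Q - g)\<^sup>2"
    using variance_eq[OF i1 i2] by (simp add: power2_diff algebra_simps)
  finally have "expectation (\<lambda>\<omega>. (Q \<omega> - g)\<^sup>2) = variance Q + (expectation Q - g)\<^sup>2" .
  moreover have "0 \<le> variance Q" by simp
  ultimately show "(expectation Q - g)\<^sup>2 \<le> expectation (\<lambda>\<omega>. (Q \<omega> - g)\<^sup>2)"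
    "variance Q \<le> expectation (\<lambda>\<omega>. (Q \<omega> - g)\<^sup>2)" by auto
qed

theorem theorem1p7:
  fixes k :: nat and L :: real and D :: "(nat \<Rightarrow> real) measure"
    and M :: "nat \<Rightarrow> 'a measure"
    and X :: "nat \<Rightarrow> stick \<Rightarrow> 'a \<Rightarrow> nat \<Rightarrow> real"
    and A :: "nat \<Rightarrow> stick \<Rightarrow> 'a \<Rightarrow> bool"
    and P :: "nat \<Rightarrow> real \<Rightarrow> real \<Rightarrow> 'a \<Rightarrow> real"
  defines "P \<equiv> \<lambda>R B s \<omega>. significand_proportion B s
                 (ending_lengths k R L (\<lambda>v. X R v \<omega>) (\<lambda>v. A R v \<omega>))"
  assumes "k \<ge> 2" and "L > 0" and "good_distribution (k - 1) D"
    and "\<And>R. R \<ge> 1 \<Longrightarrow> fragmentation_process k (1 / real k) D R (M R) (X R) (A R)"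
  shows "(\<forall>R\<ge>1. AE \<omega> in M R. \<exists>n. living_sticks k R (\<lambda>v. A R v \<omega>) n = {}) \<and>
         (\<forall>B>1. \<forall>s\<in>{1..<B}.
            (\<lambda>R. prob_space.expectation (M R) (P R B s)) \<longlonglongrightarrow> log B s \<and>
            (\<lambda>R. prob_space.variance (M R) (P R B s)) \<longlonglongrightarrow> 0)"
proof (intro conjI allI impI ballI)
  note k = assms(2) and L = assms(3) and D = assms(4) and process = assms(5)
  show "AE \<omega> in M R. \<exists>n. living_sticks k R (\<lambda>v. A R v \<omega>) n = {}" if "1 \<le> R" for R
    by (rule branching.AE_extinction[OF fragmentation_process_branching[OF k process[OF that]]])
  fix B s :: real
  assume B: "1 < B" and "s \<in> {1..<B}"
  hence s: "1 \<le> s" "s < B" by auto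
  define E where "E = (\<lambda>R. \<integral>\<omega>. (P R B s \<omega> - log B s)\<^sup>2 \<partial>M R)"
  have E0: "0 \<le> E R" for R by (simp add: E_def)
  have ev: "\<forall>\<^sub>F R in sequentially. E R < e" if e: "0 < e" for e
  proof -
    have "0 < e / 4" using e by simp
    obtain n where n: "\<And>(M :: 'a measure) R X L v v'. stick_cuts M k R D X \<Longrightarrow> 0 < L \<Longrightarrow>
       v \<in> sticks k R \<Longrightarrow> v' \<in> sticks k R \<Longrightarrow> private_tail n v v' \<Longrightarrow>
       \<bar>\<integral>\<omega>. (below k L B s (\<lambda>v\<in>sticks k R. X v \<omega>) v - log B s) * (below k L B s (\<lambda>v\<in>sticks k R. X v \<omega>) v' - log B s) \<partial>M\<bar> \<le> e / 4"
      using below_decorrelated[OF D B s \<open>0 < e / 4\<close>, where 'a = 'a] by blast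
    have "(\<lambda>m. (2 * real (tree_size k (2 * n)) / real m)\<^sup>2) \<longlonglongrightarrow> 0\<^sup>2"
      by (intro tendsto_power lim_const_over_n)
    hence "\<forall>\<^sub>F m in sequentially. (2 * real (tree_size k (2 * n)) / real m)\<^sup>2 < e / 4"
      by (rule order_tendstoD(2)) (use e in simp)
    hence "\<forall>\<^sub>F m in sequentially. 1 \<le> m \<and> (2 * real (tree_size k (2 * n)) / real m)\<^sup>2 < e / 4"
      using eventually_ge_at_top[of "1::nat"] by eventually_elim auto
    then obtain m where m: "1 \<le> m" "(2 * real (tree_size k (2 * n)) / real m)\<^sup>2 < e / 4"
      by (auto simp: eventually_sequentially)
    have "(\<lambda>R. (2 * real (2 * n * k ^ n) + 4 * (real (tree_size k m))\<^sup>2) / real R) \<longlonglongrightarrow> 0"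
      by (rule lim_const_over_n)
    hence "\<forall>\<^sub>F R in sequentially. (2 * real (2 * n * k ^ n) + 4 * (real (tree_size k m))\<^sup>2) / real R < e / 4"
      by (rule order_tendstoD(2)) (use e in simp)
    thus ?thesis using eventually_ge_at_top[of "1::nat"]
    proof eventually_elim
      case (elim R)
      have "E R \<le> e / 4 + (2 * real (tree_size k (2 * n)) / real m)\<^sup>2 +
         (2 * real (2 * n * k ^ n) + 4 * (real (tree_size k m))\<^sup>2) / real R"
        unfolding E_def P_def
        by (rule second_moment_bound(2)[OF k L D process[OF elim(2)] elim(2) m(1) B s])
           (use e n[OF fragmentation_process_stick_cuts[OF k D process[OF elim(2)]] L] in auto)
      thus ?case using elim(1) m(2) e by linarith
    qed
  qed
  have "E \<longlonglongrightarrow> 0"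
    using ev E0 by (intro order_tendstoI) (auto intro: always_eventually less_le_trans)
  have "\<forall>\<^sub>F R in sequentially. (prob_space.expectation (M R) (P R B s) - log B s)\<^sup>2 \<le> E R \<and>
      0 \<le> prob_space.variance (M R) (P R B s) \<and> prob_space.variance (M R) (P R B s) \<le> E R"
    using eventually_ge_at_top[of "1::nat"]
  proof eventually_elim
    case (elim R)
    interpret prob_space "M R" using process[OF elim] by (simp add: fragmentation_process_def Let_def)
    have meas: "P R B s \<in> borel_measurable (M R)"
    proof -
      obtain n where n: "\<And>(M :: 'a measure) R X L v v'. stick_cuts M k R D X \<Longrightarrow> 0 < L \<Longrightarrow>
         v \<in> sticks k R \<Longrightarrow> v' \<in> sticks k R \<Longrightarrow> private_tail n v v' \<Longrightarrow>
         \<bar>\<integral>\<omega>. (below k L B s (\<lambda>v\<in>sticks k R. X v \<omega>) v - log B s) * (below k L B s (\<lambda>v\<in>sticks k R. X v \<omega>) v' - log B s) \<partial>M\<bar> \<le> 1"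
        using below_decorrelated[OF D B s zero_less_one, where 'a = 'a] by blast
      show ?thesis unfolding P_def
        by (rule second_moment_bound(1)[OF k L D process[OF elim] elim order_refl B s zero_le_one])
           (use n[OF fragmentation_process_stick_cuts[OF k D process[OF elim]] L] in auto)
    qed
    have bnd: "0 \<le> P R B s \<omega>" "P R B s \<omega> \<le> 1" for \<omega>
      unfolding P_def significand_proportion_eq by (rule mean_below_bounds)+
    show ?case
      using moments_bounded_by_square_error[OF meas bnd, of "log B s"] unfolding E_def by simp
  qed
  hence le: "\<forall>\<^sub>F R in sequentially. (prob_space.expectation (M R) (P R B s) - log B s)\<^sup>2 \<le> E R"
    "\<forall>\<^sub>F R in sequentially. 0 \<le> prob_space.variance (M R) (P R B s)"
    "\<forall>\<^sub>F R in sequentially. prob_space.variance (M R) (P R B s) \<le> E R"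
    by (auto elim: eventually_mono)
  show "(\<lambda>R. prob_space.variance (M R) (P R B s)) \<longlonglongrightarrow> 0"
    by (rule tendsto_sandwich[OF le(2,3) tendsto_const \<open>E \<longlonglongrightarrow> 0\<close>])
  have "(\<lambda>R. (prob_space.expectation (M R) (P R B s) - log B s)\<^sup>2) \<longlonglongrightarrow> 0"
    by (rule tendsto_sandwich[OF _ le(1) tendsto_const \<open>E \<longlonglongrightarrow> 0\<close>]) simp
  hence "(\<lambda>R. prob_space.expectation (M R) (P R B s) - log B s) \<longlonglongrightarrow> 0" by simp
  thus "(\<lambda>R. prob_space.expectation (M R) (P R B s)) \<longlonglongrightarrow> log B s" by (simp only: LIM_zero_iff)
qed

end
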